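(* Let $R$ be a skew-invertible Hecke symmetry with generic parameter $q$ and of bi-rank $(m|0)$, $m\ge2$, and let $\tilde L$ be the generating matrix of the modified Reflection Equation algebra $\tilde{\mathcal L}(R)$. Then the characteristic polynomial $\tilde Q(t)$ of the matrix $\tilde L$ (for which $\tilde Q(\tilde L)=0$) is equal to $$\tilde Q(t)=q^m\,\mathrm{Tr}_{R(1\dots m)}\left(\mathcal P_-^{(m)}\prod_{k=1}^m\Big(q^{2(k-1)}\big(t-q^{-k+1}(k-1)_q\big)I-\tilde L_{\overline k}\Big)\right),$$ where the factors are placed in ascending order of $k$ from left to right.
   Context: Let $\mathbb K=\mathbb C$ or $\mathbb R$, $V$ a $\mathbb K$-vector space with $\dim V=N$ and basis $\{x_i\}$. A braiding is an operator $R:V^{\otimes 2}\to V^{\otimes 2}$ with $R_{12}R_{23}R_{12}=R_{23}R_{12}R_{23}$ on $V^{\otimes 3}$ (lower indices label the tensor factors on which an operator acts; $R_k:=R_{k\,k+1}$). It is a Hecke symmetry if $(qI-R)(q^{-1}I+R)=0$, $q\in\mathbb K$, $q^2\neq 1$; $q$ is generic, i.e. $q^n\ne 1$ for every nonzero integer $n$. Matrix of $R$: $R(x_i\otimes x_j)=R_{ij}^{kl}x_k\otimes x_l$ (summation over repeated indices; lower index = row, upper index = column). $R$ is skew-invertible if there is $\Psi:V^{\otimes 2}\to V^{\otimes 2}$ with $\mathrm{Tr}_2R_{12}\Psi_{23}=P_{13}$ ($P$ the flip), i.e. $R_{ij}^{kl}\Psi_{lp}^{jq}=\delta_i^q\delta_p^k$.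 Put $C=\mathrm{Tr}_2\Psi$, i.e. $C_i^j=\Psi_{ik}^{jk}$. The $R$-trace of an $N\times N$ matrix $M$ is $\mathrm{Tr}_RM=\mathrm{Tr}(CM)$, and $\mathrm{Tr}_{R(i_1\dots i_k)}X=\mathrm{Tr}_{i_1\dots i_k}(C_{i_1}\cdots C_{i_k}X)$. $k_q=(q^k-q^{-k})/(q-q^{-1})$. Skew-symmetrizers: $\mathcal P_-^{(1)}=I$, $\mathcal P_-^{(k)}=\frac1{k_q}\mathcal P_-^{(k-1)}\big(q^{k-1}I-(k-1)_qR_{k-1}\big)\mathcal P_-^{(k-1)}$, acting in positions $1,\dots,k$. Bi-rank: let $\bigwedge_R(V)=T(V)/\langle\mathrm{Im}(q^{-1}I+R)\rangle$ and $P_-(t)=\sum_k\dim\bigwedge_R^{(k)}(V)\,t^k$ (a rational function). Written in lowest terms, if its numerator has degree $m$ and its denominator degree $n$, the bi-rank of $R$ is $(m|n)$. The Reflection Equation algebra $\mathcal L(R)$ is the unital associative algebra generated by the entries of $L=\|l_i^j\|_{1\le i,j\le N}$ subject to $RL_1RL_1-L_1RL_1R=0$, $L_1=L\otimes I$. The modified algebra $\tilde{\mathcal L}(R)$ is generated by the entries of an $N\times N$ matrix $\tilde L$ subject to $R\tilde L_1R\tilde L_1-\tilde L_1R\tilde L_1R=R\tilde L_1-\tilde L_1R$. For $q^2\ne1$ the map $\tilde L\mapsto L+\frac1{q-q^{-1}}I$ is an algebra isomorphism $\tilde{\mathcal L}(R)\to\mathcal L(R)$, used to identify the two algebras. For $A=L$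 or $\tilde L$ put $A_{\overline 1}=A_1$, $A_{\overline k}=R_{k-1}A_{\overline{k-1}}R_{k-1}^{-1}$ for $k\ge2$. The characteristic polynomial of $L$ is $Q(t)=\sum_{k=0}^mt^{m-k}(-q)^ke_k(L)$, with $e_0(L)=1$, $e_k(L)=\mathrm{Tr}_{R(1\dots k)}(\mathcal P_-^{(k)}L_{\overline1}\cdots L_{\overline k})$ (central elements); it satisfies the Cayley–Hamilton identity $Q(L)=0$. The characteristic polynomial of $\tilde L$ is the corresponding monic polynomial of degree $m$ with central coefficients under the identification of $\tilde{\mathcal L}(R)$ with $\mathcal L(R)$ given by the isomorphism $\tilde L\mapsto L+\frac1{q-q^{-1}}I$, $\tilde Q(t)=Q\big(t-\tfrac1{q-q^{-1}}\big)$. *)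

theory Defs
  imports
    "HOL-Analysis.Analysis"
    "HOL-Library.Poly_Mapping"
    "HOL-Computational_Algebra.Polynomial_FPS"
begin

text \<open>
  The monoid algebra of the free monoid on \<open>'g\<close> over \<open>'k\<close> is the free unital associative algebra.
  A list-like type is introduced because the multiplication of \<open>poly_mapping\<close> is the convolution
  with respect to the additive monoid structure of the index type.
\<close>

datatype 'g fword = Word (letters: "'g list")

instantiation fword :: (type) monoid_add
begin

definition "0 = Word []"

definition "u + v = Word (letters u @ letters v)"

instance
  by standard (auto simp: zero_fword_def plus_fword_def)

end

type_synonym ('g, 'k) free_algebra = "'g fword \<Rightarrow>\<^sub>0 'k"

definition gen :: "'g \<Rightarrow> ('g, 'k::zero_neq_one) free_algebra" where
  "gen g = Poly_Mapping.single (Word [g]) 1"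

definition scal :: "'k \<Rightarrow> ('g, 'k::zero) free_algebra" where
  "scal c = Poly_Mapping.single 0 c"

inductive_set two_sided_ideal :: "'a::ring_1 set \<Rightarrow> 'a set" for G where
  zero: "0 \<in> two_sided_ideal G"
| step: "x \<in> two_sided_ideal G \<Longrightarrow> g \<in> G \<Longrightarrow> x + a * g * b \<in> two_sided_ideal G"

text \<open>
  \<open>A[t]\<close> for a noncommutative ring \<open>A\<close>, with \<open>t\<close> central. The type \<open>'a poly\<close> is not available here
  because its multiplication requires commutative coefficients.
\<close>

type_synonym 'a cpoly = "nat \<Rightarrow>\<^sub>0 'a"

definition cvar :: "'a::zero_neq_one cpoly" where
  "cvar = Poly_Mapping.single 1 1"

definition const :: "'a \<Rightarrow> 'a::zero cpoly" where
  "const a = Poly_Mapping.single 0 a"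

text \<open>
  The type \<open>'n\<close> indexes the basis \<open>x\<^sub>i\<close> of \<open>V\<close>, so \<open>N = CARD('n)\<close>. Lower indices are rows and upper
  indices are columns: \<open>R $ (i,j) $ (k,l)\<close> is \<open>R\<^sub>i\<^sub>j\<^sup>k\<^sup>l\<close>. The basis of the \<open>n\<close>-th tensor power of \<open>V\<close>
  is indexed by the lists of length \<open>n\<close>; the values of a \<open>tensor_op\<close> at lists of other lengths are
  irrelevant. The entries lie in a possibly noncommutative ring. Tensor positions are counted from 1.
\<close>

type_synonym ('n, 'a) tensor_op = "'n list \<Rightarrow> 'n list \<Rightarrow> 'a"

type_synonym ('n, 'a) matrix1 = "'a ^ 'n ^ 'n"

type_synonym ('n, 'a) matrix2 = "'a ^ ('n \<times> 'n) ^ ('n \<times> 'n)"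

definition tone :: "('n, 'a::zero_neq_one) tensor_op" where
  "tone I J = (if I = J then 1 else 0)"

definition tmul :: "nat \<Rightarrow> ('n, 'a::semiring_0) tensor_op \<Rightarrow> ('n, 'a) tensor_op \<Rightarrow> ('n, 'a) tensor_op" where
  "tmul n A B I J = (\<Sum>K | length K = n. A I K * B K J)"

definition tprod :: "nat \<Rightarrow> ('n, 'a::semiring_1) tensor_op list \<Rightarrow> ('n, 'a) tensor_op" where
  "tprod n As = foldr (tmul n) As tone"

definition ttrace :: "nat \<Rightarrow> ('n, 'a::comm_monoid_add) tensor_op \<Rightarrow> 'a" where
  "ttrace n A = (\<Sum>I | length I = n. A I I)"

definition tlift :: "('k \<Rightarrow> 'a) \<Rightarrow> ('n, 'k) tensor_op \<Rightarrow> ('n, 'a) tensor_op" where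
  "tlift \<iota> A I J = \<iota> (A I J)"

text \<open>\<open>at1 p M\<close> is \<open>M\<^sub>p\<close>, and \<open>at2 p M\<close> is \<open>M\<close> acting in the positions \<open>p\<close>, \<open>p + 1\<close>.\<close>

definition at1 :: "nat \<Rightarrow> ('n::finite, 'a::zero) matrix1 \<Rightarrow> ('n, 'a) tensor_op" where
  "at1 p M I J =
    (if \<forall>r<length I. Suc r \<noteq> p \<longrightarrow> I ! r = J ! r
     then M $ (I ! (p - 1)) $ (J ! (p - 1)) else 0)"

definition at2 :: "nat \<Rightarrow> ('n::finite, 'a::zero) matrix2 \<Rightarrow> ('n, 'a) tensor_op" where
  "at2 p M I J =
    (if \<forall>r<length I. Suc r \<noteq> p \<and> Suc r \<noteq> Suc p \<longrightarrow> I ! r = J ! r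
     then M $ (I ! (p - 1), I ! p) $ (J ! (p - 1), J ! p) else 0)"

text \<open>
  The definitions make sense over any field. The ground fields \<open>\<real>\<close> and \<open>\<complex>\<close> are treated uniformly by
  the class \<open>real_normed_field\<close>: both are instances, and by the Gelfand--Mazur theorem every instance
  is isomorphic to one of them.
\<close>

definition generic :: "'k::field \<Rightarrow> bool" where
  "generic q \<longleftrightarrow> q \<noteq> 0 \<and> (\<forall>n::int. n \<noteq> 0 \<longrightarrow> q powi n \<noteq> 1)"

definition qnum :: "'k::field \<Rightarrow> nat \<Rightarrow> 'k" where
  "qnum q k = (q ^ k - inverse q ^ k) / (q - inverse q)"

definition braiding :: "('n::finite, 'k::field) matrix2 \<Rightarrow> bool" where
  "braiding R \<longleftrightarrow>
    (\<forall>I J. length I = 3 \<and> length J = 3 \<longrightarrow>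
      tprod 3 [at2 1 R, at2 2 R, at2 1 R] I J = tprod 3 [at2 2 R, at2 1 R, at2 2 R] I J)"

definition hecke_symmetry :: "'k \<Rightarrow> ('n::finite, 'k::field) matrix2 \<Rightarrow> bool" where
  "hecke_symmetry q R \<longleftrightarrow>
    q \<noteq> 0 \<and> q\<^sup>2 \<noteq> 1 \<and> braiding R \<and> (mat q - R) ** (mat (inverse q) + R) = 0"

definition skew_inverse :: "('n::finite, 'k::field) matrix2 \<Rightarrow> ('n, 'k) matrix2 \<Rightarrow> bool" where
  "skew_inverse R \<Psi> \<longleftrightarrow>
    (\<forall>i k p s. (\<Sum>j\<in>UNIV. \<Sum>l\<in>UNIV. R $ (i, j) $ (k, l) * \<Psi> $ (l, p) $ (j, s))
      = (if i = s \<and> p = k then 1 else 0))"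

definition Cmat :: "('n::finite, 'k::field) matrix2 \<Rightarrow> ('n, 'k) matrix1" where
  "Cmat \<Psi> = (\<chi> i j. \<Sum>k\<in>UNIV. \<Psi> $ (i, k) $ (j, k))"

text \<open>\<open>skew_symm q R n k\<close> is \<open>P\<^sub>-\<^sup>(\<^sup>k\<^sup>)\<close> as an operator on the \<open>n\<close>-th tensor power, for \<open>k \<le> n\<close>.\<close>

primrec skew_symm :: "'k \<Rightarrow> ('n::finite, 'k::field) matrix2 \<Rightarrow> nat \<Rightarrow> nat \<Rightarrow> ('n, 'k) tensor_op" where
  "skew_symm q R n 0 = tone"
| "skew_symm q R n (Suc k) =
    (if k = 0 then tone
     else (\<lambda>I J. inverse (qnum q (Suc k)) *
       tprod n [skew_symm q R n k,
                \<lambda>I J. q ^ k * tone I J - qnum q k * at2 k R I J,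
                skew_symm q R n k] I J))"

text \<open>
  The tensor algebra of \<open>V\<close> is the free algebra on the basis of \<open>V\<close>. The ideal generated by
  \<open>Im (q\<^sup>-\<^sup>1 I + R)\<close> is generated by the images of the basis elements \<open>x\<^sub>i x\<^sub>j\<close>. The degree \<open>k\<close> component
  of the quotient has dimension \<open>dim T\<^sup>k - dim (J \<inter> T\<^sup>k)\<close>, where \<open>J\<close> is this ideal.
\<close>

definition wedge_ideal :: "'k \<Rightarrow> ('n::finite, 'k::field) matrix2 \<Rightarrow> ('n, 'k) free_algebra set" where
  "wedge_ideal q R = two_sided_ideal (range (\<lambda>(i, j).
    scal (inverse q) * gen i * gen j +
    (\<Sum>k\<in>UNIV. \<Sum>l\<in>UNIV. scal (R $ (i, j) $ (k, l)) * gen k * gen l)))"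

definition tensor_degree :: "nat \<Rightarrow> ('n, 'k::field) free_algebra set" where
  "tensor_degree k = {x. \<forall>w\<in>Poly_Mapping.keys x. length (letters w) = k}"

definition free_dim :: "('n, 'k::field) free_algebra set \<Rightarrow> nat" where
  "free_dim S = vector_space.dim (\<lambda>c x. scal c * x) S"

definition wedge_dim :: "'k \<Rightarrow> ('n::finite, 'k::field) matrix2 \<Rightarrow> nat \<Rightarrow> nat" where
  "wedge_dim q R k =
    free_dim (tensor_degree k :: ('n, 'k) free_algebra set)
    - free_dim (wedge_ideal q R \<inter> tensor_degree k)"

definition bi_rank :: "'k \<Rightarrow> ('n::finite, 'k::field) matrix2 \<Rightarrow> nat \<Rightarrow> nat \<Rightarrow> bool" where
  "bi_rank q R m n \<longleftrightarrow>
    (\<exists>num den :: rat poly. coprime num den \<and> den \<noteq> 0 \<and> degree num = m \<and> degree den = n \<and>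
      fps_of_poly den * Abs_fps (\<lambda>k. of_nat (wedge_dim q R k)) = fps_of_poly num)"

text \<open>
  From here on \<open>\<iota>\<close> is the embedding of the ground field into the ring of matrix entries.
  \<open>bar_copy \<iota> R n A k\<close> is \<open>A\<close> with the barred index \<open>k\<close>, acting on the \<open>n\<close>-th tensor power; the
  index 0 is never used.
\<close>

primrec bar_copy :: "('k \<Rightarrow> 'a) \<Rightarrow> ('n::finite, 'k::field) matrix2 \<Rightarrow> nat \<Rightarrow>
    ('n, 'a::ring_1) matrix1 \<Rightarrow> nat \<Rightarrow> ('n, 'a) tensor_op" where
  "bar_copy \<iota> R n A 0 = at1 1 A"
| "bar_copy \<iota> R n A (Suc k) =
    (if k = 0 then at1 1 A
     else tprod n [tlift \<iota> (at2 k R), bar_copy \<iota> R n A k, tlift \<iota> (at2 k (matrix_inv R))])"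

definition R_trace :: "('k \<Rightarrow> 'a) \<Rightarrow> ('n::finite, 'k::field) matrix2 \<Rightarrow> nat \<Rightarrow>
    ('n, 'a::ring_1) tensor_op \<Rightarrow> 'a" where
  "R_trace \<iota> \<Psi> k X =
    ttrace k (tmul k (tlift \<iota> (tprod k (map (\<lambda>i. at1 i (Cmat \<Psi>)) [1..<Suc k]))) X)"

definition elem_symm :: "('k \<Rightarrow> 'a) \<Rightarrow> 'k \<Rightarrow> ('n::finite, 'k::field) matrix2 \<Rightarrow> ('n, 'k) matrix2 \<Rightarrow>
    ('n, 'a::ring_1) matrix1 \<Rightarrow> nat \<Rightarrow> 'a" where
  "elem_symm \<iota> q R \<Psi> L k =
    (if k = 0 then 1
     else R_trace \<iota> \<Psi> k
       (tmul k (tlift \<iota> (skew_symm q R k k)) (tprod k (map (bar_copy \<iota> R k L) [1..<Suc k]))))"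

text \<open>\<open>Q(s)\<close>, where \<open>s\<close> is an element of \<open>A[t]\<close>.\<close>

definition char_poly_at :: "('k \<Rightarrow> 'a) \<Rightarrow> 'k \<Rightarrow> ('n::finite, 'k::field) matrix2 \<Rightarrow> ('n, 'k) matrix2 \<Rightarrow>
    nat \<Rightarrow> ('n, 'a::ring_1) matrix1 \<Rightarrow> 'a cpoly \<Rightarrow> 'a cpoly" where
  "char_poly_at \<iota> q R \<Psi> m L s =
    (\<Sum>k\<le>m. s ^ (m - k) * const (\<iota> ((- q) ^ k) * elem_symm \<iota> q R \<Psi> L k))"

primrec mpow :: "('n::finite, 'a::ring_1) matrix1 \<Rightarrow> nat \<Rightarrow> ('n, 'a) matrix1" where
  "mpow L 0 = mat 1"
| "mpow L (Suc r) = L ** mpow L r"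

text \<open>
  Evaluation of a polynomial at a matrix, with the coefficients to the right of the matrix powers. For
  the characteristic polynomials below the coefficients are central in the quotient, so that the side
  does not matter there.
\<close>

definition eval_at_matrix :: "'a cpoly \<Rightarrow> ('n::finite, 'a::ring_1) matrix1 \<Rightarrow> ('n, 'a) matrix1" where
  "eval_at_matrix Q L =
    (\<chi> i j. \<Sum>r\<in>Poly_Mapping.keys Q. mpow L r $ i $ j * Poly_Mapping.lookup Q r)"

text \<open>
  The algebra is the quotient of the free algebra on the symbols \<open>(i, j)\<close>, standing for the entries
  of the generating matrix, by the ideal \<open>mre_ideal R\<close>. Its elements are given by representatives;
  two representatives are equal in the algebra if their difference lies in the ideal.
\<close>

type_synonym ('n, 'k) entry_algebra = "('n \<times> 'n, 'k) free_algebra"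

definition gen_matrix :: "('n::finite, ('n, 'k::field) entry_algebra) matrix1" where
  "gen_matrix = (\<chi> i j. gen (i, j))"

definition first_copy :: "('n::finite, 'a::ring_1) matrix1 \<Rightarrow> ('n, 'a) matrix2" where
  "first_copy A = (\<chi> u v. if snd u = snd v then A $ fst u $ fst v else 0)"

definition mre_relations :: "('n::finite, 'k::field) matrix2 \<Rightarrow> ('n, ('n, 'k) entry_algebra) matrix2" where
  "mre_relations R =
    (let S = map_matrix scal R; L = first_copy gen_matrix
     in (S ** L ** S ** L - L ** S ** L ** S) - (S ** L - L ** S))"

definition mre_ideal :: "('n::finite, 'k::field) matrix2 \<Rightarrow> ('n, 'k) entry_algebra set" where
  "mre_ideal R = two_sided_ideal (range (\<lambda>(u, v). mre_relations R $ u $ v))"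

definition mre_eq :: "('n::finite, 'k::field) matrix2 \<Rightarrow>
    ('n, 'k) entry_algebra \<Rightarrow> ('n, 'k) entry_algebra \<Rightarrow> bool" where
  "mre_eq R a b \<longleftrightarrow> a - b \<in> mre_ideal R"

definition mre_poly_eq :: "('n::finite, 'k::field) matrix2 \<Rightarrow>
    ('n, 'k) entry_algebra cpoly \<Rightarrow> ('n, 'k) entry_algebra cpoly \<Rightarrow> bool" where
  "mre_poly_eq R P Q \<longleftrightarrow> (\<forall>r. mre_eq R (Poly_Mapping.lookup P r) (Poly_Mapping.lookup Q r))"

definition mre_matrix_eq :: "('n::finite, 'k::field) matrix2 \<Rightarrow>
    ('n, ('n, 'k) entry_algebra) matrix1 \<Rightarrow> ('n, ('n, 'k) entry_algebra) matrix1 \<Rightarrow> bool" where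
  "mre_matrix_eq R A B \<longleftrightarrow> (\<forall>i j. mre_eq R (A $ i $ j) (B $ i $ j))"

text \<open>
  The matrix \<open>L\<close> of the unmodified algebra, transported along the isomorphism
  \<open>L\<^sup>~ \<mapsto> L + (q - q\<^sup>-\<^sup>1)\<^sup>-\<^sup>1 I\<close>, and \<open>Q\<^sup>~(t) = Q(t - (q - q\<^sup>-\<^sup>1)\<^sup>-\<^sup>1)\<close>.
\<close>

definition re_matrix :: "'k \<Rightarrow> ('n::finite, ('n, 'k::field) entry_algebra) matrix1" where
  "re_matrix q = gen_matrix - mat (scal (inverse (q - inverse q)))"

definition mre_char_poly :: "'k \<Rightarrow> ('n::finite, 'k::field) matrix2 \<Rightarrow> ('n, 'k) matrix2 \<Rightarrow> nat \<Rightarrow>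
    ('n, 'k) entry_algebra cpoly" where
  "mre_char_poly q R \<Psi> m =
    char_poly_at scal q R \<Psi> m (re_matrix q) (cvar - const (scal (inverse (q - inverse q))))"

definition cscal :: "'k \<Rightarrow> ('n, 'k::field) entry_algebra cpoly" where
  "cscal c = const (scal c)"

text \<open>
  The factor \<open>q\<^bsup>2(k-1)\<^esup> (t - q\<^bsup>-k+1\<^esup> (k-1)\<^sub>q) I - L\<^sup>~\<close> with the barred index \<open>k\<close> on the last matrix,
  for \<open>k \<ge> 1\<close>, on the \<open>m\<close>-th tensor power.
\<close>

definition mre_factor :: "'k \<Rightarrow> ('n::finite, 'k::field) matrix2 \<Rightarrow> nat \<Rightarrow> nat \<Rightarrow>
    ('n, ('n, 'k) entry_algebra cpoly) tensor_op" where
  "mre_factor q R m k I J =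
    cscal (q ^ (2 * (k - 1))) * (cvar - cscal (inverse q ^ (k - 1) * qnum q (k - 1))) * tone I J
    - bar_copy cscal R m (map_matrix const gen_matrix) k I J"

end

theory Submission
  imports Defs
begin

text \<open>
  Write \<open>h = 1 / (q - q\<^sup>-\<^sup>1)\<close> and \<open>s = t - h\<close>, and let \<open>[k]\<close> be the quantum integers. Since
  \<open>L\<^sup>~ = L + h\<close>, the \<open>k\<close>-th factor of the product is \<open>q\<^bsup>2(k-1)\<^esup> s - L\<^sub>k\<close>, where \<open>L\<^sub>k\<close> is the copy of
  \<open>L\<close> with the barred index \<open>k\<close>, and the claim is a formula for \<open>Q(s)\<close>.

  \<^emph>\<open>The product formula.\<close> Let \<open>T(X)\<close> be the R-trace of \<open>P\<^sub>-\<^sup>(\<^sup>m\<^sup>) X\<close>. The generators \<open>R\<^sub>i\<close> act on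
  \<open>P\<^sub>-\<^sup>(\<^sup>m\<^sup>)\<close> by the scalar \<open>- q\<^sup>-\<^sup>1\<close> from both sides and the R-trace is cyclic with respect to them, so
  that \<open>T(R\<^sub>i X R\<^sub>i\<^sup>-\<^sup>1) = T(X)\<close> (\<open>T_conj\<close>). As \<open>L\<^sub>k\<^sub>+\<^sub>1 = R\<^sub>k L\<^sub>k R\<^sub>k\<^sup>-\<^sup>1\<close>, an ordered product of \<open>j\<close> of the
  copies has the same value under \<open>T\<close> as \<open>L\<^sub>1 \<cdots> L\<^sub>j\<close> (\<open>T_lp_ell\<close>). Hence the coefficient of
  \<open>s\<^bsup>m-j\<^esup>\<close> in \<open>T(\<Prod>(q\<^bsup>2(k-1)\<^esup> s - L\<^sub>k))\<close> is \<open>T(L\<^sub>1 \<cdots> L\<^sub>j)\<close> times a weighted count of subsets, a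
  Gaussian binomial (\<open>T_pf\<close>, \<open>cc_closed\<close>). Tracing \<open>P\<^sub>-\<^sup>(\<^sup>m\<^sup>)\<close> over the positions \<open>m, \<dots>, j + 1\<close> gives
  \<open>T(L\<^sub>1 \<cdots> L\<^sub>j) = e\<^sub>j\<close> divided by the same binomial (\<open>tr_P_lp\<close>), and the powers of \<open>q\<close> match.

  \<^emph>\<open>The Cayley-Hamilton identity.\<close> Since \<open>P\<^sub>-\<^sup>(\<^sup>m\<^sup>+\<^sup>1\<^sup>) = 0\<close>, the R-trace of
  \<open>P\<^sub>-\<^sup>(\<^sup>m\<^sup>+\<^sup>1\<^sup>) L\<^sub>2 \<cdots> L\<^sub>m\<^sub>+\<^sub>1\<close> over all positions but the first is zero. Writing \<open>P\<^sub>-\<^sup>(\<^sup>m\<^sup>+\<^sup>1\<^sup>)\<close> through \<open>R\<^sub>1\<close>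
  and the skew-symmetrizer \<open>P\<close> in the positions \<open>2, \<dots>, m + 1\<close>, and using that \<open>R\<^sub>i\<close> commutes with
  \<open>L\<^sub>iL\<^sub>i\<^sub>+\<^sub>1\<close> modulo the relations, this trace becomes a combination \<open>G\<^sub>m\<close> of \<open>e\<^sub>m\<close> and of the trace of
  \<open>R\<^sub>1\<^sup>-\<^sup>1 L\<^sub>2 \<cdots> L\<^sub>m\<^sub>+\<^sub>1 P\<close> (\<open>G_trace\<close>). The analogous combinations \<open>G\<^sub>k\<close> satisfy, up to constant factors,
  the recursion \<open>G\<^sub>k = q\<^sup>k e\<^sub>k - L G\<^sub>k\<^sub>-\<^sub>1\<close> (\<open>G_step\<close>), so that \<open>G\<^sub>m\<close> is a nonzero multiple of \<open>Q(L)\<close>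
  (\<open>G_expansion\<close>, \<open>cayley_hamilton\<close>).

  \<^emph>\<open>The bi-rank.\<close> It enters through \<open>P\<^sub>-\<^sup>(\<^sup>m\<^sup>+\<^sup>1\<^sup>) = 0 \<noteq> P\<^sub>-\<^sup>(\<^sup>m\<^sup>)\<close>: the \<open>k\<close>-th exterior power vanishes iff
  \<open>P\<^sub>-\<^sup>(\<^sup>k\<^sup>)\<close> does. Tracing the vanishing \<open>P\<^sub>-\<^sup>(\<^sup>m\<^sup>+\<^sup>1\<^sup>)\<close> over the last position gives
  \<open>Tr C = q\<^sup>-\<^sup>m [m]\<close> (\<open>trace_one\<close>), the value on which all the partial traces depend.

  Both computations take place in a tower of algebras with conditional expectations; its axioms are
  the properties of the R-trace (\<open>markov_tower\<close>). The tower is realized by operators on an infinite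
  tensor power of \<open>V\<close>, so that all the finite tensor powers live in one ring.
\<close>

section \<open>Quantum integers\<close>

lemma generic_nonzero [simp]: "generic q \<Longrightarrow> q \<noteq> 0"
  by (simp add: generic_def)

lemma generic_power: "generic q \<Longrightarrow> n > 0 \<Longrightarrow> q ^ n \<noteq> 1"
  unfolding generic_def by (metis power_int_of_nat of_nat_0_less_iff less_irrefl)

lemma generic_diff: "generic q \<Longrightarrow> q - inverse q \<noteq> 0"
  using generic_power[of q 2] by (auto simp: power2_eq_square field_simps)

lemma qnum_0 [simp]: "qnum q 0 = 0"
  by (simp add: qnum_def)

lemma qnum_1: "generic q \<Longrightarrow> qnum q (Suc 0) = 1"
  using generic_diff[of q] by (simp add: qnum_def)

lemma qnum_nonzero: assumes "generic q" "n > 0" shows "qnum q n \<noteq> 0"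
proof -
  have "q ^ n \<noteq> inverse q ^ n"
  proof
    assume "q ^ n = inverse q ^ n"
    then have "q ^ n * q ^ n = 1"
      using assms by (simp add: power_inverse) (metis generic_nonzero power_not_zero right_inverse)
    then have "q ^ (n + n) = 1" by (simp add: power_add)
    then show False using generic_power[of q "n + n"] assms by simp
  qed
  then show ?thesis using assms generic_diff[of q] by (simp add: qnum_def)
qed

lemma qnum_add:
  assumes "generic q"
  shows "qnum q (a + b) = q ^ a * qnum q b + inverse q ^ b * qnum q a"
proof -
  have "q \<noteq> 0" "q - inverse q \<noteq> 0" using assms generic_diff by auto
  then show ?thesis
    unfolding qnum_def by (simp add: divide_simps power_add) (simp add: algebra_simps)
qed

lemma qnum_Suc: "generic q \<Longrightarrow> qnum q (Suc k) = q ^ k + inverse q * qnum q k"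
  using qnum_add[of q k 1] by (simp add: qnum_1)

lemma q_qnum: "generic q \<Longrightarrow> k > 0 \<Longrightarrow> q * qnum q k = q ^ k + qnum q (k - 1)"
  by (cases k) (simp_all add: qnum_Suc algebra_simps)

section \<open>Skew-symmetrizers of Hecke algebras\<close>

locale scaled_ring = vector_space scl
  for scl :: "'k::field \<Rightarrow> 'r::ring_1 \<Rightarrow> 'r" (infixr "\<star>" 72) +
  assumes scl_left: "(c \<star> x) * y = c \<star> (x * y)"
    and scl_right: "x * (c \<star> y) = c \<star> (x * y)"
begin

primrec asym :: "'k \<Rightarrow> (nat \<Rightarrow> 'r) \<Rightarrow> nat \<Rightarrow> 'r" where
  "asym q r 0 = 1"
| "asym q r (Suc k) =
    (if k = 0 then 1
     else inverse (qnum q (Suc k)) \<star>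
       (asym q r k * (q ^ k \<star> 1 - qnum q k \<star> r k) * asym q r k))"

definition hecke_upto :: "'k \<Rightarrow> (nat \<Rightarrow> 'r) \<Rightarrow> nat \<Rightarrow> bool" where
  "hecke_upto q r n \<longleftrightarrow>
    (\<forall>i. 1 \<le> i \<and> i < n \<longrightarrow> r i * r i = 1 + (q - inverse q) \<star> r i) \<and>
    (\<forall>i. 1 \<le> i \<and> Suc i < n \<longrightarrow> r i * r (Suc i) * r i = r (Suc i) * r i * r (Suc i)) \<and>
    (\<forall>i j. 1 \<le> i \<and> Suc i < j \<and> j < n \<longrightarrow> r i * r j = r j * r i)"

lemmas scl_simps = scl_left scl_right scale_right_distrib scale_right_diff_distrib

lemma asym_1 [simp]: "asym q r (Suc 0) = 1"
  by simp

lemma asym_Suc: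
  assumes "generic q"
  shows "qnum q (Suc k) \<star> asym q r (Suc k) = asym q r k * (q ^ k \<star> 1 - qnum q k \<star> r k) * asym q r k"
  using qnum_nonzero[OF assms, of "Suc k"] by (cases "k = 0") (auto simp: qnum_1 assms)

declare asym.simps(2) [simp del]

lemma asym_cong: "(\<And>i. 1 \<le> i \<Longrightarrow> i < k \<Longrightarrow> r i = r' i) \<Longrightarrow> asym q r k = asym q r' k"
  by (induction k) (auto simp: asym.simps(2))

lemma asym_commute:
  assumes "\<And>i. 1 \<le> i \<Longrightarrow> i < k \<Longrightarrow> x * r i = r i * x"
  shows "x * asym q r k = asym q r k * x"
  using assms
proof (induction k)
  case (Suc k)
  have IH: "x * asym q r k = asym q r k * x" using Suc by simp
  show ?case
  proof (cases "k = 0")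
    case False
    let ?h = "q ^ k \<star> 1 - qnum q k \<star> r k"
    have h: "x * ?h = ?h * x"
      using Suc.prems[of k] False by (simp add: right_diff_distrib left_diff_distrib scl_simps)
    have "x * (asym q r k * ?h * asym q r k) = asym q r k * ?h * asym q r k * x"
      using IH h by (metis mult.assoc)
    then show ?thesis using False by (simp add: asym.simps(2) scl_simps)
  qed simp
qed simp

text \<open>
  If every generator acts by \<open>- q\<^sup>-\<^sup>1\<close>, then \<open>q\<^sup>k - [k] r\<^sub>k\<close> acts by \<open>q\<^sup>k + q\<^sup>-\<^sup>1 [k] = [k + 1]\<close>, which
  cancels the denominator of the skew-symmetrizer.
\<close>

lemma asym_fixes_right:
  assumes g: "generic q" and "\<And>i. 1 \<le> i \<Longrightarrow> i < k \<Longrightarrow> x * r i = - inverse q \<star> x"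
  shows "x * asym q r k = x"
  using assms(2)
proof (induction k)
  case (Suc k)
  show ?case
  proof (cases "k = 0")
    case False
    have IH: "x * asym q r k = x" using Suc by simp
    have "qnum q (Suc k) \<star> (x * asym q r (Suc k)) = x * (asym q r k * (q ^ k \<star> 1 - qnum q k \<star> r k) * asym q r k)"
      by (metis asym_Suc[OF g] scl_right)
    also have "\<dots> = x * (q ^ k \<star> 1 - qnum q k \<star> r k) * asym q r k"
      using IH by (metis mult.assoc)
    also have "x * (q ^ k \<star> 1 - qnum q k \<star> r k) = qnum q (Suc k) \<star> x"
      using Suc.prems[of k] False by (simp add: right_diff_distrib scl_simps qnum_Suc[OF g] scale_left_distrib mult.commute)
    also have "\<dots> * asym q r k = qnum q (Suc k) \<star> x" using IH by (simp add: scl_left)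
    finally show ?thesis using qnum_nonzero[OF g, of "Suc k"] by simp
  qed simp
qed simp

lemma asym_fixes_left:
  assumes g: "generic q" and "\<And>i. 1 \<le> i \<Longrightarrow> i < k \<Longrightarrow> r i * x = - inverse q \<star> x"
  shows "asym q r k * x = x"
  using assms(2)
proof (induction k)
  case (Suc k)
  show ?case
  proof (cases "k = 0")
    case False
    have IH: "asym q r k * x = x" using Suc by simp
    have "qnum q (Suc k) \<star> (asym q r (Suc k) * x) = asym q r k * (q ^ k \<star> 1 - qnum q k \<star> r k) * asym q r k * x"
      by (metis asym_Suc[OF g] scl_left)
    also have "\<dots> = asym q r k * ((q ^ k \<star> 1 - qnum q k \<star> r k) * x)"
      using IH by (metis mult.assoc)
    also have "(q ^ k \<star> 1 - qnum q k \<star> r k) * x = qnum q (Suc k) \<star> x"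
      using Suc.prems[of k] False by (simp add: left_diff_distrib scl_simps qnum_Suc[OF g] scale_left_distrib mult.commute)
    also have "asym q r k * \<dots> = qnum q (Suc k) \<star> x" using IH by (simp add: scl_right)
    finally show ?thesis using qnum_nonzero[OF g, of "Suc k"] by simp
  qed simp
qed simp

text \<open>
  This is the computation for \<open>asym_fixes_right\<close> modulo a subspace \<open>D\<close>. It serves to express the
  skew-symmetrizer as the identity up to elements in the left ideal generated by the \<open>r\<^sub>i + q\<^sup>-\<^sup>1\<close>.
\<close>

lemma asym_modulo:
  assumes g: "generic q"
    and D: "0 \<in> D" "\<And>x y. x \<in> D \<Longrightarrow> y \<in> D \<Longrightarrow> x + y \<in> D" "\<And>c x. x \<in> D \<Longrightarrow> c \<star> x \<in> D"
    and "\<And>x i. 1 \<le> i \<Longrightarrow> i < k \<Longrightarrow> x * r i + inverse q \<star> x \<in> D"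
  shows "x * asym q r k - x \<in> D"
  using assms(5)
proof (induction k arbitrary: x)
  case (Suc k)
  show ?case
  proof (cases "k = 0")
    case False
    let ?c = "qnum q (Suc k)" and ?y = "x * asym q r k"
    let ?z = "?y * (q ^ k \<star> 1 - qnum q k \<star> r k)"
    have "?z * asym q r k - ?z \<in> D" and "?c \<star> (?y - x) \<in> D"
      using Suc by (auto intro: D)
    moreover have "?z - ?c \<star> ?y = - qnum q k \<star> (?y * r k + inverse q \<star> ?y)"
      by (simp add: right_diff_distrib scl_right qnum_Suc[OF g] scale_right_distrib scale_left_distrib mult.commute)
    then have "?z - ?c \<star> ?y \<in> D" using Suc.prems[of k ?y] False by (simp add: D(3) del: scale_minus_left)
    ultimately have "(?z * asym q r k - ?z) + (?z - ?c \<star> ?y) + ?c \<star> (?y - x) \<in> D" by (intro D(2))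
    moreover have "?c \<star> (x * asym q r (Suc k)) = ?z * asym q r k"
      by (metis asym_Suc[OF g] scl_right mult.assoc)
    ultimately have "?c \<star> (x * asym q r (Suc k) - x) \<in> D"
      by (simp add: scale_right_diff_distrib)
    then have "inverse ?c \<star> (?c \<star> (x * asym q r (Suc k) - x)) \<in> D" by (rule D(3))
    then show ?thesis using qnum_nonzero[OF g, of "Suc k"] by simp
  qed (simp add: D)
qed (simp add: D)

text \<open>
  On the image of \<open>a + q\<^sup>-\<^sup>1\<close> the generator \<open>a\<close> acts by \<open>q\<close>, and \<open>q\<^sup>k - q [k] = - [k - 1]\<close>.
\<close>

lemma hecke_quadratic:
  assumes g: "generic q" and a: "a * a = 1 + (q - inverse q) \<star> a" and k: "k > 0"
  shows "(q ^ k \<star> 1 - qnum q k \<star> a) * (a + inverse q \<star> 1) = (- qnum q (k - 1)) \<star> (a + inverse q \<star> 1)"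
    and "(a + inverse q \<star> 1) * (q ^ k \<star> 1 - qnum q k \<star> a) = (- qnum q (k - 1)) \<star> (a + inverse q \<star> 1)"
proof -
  let ?s = "a + inverse q \<star> 1"
  have 1: "a * ?s = q \<star> ?s"
    using g by (simp add: distrib_left a scl_simps scale_left_diff_distrib)
  have 2: "?s * a = a * ?s"
    by (simp add: distrib_left distrib_right scl_simps)
  have 3: "q ^ k - qnum q k * q = - qnum q (k - 1)"
    using q_qnum[OF g k] by (simp add: mult.commute)
  have "(q ^ k \<star> 1 - qnum q k \<star> a) * ?s = q ^ k \<star> ?s - qnum q k \<star> (a * ?s)"
    by (simp only: left_diff_distrib scl_left mult_1)
  also have "\<dots> = (q ^ k - qnum q k * q) \<star> ?s"
    by (simp only: 1 scale_scale scale_left_diff_distrib)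
  finally show "(q ^ k \<star> 1 - qnum q k \<star> a) * ?s = (- qnum q (k - 1)) \<star> ?s"
    by (simp only: 3)
  have "?s * (q ^ k \<star> 1 - qnum q k \<star> a) = q ^ k \<star> ?s - qnum q k \<star> (?s * a)"
    by (simp only: right_diff_distrib scl_right mult_1_right)
  also have "\<dots> = (q ^ k - qnum q k * q) \<star> ?s"
    by (simp only: 2 1 scale_scale scale_left_diff_distrib)
  finally show "?s * (q ^ k \<star> 1 - qnum q k \<star> a) = (- qnum q (k - 1)) \<star> ?s"
    by (simp only: 3)
qed

lemma expand_right:
  "p * (x \<star> 1 - y \<star> a) * (u \<star> 1 - v \<star> b) * s
    = u \<star> (p * ((x \<star> 1 - y \<star> a) * s)) - v \<star> (x \<star> (p * b * s) - y \<star> (p * a * b * s))"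
  by (simp add: left_diff_distrib right_diff_distrib scl_simps ac_simps)

lemma expand_left:
  "s * (u \<star> 1 - v \<star> b) * (x \<star> 1 - y \<star> a) * p
    = u \<star> (s * (x \<star> 1 - y \<star> a) * p) - v \<star> (x \<star> (s * b * p) - y \<star> (s * b * a * p))"
  by (simp add: left_diff_distrib right_diff_distrib scl_simps ac_simps)

text \<open>
  Let \<open>P\<close> be the skew-symmetrizer in the generators below \<open>r\<^sub>k\<close>. The only new case is that \<open>a = r\<^sub>k\<close>
  acts on \<open>P (q\<^sup>k - [k] a) P\<close> by \<open>- q\<^sup>-\<^sup>1\<close>. The inner \<open>P\<close> is expanded through \<open>b = r\<^sub>k\<^sub>-\<^sub>1\<close> and the smaller
  skew-symmetrizer \<open>p\<close>, which commutes with \<open>a\<close> and is absorbed by \<open>P\<close>. What is left is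
  \<open>P (q\<^sup>k - [k] a) (q\<^bsup>k-1\<^esup> - [k - 1] b) (a + q\<^sup>-\<^sup>1) = 0\<close>, where \<open>P a b (a + q\<^sup>-\<^sup>1) = 0\<close> by the braid
  relation and the other terms cancel.
\<close>

lemma asym_absorbs:
  assumes g: "generic q" and H: "hecke_upto q r n" and "k \<le> n"
  shows "\<forall>i. 1 \<le> i \<and> i < k \<longrightarrow> asym q r k * r i = - inverse q \<star> asym q r k
    \<and> r i * asym q r k = - inverse q \<star> asym q r k"
  using assms(3)
proof (induction k)
  case (Suc k)
  let ?P = "asym q r k" and ?a = "r k"
  let ?h = "q ^ k \<star> 1 - qnum q k \<star> ?a" and ?s = "?a + inverse q \<star> 1"
  have IHr: "?P * r i = - inverse q \<star> ?P" and IHl: "r i * ?P = - inverse q \<star> ?P"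
    if "1 \<le> i" "i < k" for i using Suc that by auto
  show ?case
  proof (intro allI impI)
    fix i assume i: "1 \<le> i \<and> i < Suc k"
    have "qnum q (Suc k) \<noteq> 0" by (simp add: qnum_nonzero g)
    have reduce: "asym q r (Suc k) * r i = - inverse q \<star> asym q r (Suc k)
        \<and> r i * asym q r (Suc k) = - inverse q \<star> asym q r (Suc k)" if "?P * ?h * ?P * r i = - inverse q \<star> (?P * ?h * ?P)"
      "r i * (?P * ?h * ?P) = - inverse q \<star> (?P * ?h * ?P)" for i
    proof -
      have "qnum q (Suc k) \<star> (asym q r (Suc k) * r i) = qnum q (Suc k) \<star> (- inverse q \<star> asym q r (Suc k))"
        using that(1) by (metis asym_Suc[OF g] scl_left scale_left_commute)
      moreover have "qnum q (Suc k) \<star> (r i * asym q r (Suc k)) = qnum q (Suc k) \<star> (- inverse q \<star> asym q r (Suc k))"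
        using that(2) by (metis asym_Suc[OF g] scl_right scale_left_commute)
      ultimately show "asym q r (Suc k) * r i = - inverse q \<star> asym q r (Suc k)
        \<and> r i * asym q r (Suc k) = - inverse q \<star> asym q r (Suc k)"
        using \<open>qnum q (Suc k) \<noteq> 0\<close> by (metis scale_left_imp_eq)
    qed
    show "asym q r (Suc k) * r i = - inverse q \<star> asym q r (Suc k)
        \<and> r i * asym q r (Suc k) = - inverse q \<star> asym q r (Suc k)"
    proof (cases "i < k")
      case True
      have "?P * ?h * ?P * r i = - inverse q \<star> (?P * ?h * ?P)"
        by (simp only: mult.assoc IHr True i scl_simps)
      moreover have "r i * (?P * ?h * ?P) = - inverse q \<star> (?P * ?h * ?P)"
        by (simp only: mult.assoc[symmetric] IHl True i scl_simps)
      ultimately show ?thesis by (rule reduce)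
    next
      case False
      then have ik: "i = k" and k0: "k > 0" using i by auto
      have aa: "?a * ?a = 1 + (q - inverse q) \<star> ?a" using H k0 Suc.prems by (auto simp: hecke_upto_def)
      note quad = hecke_quadratic[OF g aa k0]
      have zero: "?P * ?h * ?P * ?s = 0 \<and> ?s * (?P * ?h * ?P) = 0"
      proof (cases "k = 1")
        case True
        then show ?thesis using quad by simp
      next
        case False
        then obtain j where j: "k = Suc j" "j > 0" using k0 by (cases k) auto
        let ?p = "asym q r j" and ?b = "r j"
        let ?g = "q ^ j \<star> 1 - qnum q j \<star> ?b"
        have Pexp: "qnum q k \<star> ?P = ?p * ?g * ?p" using asym_Suc[OF g] j by simp
        have pa: "?p * ?a = ?a * ?p"
        proof (rule asym_commute[symmetric])
          fix i assume "1 \<le> i" "i < j"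
          then have "r i * ?a = ?a * r i"
            using H j Suc.prems unfolding hecke_upto_def by (metis Suc_le_eq Suc_less_eq less_le_trans)
          then show "?a * r i = r i * ?a" by simp
        qed
        have Pp: "?P * ?p = ?P" by (rule asym_fixes_right[OF g]) (use IHr j in auto)
        have pP: "?p * ?P = ?P" by (rule asym_fixes_left[OF g]) (use IHl j in auto)
        have ph: "?p * ?h = ?h * ?p" using pa by (simp add: algebra_simps scl_simps)
        have ps: "?p * ?s = ?s * ?p" using pa by (simp add: algebra_simps scl_simps)
        have Pb: "?P * ?b = - inverse q \<star> ?P" and bP: "?b * ?P = - inverse q \<star> ?P"
          using IHr[of j] IHl[of j] j by auto
        have braid: "?b * ?a * ?b = ?a * ?b * ?a"
          using H j Suc.prems by (auto simp: hecke_upto_def)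
        have Pabs: "?P * ?a * ?b * ?s = 0"
        proof -
          have "?P * ?a * ?b * ?a = ?P * ?b * ?a * ?b" by (metis braid mult.assoc)
          also have "\<dots> = - inverse q \<star> (?P * ?a * ?b)" by (simp add: Pb scl_simps)
          finally show ?thesis by (simp add: distrib_left scl_simps)
        qed
        have sabP: "?s * ?b * ?a * ?P = 0"
        proof -
          have "?a * ?b * ?a * ?P = ?b * ?a * (?b * ?P)" by (metis braid mult.assoc)
          also have "\<dots> = - inverse q \<star> (?b * ?a * ?P)" by (simp add: bP scl_simps)
          finally show ?thesis by (simp add: distrib_right scl_simps)
        qed
        have Pbs: "?P * ?b * ?s = - inverse q \<star> (?P * ?s)" by (simp add: Pb scl_simps)
        have sbP: "?s * ?b * ?P = - inverse q \<star> (?s * ?P)" by (simp add: bP mult.assoc scl_simps)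
        have qq: "q ^ k * inverse q = q ^ j" using j g by simp
        have kj: "qnum q (k - 1) = qnum q j" using j by simp
        have "?P * ?h * ?g * ?s = q ^ j \<star> (?P * (?h * ?s))
            - qnum q j \<star> (q ^ k \<star> (?P * ?b * ?s) - qnum q k \<star> (?P * ?a * ?b * ?s))"
          by (rule expand_right)
        also have "\<dots> = (q ^ j * - qnum q j - qnum q j * (q ^ k * - inverse q)) \<star> (?P * ?s)"
          by (simp only: quad kj Pabs Pbs scl_right scale_scale scale_zero_right diff_zero scale_left_diff_distrib)
        finally have R: "?P * ?h * ?g * ?s = 0" using qq by simp
        have "?s * ?g * ?h * ?P = q ^ j \<star> (?s * ?h * ?P)
            - qnum q j \<star> (q ^ k \<star> (?s * ?b * ?P) - qnum q k \<star> (?s * ?b * ?a * ?P))"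
          by (rule expand_left)
        also have "\<dots> = (q ^ j * - qnum q j - qnum q j * (q ^ k * - inverse q)) \<star> (?s * ?P)"
          by (simp only: quad kj sabP sbP scl_left scale_scale scale_zero_right diff_zero scale_left_diff_distrib)
        finally have L: "?s * ?g * ?h * ?P = 0" using qq by simp
        have "qnum q k \<star> (?P * ?h * ?P * ?s) = ?P * ?h * (?p * ?g * ?p) * ?s"
          by (metis Pexp scl_left scl_right)
        also have "\<dots> = ?P * (?h * ?p) * ?g * (?p * ?s)" by (simp only: mult.assoc)
        also have "\<dots> = (?P * ?p) * ?h * ?g * ?s * ?p"
          by (simp only: ph[symmetric] ps) (simp only: mult.assoc)
        also have "\<dots> = ?P * ?h * ?g * ?s * ?p" by (simp only: Pp)
        finally have 1: "qnum q k \<star> (?P * ?h * ?P * ?s) = 0" using R by simp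
        have "qnum q k \<star> (?s * (?P * ?h * ?P)) = ?s * ((?p * ?g * ?p) * ?h * ?P)"
          by (metis Pexp scl_left scl_right)
        also have "\<dots> = (?s * ?p) * ?g * (?p * ?h) * ?P" by (simp only: mult.assoc)
        also have "\<dots> = ?p * (?s * ?g * ?h * (?p * ?P))"
          by (simp only: ps[symmetric] ph) (simp only: mult.assoc)
        also have "\<dots> = ?p * (?s * ?g * ?h * ?P)" by (simp only: pP)
        finally have 2: "qnum q k \<star> (?s * (?P * ?h * ?P)) = 0" using L by simp
        show ?thesis using 1 2 qnum_nonzero[OF g, of k] k0 by simp
      qed
      have "?P * ?h * ?P * r i = - inverse q \<star> (?P * ?h * ?P)"
        using conjunct1[OF zero] unfolding ik by (simp add: distrib_left scl_simps eq_neg_iff_add_eq_0)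
      moreover have "r i * (?P * ?h * ?P) = - inverse q \<star> (?P * ?h * ?P)"
        using conjunct2[OF zero] unfolding ik by (simp add: distrib_right scl_simps eq_neg_iff_add_eq_0)
      ultimately show ?thesis by (rule reduce)
    qed
  qed
qed simp

lemma
  assumes "generic q" and "hecke_upto q r n" and "k \<le> n" "1 \<le> i" "i < k"
  shows asym_mult_gen: "asym q r k * r i = - inverse q \<star> asym q r k"
    and gen_mult_asym: "r i * asym q r k = - inverse q \<star> asym q r k"
  using asym_absorbs assms by blast+

lemma asym_idem:
  assumes "generic q" and "hecke_upto q r k"
  shows "asym q r k * asym q r k = asym q r k"
  by (rule asym_fixes_right[OF assms(1)]) (use asym_mult_gen[OF assms order_refl] in auto)

lemma hecke_upto_reverse:
  assumes "hecke_upto q r n" shows "hecke_upto q (\<lambda>i. r (n - i)) n"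
  unfolding hecke_upto_def
proof (intro conjI allI impI)
  fix i assume "1 \<le> i \<and> i < n"
  then show "r (n - i) * r (n - i) = 1 + (q - inverse q) \<star> r (n - i)"
    using assms by (auto simp: hecke_upto_def)
next
  fix i assume i: "1 \<le> i \<and> Suc i < n"
  then have "n - i = Suc (n - Suc i)" by auto
  then show "r (n - i) * r (n - Suc i) * r (n - i) = r (n - Suc i) * r (n - i) * r (n - Suc i)"
    using assms i unfolding hecke_upto_def by (metis One_nat_def Suc_le_eq diff_less zero_less_diff le_less_trans less_le_trans zero_less_Suc lessI)
next
  fix i j assume "1 \<le> i \<and> Suc i < j \<and> j < n"
  then have "1 \<le> n - j \<and> Suc (n - j) < n - i \<and> n - i < n" by auto
  then show "r (n - i) * r (n - j) = r (n - j) * r (n - i)"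
    using assms by (auto simp: hecke_upto_def)
qed

text \<open>
  The skew-symmetrizer is the unique idempotent affording the sign character, so it is invariant under
  the diagram automorphism of the Hecke algebra.
\<close>

lemma asym_reverse:
  assumes g: "generic q" and H: "hecke_upto q r n"
  shows "asym q (\<lambda>i. r (n - i)) n = asym q r n"
proof -
  let ?r = "\<lambda>i. r (n - i)"
  have H': "hecke_upto q ?r n" by (rule hecke_upto_reverse[OF H])
  have "asym q ?r n * asym q r n = asym q ?r n"
  proof (rule asym_fixes_right[OF g])
    fix i assume "1 \<le> i" "i < n"
    then show "asym q ?r n * r i = - inverse q \<star> asym q ?r n"
      using asym_mult_gen[OF g H' order_refl, of "n - i"] by auto
  qed
  moreover have "asym q ?r n * asym q r n = asym q r n"
  proof (rule asym_fixes_left[OF g])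
    fix i assume "1 \<le> i" "i < n"
    then show "r (n - i) * asym q r n = - inverse q \<star> asym q r n"
      using gen_mult_asym[OF g H order_refl, of "n - i"] by auto
  qed
  ultimately show ?thesis by simp
qed

lemma hecke_upto_shift: "hecke_upto q r (Suc n) \<Longrightarrow> hecke_upto q (\<lambda>i. r (Suc i)) n"
  unfolding hecke_upto_def
proof (elim conjE, intro conjI allI impI)
  fix i j assume "\<forall>i j. 1 \<le> i \<and> Suc i < j \<and> j < Suc n \<longrightarrow> r i * r j = r j * r i" "1 \<le> i \<and> Suc i < j \<and> j < n"
  then show "r (Suc i) * r (Suc j) = r (Suc j) * r (Suc i)" by (metis Suc_less_eq le_SucI)
qed auto

text \<open>
  The recursion that splits off the first generator instead of the last one, obtained by applying the
  diagram automorphism.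
\<close>

lemma asym_Suc_left:
  assumes g: "generic q" and H: "hecke_upto q r (Suc k)"
  shows "qnum q (Suc k) \<star> asym q r (Suc k) =
    asym q (\<lambda>i. r (Suc i)) k * (q ^ k \<star> 1 - qnum q k \<star> r 1) * asym q (\<lambda>i. r (Suc i)) k"
proof -
  have "asym q (\<lambda>i. r (Suc k - i)) k = asym q (\<lambda>i. r (Suc (k - i))) k"
    by (rule asym_cong) (simp add: Suc_diff_le)
  also have "\<dots> = asym q (\<lambda>i. r (Suc i)) k"
    using asym_reverse[OF g hecke_upto_shift[OF H]] by simp
  finally show ?thesis
    using asym_Suc[OF g, of k "\<lambda>i. r (Suc k - i)"] asym_reverse[OF g H] by simp
qed

end

lemma commute_mult:
  fixes x :: "'r::semigroup_mult"
  shows "x * a = a * x \<Longrightarrow> x * b = b * x \<Longrightarrow> x * (a * b) = a * b * x"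
  by (metis mult.assoc)

section \<open>Towers of algebras with an R-trace\<close>

text \<open>
  \<open>A k\<close> stands for the operators in the first \<open>k\<close> positions, \<open>r i\<close> for \<open>R\<close> in the positions \<open>i\<close> and
  \<open>i + 1\<close>, and \<open>E i\<close> for the R-trace over the position \<open>i\<close>. In \<open>E_conj\<close> the last factor is the inverse
  of \<open>r k\<close>.
\<close>

locale markov_tower = scaled_ring scl
  for scl :: "'k::field \<Rightarrow> 'r::ring_1 \<Rightarrow> 'r" (infixr "\<star>" 72) +
  fixes q \<delta> :: 'k and r :: "nat \<Rightarrow> 'r" and E :: "nat \<Rightarrow> 'r \<Rightarrow> 'r" and A :: "nat \<Rightarrow> 'r set"
  assumes gen: "generic q"
    and quadratic: "1 \<le> i \<Longrightarrow> r i * r i = 1 + (q - inverse q) \<star> r i"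
    and braid: "1 \<le> i \<Longrightarrow> r i * r (Suc i) * r i = r (Suc i) * r i * r (Suc i)"
    and A_one: "1 \<in> A k"
    and A_add: "x \<in> A k \<Longrightarrow> y \<in> A k \<Longrightarrow> x + y \<in> A k"
    and A_mult: "x \<in> A k \<Longrightarrow> y \<in> A k \<Longrightarrow> x * y \<in> A k"
    and A_scl: "x \<in> A k \<Longrightarrow> c \<star> x \<in> A k"
    and A_Suc: "x \<in> A k \<Longrightarrow> x \<in> A (Suc k)"
    and r_mem: "1 \<le> i \<Longrightarrow> r i \<in> A (Suc i)"
    and r_comm: "x \<in> A k \<Longrightarrow> k < i \<Longrightarrow> r i * x = x * r i"
    and E_add: "E i (x + y) = E i x + E i y"
    and E_scl: "E i (c \<star> x) = c \<star> E i x"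
    and E_mem: "x \<in> A (Suc k) \<Longrightarrow> E (Suc k) x \<in> A k"
    and E_left: "x \<in> A k \<Longrightarrow> E (Suc k) (x * y) = x * E (Suc k) y"
    and E_right: "x \<in> A k \<Longrightarrow> E (Suc k) (y * x) = E (Suc k) y * x"
    and E_one: "E (Suc k) 1 = \<delta> \<star> 1"
    and E_r: "1 \<le> k \<Longrightarrow> E (Suc k) (r k) = 1"
    and E_conj: "1 \<le> k \<Longrightarrow> x \<in> A k \<Longrightarrow>
      E (Suc k) (r k * x * (r k - (q - inverse q) \<star> 1)) = E k x"
    and E_cyclic: "1 \<le> k \<Longrightarrow> x \<in> A (Suc k) \<Longrightarrow>
      E k (E (Suc k) (r k * x)) = E k (E (Suc k) (x * r k))"
begin

definition rinv :: "nat \<Rightarrow> 'r" where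
  "rinv i = r i - (q - inverse q) \<star> 1"

lemma r_rinv: "1 \<le> i \<Longrightarrow> r i * rinv i = 1" and rinv_r: "1 \<le> i \<Longrightarrow> rinv i * r i = 1"
  by (simp_all add: rinv_def right_diff_distrib left_diff_distrib scl_simps quadratic)

lemma r_rinv': "1 \<le> i \<Longrightarrow> r i * (rinv i * x) = x" and rinv_r': "1 \<le> i \<Longrightarrow> rinv i * (r i * x) = x"
  by (simp_all add: mult.assoc[symmetric] r_rinv rinv_r)

lemma A_diff: "x \<in> A k \<Longrightarrow> y \<in> A k \<Longrightarrow> x - y \<in> A k"
  using A_add[of x k "(- 1) \<star> y"] A_scl[of y k "- 1"] by simp

lemma A_mono: "x \<in> A k \<Longrightarrow> k \<le> n \<Longrightarrow> x \<in> A n"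
  by (induction n rule: nat_induct) (auto simp: le_Suc_eq intro: A_Suc)

lemma rinv_mem: "1 \<le> i \<Longrightarrow> rinv i \<in> A (Suc i)"
  unfolding rinv_def by (intro A_diff r_mem A_scl A_one)

lemma rinv_comm: "y * r i = r i * y \<Longrightarrow> y * rinv i = rinv i * y"
  unfolding rinv_def by (simp add: algebra_simps scl_simps)

lemma r_far: "1 \<le> i \<Longrightarrow> Suc i < j \<Longrightarrow> r i * r j = r j * r i"
  using r_comm[OF r_mem] by simp

lemma E_diff: "E i (x - y) = E i x - E i y"
  using E_add[of i "x - y" y] by (simp add: algebra_simps)

lemma E_zero [simp]: "E i 0 = 0"
  using E_diff[of i 0 0] by simp

lemma hecke: "hecke_upto q (\<lambda>i. r (a + i)) n"
  unfolding hecke_upto_def by (auto simp: quadratic braid intro!: r_far)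

text \<open>The skew-symmetrizer in the positions \<open>a + 1, \<dots>, a + k\<close>.\<close>

abbreviation P :: "nat \<Rightarrow> nat \<Rightarrow> 'r" where
  "P a k \<equiv> asym q (\<lambda>i. r (a + i)) k"

lemma P_mem: "P a k \<in> A (a + k)"
proof (induction k)
  case (Suc k)
  have "P a k \<in> A (a + Suc k)" using Suc A_Suc by simp
  moreover have "r (a + k) \<in> A (a + Suc k)" if "k \<noteq> 0" using r_mem[of "a + k"] that by simp
  ultimately show ?case
    by (auto simp: asym.simps(2) intro!: A_one A_scl A_mult A_diff)
qed (simp add: A_one)

lemma P_idem: "P a k * P a k = P a k"
  by (rule asym_idem[OF gen hecke])

lemma P_gen: "a < i \<Longrightarrow> i < a + k \<Longrightarrow> P a k * r i = - inverse q \<star> P a k"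
  using asym_mult_gen[OF gen hecke[of a k] order_refl, of "i - a"] by simp

lemma gen_P: "a < i \<Longrightarrow> i < a + k \<Longrightarrow> r i * P a k = - inverse q \<star> P a k"
  using gen_mult_asym[OF gen hecke[of a k] order_refl, of "i - a"] by simp

lemma P_comm: "x \<in> A a \<Longrightarrow> x * P a k = P a k * x"
  by (rule asym_commute) (simp add: r_comm)

lemma P_Suc_left: "qnum q (Suc k) \<star> P a (Suc k) =
    P (Suc a) k * (q ^ k \<star> 1 - qnum q k \<star> r (Suc a)) * P (Suc a) k"
  using asym_Suc_left[OF gen hecke[of a "Suc k"]] by simp

text \<open>The iterated trace over the positions \<open>a + 1, \<dots>, a + n\<close>.\<close>

primrec tr :: "nat \<Rightarrow> nat \<Rightarrow> 'r \<Rightarrow> 'r" where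
  "tr a 0 x = x"
| "tr a (Suc n) x = tr a n (E (a + Suc n) x)"

lemma tr_scl: "tr a n (c \<star> x) = c \<star> tr a n x"
  by (induction n arbitrary: x) (auto simp: E_scl)

lemma tr_minus: "tr a n (- x) = - tr a n x"
  using tr_scl[of a n "- 1" x] by simp

lemma tr_diff: "tr a n (x - y) = tr a n x - tr a n y"
  by (induction n arbitrary: x y) (auto simp: E_diff)

lemma tr_left: "x \<in> A a \<Longrightarrow> tr a n (x * y) = x * tr a n y"
proof (induction n arbitrary: y)
  case (Suc n)
  then show ?case using E_left[of x "a + n" y] A_mono[of x a "a + n"] by simp
qed simp

lemma tr_mem: "x \<in> A (a + n) \<Longrightarrow> tr a n x \<in> A a"
  by (induction n arbitrary: x) (auto simp: E_mem)

lemma tr_Suc_left: "tr a (Suc n) x = E (Suc a) (tr (Suc a) n x)"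
  by (induction n arbitrary: x) auto

lemma tr_cyclic_gen:
  "x \<in> A (a + n) \<Longrightarrow> a < i \<Longrightarrow> i < a + n \<Longrightarrow> tr a n (r i * x) = tr a n (x * r i)"
proof (induction n arbitrary: x)
  case (Suc n)
  show ?case
  proof (cases "i = a + n")
    case True
    then obtain n' where "n = Suc n'" using Suc.prems by (cases n) auto
    then show ?thesis using E_cyclic[of i x] True Suc.prems by simp
  next
    case False
    then have "r i \<in> A (a + n)" using Suc.prems by (intro A_mono[OF r_mem]) auto
    moreover have "E (Suc (a + n)) x \<in> A (a + n)" using Suc.prems by (intro E_mem) simp
    ultimately show ?thesis using Suc.IH[of "E (Suc (a + n)) x"] False Suc.prems
      by (simp add: E_left E_right)
  qed
qed simp

text \<open>
  The elements that can be moved around under the trace form a subalgebra. It contains the generators,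
  hence the skew-symmetrizers.
\<close>

definition cyclic :: "nat \<Rightarrow> nat \<Rightarrow> 'r \<Rightarrow> bool" where
  "cyclic a n y \<longleftrightarrow> y \<in> A (a + n) \<and> (\<forall>x\<in>A (a + n). tr a n (y * x) = tr a n (x * y))"

lemma cyclic_mult: "cyclic a n x \<Longrightarrow> cyclic a n y \<Longrightarrow> cyclic a n (x * y)"
  unfolding cyclic_def by (metis A_mult mult.assoc)

lemma cyclic_diff: "cyclic a n x \<Longrightarrow> cyclic a n y \<Longrightarrow> cyclic a n (x - y)"
  unfolding cyclic_def by (simp add: A_diff left_diff_distrib right_diff_distrib tr_diff)

lemma cyclic_scl: "cyclic a n x \<Longrightarrow> cyclic a n (c \<star> x)"
  unfolding cyclic_def by (simp add: A_scl scl_simps tr_scl)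

lemma cyclic_one: "cyclic a n 1"
  by (simp add: cyclic_def A_one)

lemma cyclic_gen: "a < i \<Longrightarrow> i < a + n \<Longrightarrow> cyclic a n (r i)"
  unfolding cyclic_def using A_mono[OF r_mem[of i], of "a + n"] by (auto intro: tr_cyclic_gen)

lemma cyclic_P: "a \<le> b \<Longrightarrow> b + k \<le> a + n \<Longrightarrow> cyclic a n (P b k)"
  by (induction k)
     (auto simp: asym.simps(2) intro!: cyclic_one cyclic_scl cyclic_mult cyclic_diff cyclic_gen)

lemma tr_cyclic_P:
  "a \<le> b \<Longrightarrow> b + k \<le> a + n \<Longrightarrow> x \<in> A (a + n) \<Longrightarrow> tr a n (P b k * x) = tr a n (x * P b k)"
  using cyclic_P cyclic_def by blast

text \<open>
  The braid \<open>r\<^sub>a\<^sub>+\<^sub>1 \<cdots> r\<^sub>a\<^sub>+\<^sub>k\<close>. Conjugation by it moves everything that is built from the generators and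
  from the barred copies of a matrix one position to the right, and does not change the trace.
\<close>

primrec Z :: "nat \<Rightarrow> nat \<Rightarrow> 'r" where
  "Z a 0 = 1"
| "Z a (Suc k) = Z a k * r (a + Suc k)"

primrec Zinv :: "nat \<Rightarrow> nat \<Rightarrow> 'r" where
  "Zinv a 0 = 1"
| "Zinv a (Suc k) = rinv (a + Suc k) * Zinv a k"

lemma Z_Zinv: "Z a k * Zinv a k = 1"
proof (induction k)
  case (Suc k)
  have "Z a (Suc k) * Zinv a (Suc k) = Z a k * (r (a + Suc k) * (rinv (a + Suc k) * Zinv a k))"
    by (simp only: Z.simps Zinv.simps mult.assoc)
  then show ?case using Suc by (simp only: r_rinv' le_add2 add_Suc_right le_SucI One_nat_def Suc_le_mono le0)
qed simp

lemma Z_mem: "Z a k \<in> A (Suc (a + k))" and Zinv_mem: "Zinv a k \<in> A (Suc (a + k))"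
proof (induction k)
  case (Suc k)
  { case 1 show ?case using A_mult[OF A_Suc[OF Suc(1)] r_mem[of "Suc (a + k)"]] by simp }
  { case 2 show ?case using A_mult[OF rinv_mem[of "Suc (a + k)"] A_Suc[OF Suc(2)]] by simp }
qed (simp_all add: A_one)

lemma Z_gen: "1 \<le> i \<Longrightarrow> i < k \<Longrightarrow> Z a k * r (a + i) = r (Suc (a + i)) * Z a k"
proof (induction k)
  case (Suc k)
  show ?case
  proof (cases "i = k")
    case True
    then obtain j where k: "k = Suc j" using Suc.prems by (cases k) auto
    have "Z a (Suc k) * r (a + i) = Z a j * (r (a + k) * r (Suc (a + k)) * r (a + k))"
      using True k by (simp add: mult.assoc)
    also have "\<dots> = (Z a j * r (Suc (a + k))) * (r (a + k) * r (Suc (a + k)))"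
      using braid[of "a + k"] k by (simp add: mult.assoc)
    also have "Z a j * r (Suc (a + k)) = r (Suc (a + k)) * Z a j"
      using r_comm[OF Z_mem[of a j], of "Suc (a + k)"] k by simp
    finally show ?thesis using True k by (simp add: mult.assoc)
  next
    case False
    then have "Z a (Suc k) * r (a + i) = Z a k * r (a + i) * r (a + Suc k)"
      using Suc.prems r_far[of "a + i" "a + Suc k"] by (simp add: mult.assoc)
    then show ?thesis using Suc False by (simp add: mult.assoc)
  qed
qed simp

lemma Z_P: "j \<le> k \<Longrightarrow> Z a k * P a j = P (Suc a) j * Z a k"
proof (induction j)
  case (Suc j)
  let ?f = "\<lambda>a. q ^ j \<star> 1 - qnum q j \<star> r (a + j)"
  have 1: "Z a k * P a j = P (Suc a) j * Z a k" using Suc by simp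
  show ?case
  proof (cases "j = 0")
    case False
    have 2: "Z a k * ?f a = ?f (Suc a) * Z a k"
      using Z_gen[of j k a] False Suc.prems by (simp add: algebra_simps scl_simps)
    have "Z a k * (P a j * ?f a * P a j) = (Z a k * P a j) * ?f a * P a j"
      by (simp only: mult.assoc)
    also have "\<dots> = P (Suc a) j * (Z a k * ?f a) * P a j"
      by (simp only: 1 mult.assoc)
    also have "\<dots> = P (Suc a) j * ?f (Suc a) * (Z a k * P a j)"
      by (simp only: 2 mult.assoc)
    also have "\<dots> = P (Suc a) j * ?f (Suc a) * P (Suc a) j * Z a k"
      by (simp only: 1 mult.assoc)
    finally show ?thesis using False by (simp add: asym.simps(2) scl_simps)
  qed simp
qed simp

lemma tr_shift: "x \<in> A (a + k) \<Longrightarrow> tr (Suc a) k (Z a k * x * Zinv a k) = tr a k x"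
proof (induction k arbitrary: x)
  case (Suc k)
  let ?n = "Suc (a + k)"
  have "E (Suc ?n) (Z a (Suc k) * x * Zinv a (Suc k)) = E (Suc ?n) (Z a k * (r ?n * x * rinv ?n) * Zinv a k)"
    by (simp add: mult.assoc)
  also have "\<dots> = Z a k * E (Suc ?n) (r ?n * x * rinv ?n) * Zinv a k"
    by (simp add: E_left[OF Z_mem] E_right[OF Zinv_mem])
  also have "E (Suc ?n) (r ?n * x * rinv ?n) = E ?n x"
    using E_conj[of ?n x] Suc.prems by (simp add: rinv_def)
  finally show ?case using Suc.IH[of "E ?n x"] E_mem[of x "a + k"] Suc.prems by simp
qed simp

text \<open>
  The last position occurs in \<open>P\<^sub>-\<^sup>(\<^sup>k\<^sup>+\<^sup>1\<^sup>)\<close> only in the middle factor \<open>q\<^sup>k - [k] r\<^sub>k\<close>, whose trace is a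
  scalar.
\<close>

lemma E_P:
  assumes "x \<in> A k" "k \<ge> 1"
  shows "qnum q (Suc k) \<star> E (Suc k) (P 0 (Suc k) * x) = (q ^ k * \<delta> - qnum q k) \<star> (P 0 k * x)"
proof -
  have Pk: "P 0 k \<in> A k" using P_mem[of 0 k] by simp
  have f: "E (Suc k) (q ^ k \<star> 1 - qnum q k \<star> r k) = (q ^ k * \<delta> - qnum q k) \<star> 1"
    using assms by (simp add: E_diff E_scl E_one E_r scale_left_diff_distrib)
  have "qnum q (Suc k) \<star> E (Suc k) (P 0 (Suc k) * x)
      = E (Suc k) ((qnum q (Suc k) \<star> P 0 (Suc k)) * x)"
    by (simp add: E_scl scl_simps)
  also have "\<dots> = E (Suc k) (P 0 k * (q ^ k \<star> 1 - qnum q k \<star> r k) * (P 0 k * x))"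
    using asym_Suc[OF gen, of k r] by (simp add: mult.assoc)
  also have "\<dots> = P 0 k * E (Suc k) (q ^ k \<star> 1 - qnum q k \<star> r k) * (P 0 k * x)"
    using E_right[OF A_mult[OF Pk assms(1)]] E_left[OF Pk] by simp
  also have "\<dots> = (q ^ k * \<delta> - qnum q k) \<star> (P 0 k * P 0 k * x)"
    by (simp only: f scl_simps mult_1_right mult.assoc)
  finally show ?thesis by (simp only: P_idem)
qed

text \<open>
  If the exterior powers stop after the \<open>m\<close>-th one, the partial trace of the vanishing skew-symmetrizer
  determines the trace of the identity.
\<close>

lemma trace_one:
  assumes "m \<ge> 1" "P 0 (Suc m) = 0" "P 0 m \<noteq> 0"
  shows "q ^ m * \<delta> = qnum q m"
  using E_P[of 1 m] assms by (simp add: A_one)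

end

section \<open>Barred copies\<close>

locale reflection_tower = markov_tower +
  fixes l :: 'b
  assumes l_mem: "l \<in> A 1"
begin

primrec ell :: "nat \<Rightarrow> 'b" where
  "ell 0 = l"
| "ell (Suc k) = (if k = 0 then l else r k * ell k * rinv k)"

lemma ell_1: "ell (Suc 0) = l" by simp

lemma ell_Suc: "1 \<le> k \<Longrightarrow> ell (Suc k) = r k * ell k * rinv k"
  by simp

declare ell.simps(2) [simp del]

lemma ell_mem: "1 \<le> k \<Longrightarrow> ell k \<in> A k"
proof (induction k rule: nat_induct_at_least)
  case base then show ?case using l_mem ell_1 by simp
next
  case (Suc k)
  then show ?case by (auto simp: ell_Suc intro!: A_mult r_mem rinv_mem intro: A_Suc)
qed

lemma r_ell: "1 \<le> k \<Longrightarrow> r k * ell k = ell (Suc k) * r k"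
  by (simp add: ell_Suc mult.assoc rinv_r)

lemma r_ell_comm_less: "1 \<le> j \<Longrightarrow> j < i \<Longrightarrow> r i * ell j = ell j * r i"
  by (rule r_comm[OF ell_mem])

text \<open>
  The critical case is \<open>j = i + 2\<close>, where the barred copy is the conjugate of \<open>ell i\<close> by
  \<open>r\<^sub>i\<^sub>+\<^sub>1 r\<^sub>i\<close>. Conjugation by this braid turns \<open>r\<^sub>i\<^sub>+\<^sub>1\<close>, which commutes with \<open>ell i\<close>, into \<open>r\<^sub>i\<close>.
\<close>

lemma r_ell_comm_greater: "1 \<le> i \<Longrightarrow> Suc i < j \<Longrightarrow> r i * ell j = ell j * r i"
proof (induction j)
  case (Suc j)
  show ?case
  proof (cases "j = Suc i")
    case True
    let ?a = "r i" and ?b = "r (Suc i)" and ?a' = "rinv i" and ?b' = "rinv (Suc i)"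
    have br: "?a * ?b * ?a = ?b * ?a * ?b" using braid Suc.prems by simp
    have "?a * ?b * ?a' = ?b' * (?b * ?a * ?b) * ?a'"
      using Suc.prems by (simp add: mult.assoc rinv_r')
    also have "\<dots> = ?b' * ?a * ?b"
      using Suc.prems by (simp only: br[symmetric]) (simp add: mult.assoc r_rinv)
    finally have 1: "?a * ?b * ?a' = ?b' * ?a * ?b" .
    have "?b * ?a' * ?b' = ?a' * (?a * ?b * ?a') * ?b'"
      using Suc.prems by (simp add: mult.assoc rinv_r')
    also have "\<dots> = ?a' * ?b' * ?a"
      using Suc.prems by (simp only: 1) (simp add: mult.assoc r_rinv)
    finally have 2: "?b * (?a' * ?b') = ?a' * (?b' * ?a)" by (simp only: mult.assoc)
    have 3: "?b * ell i = ell i * ?b" using Suc.prems by (intro r_ell_comm_less) auto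
    have ell: "ell (Suc j) = ?b * ?a * ell i * (?a' * ?b')"
      using Suc.prems True by (simp add: ell_Suc mult.assoc)
    have "?a * ell (Suc j) = (?a * ?b * ?a) * ell i * (?a' * ?b')"
      by (simp only: ell mult.assoc)
    also have "\<dots> = ?b * ?a * (?b * ell i) * (?a' * ?b')" by (simp only: br) (simp only: mult.assoc)
    also have "\<dots> = ?b * ?a * ell i * (?b * (?a' * ?b'))" by (simp only: 3) (simp only: mult.assoc)
    also have "\<dots> = ell (Suc j) * ?a" by (simp only: 2 ell mult.assoc)
    finally show ?thesis .
  next
    case False
    then have 1: "r i * ell j = ell j * r i" using Suc by auto
    have 2: "r i * r j = r j * r i" using Suc.prems False by (intro r_far) auto
    have 3: "r i * rinv j = rinv j * r i" by (rule rinv_comm) (rule 2)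
    have "1 \<le> j" using Suc.prems by simp
    have "r i * (r j * ell j * rinv j) = r j * (r i * ell j) * rinv j"
      by (simp only: 2 flip: mult.assoc)
    also have "\<dots> = r j * ell j * (r i * rinv j)" by (simp only: 1) (simp only: mult.assoc)
    also have "\<dots> = r j * ell j * rinv j * r i" by (simp only: 3) (simp only: mult.assoc)
    finally show ?thesis using \<open>1 \<le> j\<close> by (simp only: ell_Suc)
  qed
qed simp

lemma r_ell_comm: "1 \<le> i \<Longrightarrow> 1 \<le> j \<Longrightarrow> j \<noteq> i \<Longrightarrow> j \<noteq> Suc i \<Longrightarrow> r i * ell j = ell j * r i"
  by (cases "j < i") (auto intro: r_ell_comm_less r_ell_comm_greater)

text \<open>The product of the barred copies in the positions \<open>a + 1, \<dots>, a + k\<close>.\<close>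

primrec lp :: "nat \<Rightarrow> nat \<Rightarrow> 'b" where
  "lp a 0 = 1"
| "lp a (Suc k) = lp a k * ell (a + Suc k)"

lemma lp_mem: "lp a k \<in> A (a + k)"
proof (induction k)
  case (Suc k)
  then show ?case using A_mult[OF A_Suc[OF Suc] ell_mem[of "Suc (a + k)"]] by simp
qed (simp add: A_one)

lemma lp_Suc_left: "lp a (Suc k) = ell (Suc a) * lp (Suc a) k"
  by (induction k) (simp_all add: mult.assoc)

lemma r_lp_comm:
  "1 \<le> i \<Longrightarrow> i < a + 1 \<and> i \<noteq> a \<or> a + k < i \<Longrightarrow> r i * lp a k = lp a k * r i" 
proof (induction k)
  case (Suc k)
  then have "r i * lp a k = lp a k * r i" by auto
  moreover have "r i * ell (a + Suc k) = ell (a + Suc k) * r i"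
    using Suc.prems by (intro r_ell_comm) auto
  ultimately show ?case by (simp add: commute_mult)
qed simp

lemma Z_ell: "1 \<le> i \<Longrightarrow> i \<le> k \<Longrightarrow> Z a k * ell (a + i) = ell (Suc (a + i)) * Z a k"
proof (induction k)
  case (Suc k)
  show ?case
  proof (cases "i = Suc k")
    case True
    have comm: "Z a j * ell (Suc (Suc (a + k))) = ell (Suc (Suc (a + k))) * Z a j" if "j \<le> k" for j
      using that
    proof (induction j)
      case (Suc j)
      have "r (a + Suc j) * ell (Suc (Suc (a + k))) = ell (Suc (Suc (a + k))) * r (a + Suc j)"
        using Suc.prems by (intro r_ell_comm) auto
      then show ?case using commute_mult[of "ell (Suc (Suc (a + k)))" "Z a j" "r (a + Suc j)"] Suc by simp
    qed simp
    have "Z a (Suc k) * ell (a + i) = Z a k * ell (Suc (Suc (a + k))) * r (a + Suc k)"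
      using r_ell[of "a + Suc k"] True by (simp add: mult.assoc)
    then show ?thesis using True comm[of k] by (simp add: mult.assoc)
  next
    case False
    then have "r (a + Suc k) * ell (a + i) = ell (a + i) * r (a + Suc k)"
      using Suc.prems by (intro r_ell_comm) auto
    then have "Z a (Suc k) * ell (a + i) = Z a k * ell (a + i) * r (a + Suc k)"
      by (simp add: mult.assoc)
    then show ?thesis using Suc False by (simp add: mult.assoc)
  qed
qed simp

lemma Z_lp: "j \<le> k \<Longrightarrow> Z a k * lp a j = lp (Suc a) j * Z a k"
proof (induction j)
  case (Suc j)
  have "Z a k * lp a (Suc j) = (Z a k * lp a j) * ell (a + Suc j)" by (simp add: mult.assoc)
  also have "\<dots> = lp (Suc a) j * (Z a k * ell (a + Suc j))" using Suc by (simp add: mult.assoc)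
  also have "\<dots> = lp (Suc a) (Suc j) * Z a k" using Z_ell[of "Suc j" k a] Suc by (simp add: mult.assoc)
  finally show ?case .
qed simp

definition e :: "nat \<Rightarrow> 'b" where
  "e k = tr 0 k (P 0 k * lp 0 k)"

lemma e_mem: "e k \<in> A 0"
  unfolding e_def using A_mult[OF P_mem[of 0 k] lp_mem[of 0 k]] by (intro tr_mem) simp

definition W :: "nat \<Rightarrow> nat \<Rightarrow> 'b" where
  "W a k = lp a k * P a k"

lemma W_mem: "W a k \<in> A (a + k)"
  unfolding W_def by (intro A_mult lp_mem P_mem)

lemma W_shift: "W (Suc a) k = Z a k * W a k * Zinv a k"
proof -
  have "Z a k * W a k = lp (Suc a) k * (Z a k * P a k)"
    unfolding W_def by (simp only: Z_lp[OF order_refl] mult.assoc[symmetric])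
  also have "\<dots> = W (Suc a) k * Z a k"
    unfolding W_def by (simp only: Z_P[OF order_refl] mult.assoc)
  finally show ?thesis by (simp only: mult.assoc Z_Zinv mult_1_right)
qed

text \<open>
  Conjugation by the braid \<open>Z\<close> shifts the positions, so \<open>e k\<close> can be computed in any \<open>k\<close> consecutive ones.
\<close>

lemma tr_W: "tr a k (W a k) = e k"
proof (induction a)
  case 0
  show ?case unfolding W_def e_def using tr_cyclic_P[of 0 0 k k "lp 0 k"] lp_mem[of 0 k] by simp
next
  case (Suc a)
  then show ?case by (simp only: W_shift tr_shift[OF W_mem])
qed

section \<open>The expansion of the product\<close>

definition T :: "nat \<Rightarrow> 'b \<Rightarrow> 'b" where
  "T m x = tr 0 m (P 0 m * x)"

lemma T_diff: "T m (x - y) = T m x - T m y"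
  by (simp add: T_def right_diff_distrib tr_diff)

lemma T_scl: "T m (c \<star> x) = c \<star> T m x"
  by (simp add: T_def scl_right tr_scl)

lemma T_left: "s \<in> A 0 \<Longrightarrow> T m (s * x) = s * T m x"
proof -
  assume s: "s \<in> A 0"
  have "P 0 m * (s * x) = s * (P 0 m * x)"
    by (simp only: P_comm[OF s] flip: mult.assoc)
  then show ?thesis by (simp add: T_def tr_left[OF s])
qed

text \<open>
  The generator acts on the skew-symmetrizer by \<open>- q\<^sup>-\<^sup>1\<close> from the right, and its inverse, after it has
  been moved around the trace, by \<open>- q\<close> from the left.
\<close>

lemma T_conj:
  assumes "x \<in> A m" "1 \<le> i" "i < m"
  shows "T m (r i * x * rinv i) = T m x"
proof -
  have l: "T m (r i * y) = - inverse q \<star> T m y" for y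
    using P_gen[of 0 i m] assms by (simp add: T_def scl_simps tr_scl tr_minus flip: mult.assoc)
  have r: "T m (y * r i) = - inverse q \<star> T m y" if "y \<in> A m" for y
  proof -
    have "P 0 m * y \<in> A (0 + m)" using A_mult[OF P_mem[of 0 m]] that by simp
    then have "T m (y * r i) = tr 0 m (r i * (P 0 m * y))"
      using tr_cyclic_gen[of "P 0 m * y" 0 m i] assms by (simp add: T_def mult.assoc)
    also have "\<dots> = - inverse q \<star> T m y"
      using gen_P[of 0 i m] assms by (simp add: T_def scl_simps tr_scl tr_minus flip: mult.assoc)
    finally show ?thesis .
  qed
  have "- inverse q \<star> T m (x * rinv i) = T m (x * rinv i * r i)"
    using assms A_mono[OF rinv_mem, of i m] by (intro r[symmetric] A_mult) auto
  then have "- inverse q \<star> T m (x * rinv i) = T m x"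
    using assms by (simp add: mult.assoc rinv_r)
  then show ?thesis by (simp add: l mult.assoc)
qed

text \<open>
  The last barred copy \<open>L\<^sub>n\<^sub>+\<^sub>1\<close> is the conjugate of \<open>L\<^sub>n\<close> by \<open>r\<^sub>n\<close>, and \<open>r\<^sub>n\<close> commutes with the other
  factors. So under \<open>T\<close> it slides down to the first free position.
\<close>

lemma T_lp_ell:
  assumes "j \<le> n" "n < m" "y \<in> A m" "\<And>i. 1 \<le> i \<Longrightarrow> i \<le> n \<Longrightarrow> r i * y = y * r i"
  shows "T m (lp 0 j * ell (Suc n) * y) = T m (lp 0 (Suc j) * y)"
  using assms
proof (induction n rule: dec_induct)
  case (step n)
  have c: "y * rinv (Suc n) = rinv (Suc n) * y"
    using step.prems by (intro rinv_comm) simp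
  have "lp 0 j * ell (Suc (Suc n)) * y = lp 0 j * r (Suc n) * ell (Suc n) * (rinv (Suc n) * y)"
    by (simp add: ell_Suc mult.assoc)
  also have "\<dots> = r (Suc n) * (lp 0 j * ell (Suc n) * y) * rinv (Suc n)"
    using r_lp_comm[of "Suc n" 0 j] step.hyps by (simp add: c[symmetric] mult.assoc[symmetric])
  finally have "T m (lp 0 j * ell (Suc (Suc n)) * y) = T m (lp 0 j * ell (Suc n) * y)"
    using step.prems step.hyps A_mono[OF lp_mem[of 0 j], of m] A_mono[OF ell_mem[of "Suc n"], of m]
    by (simp add: T_conj A_mult)
  then show ?case using step by simp
qed simp
text \<open>
  The product in the formula to be proved, with the factors already written in terms of \<open>L\<close> and \<open>s\<close>,
  and the coefficients \<open>cc n j\<close> of its expansion under \<open>T\<close>.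
\<close>

primrec pf :: "'b \<Rightarrow> nat \<Rightarrow> 'b" where
  "pf s 0 = 1"
| "pf s (Suc n) = pf s n * (q ^ (2 * n) \<star> s - ell (Suc n))"

primrec cc :: "nat \<Rightarrow> nat \<Rightarrow> 'a" where
  "cc 0 j = (if j = 0 then 1 else 0)"
| "cc (Suc n) j = q ^ (2 * n) * cc n j - (case j of 0 \<Rightarrow> 0 | Suc i \<Rightarrow> cc n i)"

lemma cc_zero: "n < j \<Longrightarrow> cc n j = 0"
  by (induction n arbitrary: j) (auto split: nat.splits)

text \<open>
  The part \<open>y\<close> of the product that has not been expanded yet only has to commute with the generators
  used for sliding the barred copies; this keeps the induction going.
\<close>

lemma T_pf:
  assumes "s \<in> A 0" "\<And>x. s * x = x * s" "n \<le> m" "y \<in> A m"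
    "\<And>i. 1 \<le> i \<Longrightarrow> i < n \<Longrightarrow> r i * y = y * r i"
  shows "T m (pf s n * y) = (\<Sum>j\<le>n. cc n j \<star> (s ^ (n - j) * T m (lp 0 j * y)))"
  using assms(3-)
proof (induction n arbitrary: y)
  case (Suc n)
  let ?f = "q ^ (2 * n) \<star> s - ell (Suc n)"
  let ?t = "\<lambda>j. T m (lp 0 j * y)"
  have fy: "?f * y \<in> A m"
    using Suc.prems A_mono[OF assms(1), of m] A_mono[OF ell_mem[of "Suc n"], of m]
    by (intro A_mult A_diff A_scl) auto
  have comm: "r i * (?f * y) = ?f * y * r i" if "1 \<le> i" "i < n" for i
  proof -
    have "r i * ?f = ?f * r i"
      using r_ell_comm[of i "Suc n"] assms(2)[of "r i"] that
      by (simp add: right_diff_distrib left_diff_distrib scl_simps)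
    then show ?thesis using Suc.prems(3)[of i] that by (intro commute_mult) auto
  qed
  have sA: "s ^ k \<in> A 0" for k by (induction k) (auto intro: A_one A_mult assms(1))
  have step_j: "T m (lp 0 j * (?f * y)) = q ^ (2 * n) \<star> (s * ?t j) - ?t (Suc j)" if "j \<le> n" for j
  proof -
    have comm: "lp 0 j * (s * y) = s * (lp 0 j * y)"
      by (simp only: assms(2)[of "lp 0 j"] flip: mult.assoc)
    have "lp 0 j * (?f * y) = q ^ (2 * n) \<star> (s * (lp 0 j * y)) - lp 0 j * ell (Suc n) * y"
      by (simp add: right_diff_distrib left_diff_distrib scl_simps mult.assoc comm)
    then show ?thesis using T_lp_ell[of j n m y] that Suc.prems
      by (simp add: T_diff T_scl T_left[OF assms(1)])
  qed
  have "T m (pf s (Suc n) * y) = T m (pf s n * (?f * y))" by (simp add: mult.assoc)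
  also have "\<dots> = (\<Sum>j\<le>n. cc n j \<star> (s ^ (n - j) * T m (lp 0 j * (?f * y))))"
    using Suc.prems by (intro Suc.IH fy comm) auto
  also have "\<dots> = (\<Sum>j\<le>n. (q ^ (2 * n) * cc n j) \<star> (s ^ (Suc n - j) * ?t j) - cc n j \<star> (s ^ (n - j) * ?t (Suc j)))"
  proof (rule sum.cong[OF refl])
    fix j assume "j \<in> {..n}"
    then have j: "j \<le> n" by simp
    have "s ^ (Suc n - j) = s ^ (n - j) * s" using j by (simp add: Suc_diff_le power_commutes)
    then show "cc n j \<star> (s ^ (n - j) * T m (lp 0 j * (?f * y)))
      = (q ^ (2 * n) * cc n j) \<star> (s ^ (Suc n - j) * ?t j) - cc n j \<star> (s ^ (n - j) * ?t (Suc j))"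
      by (simp add: step_j[OF j] right_diff_distrib scl_simps mult.assoc mult.commute[of "q ^ (2 * n)"])
  qed
  also have "\<dots> = (\<Sum>j\<le>Suc n. (q ^ (2 * n) * cc n j) \<star> (s ^ (Suc n - j) * ?t j))
      - (\<Sum>j\<le>Suc n. (case j of 0 \<Rightarrow> 0 | Suc i \<Rightarrow> cc n i) \<star> (s ^ (Suc n - j) * ?t j))"
    by (simp only: sum_subtractf sum.atMost_Suc_shift[of "\<lambda>j. (case j of 0 \<Rightarrow> 0 | Suc i \<Rightarrow> cc n i) \<star> (s ^ (Suc n - j) * ?t j)"])
       (simp add: cc_zero)
  also have "\<dots> = (\<Sum>j\<le>Suc n. cc (Suc n) j \<star> (s ^ (Suc n - j) * ?t j))"
    by (simp add: sum_subtractf[symmetric] scale_left_diff_distrib del: sum.atMost_Suc)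
  finally show ?case .
qed (simp)

definition qfact :: "nat \<Rightarrow> 'a" where
  "qfact n = (\<Prod>i=1..n. qnum q i)"

lemma qfact_0 [simp]: "qfact 0 = 1" and qfact_Suc: "qfact (Suc n) = qnum q (Suc n) * qfact n"
  by (simp_all add: qfact_def)

lemma qfact_nonzero: "qfact n \<noteq> 0"
  using qnum_nonzero[OF gen] by (simp add: qfact_def)

text \<open>
  The recursion for \<open>cc\<close> is the Pascal rule \<open>[n + 1] = q\<^sup>i\<^sup>+\<^sup>1 [d + 1] + q\<^bsup>-(d+1)\<^esup> [i + 1]\<close> for
  Gaussian binomials, with \<open>n = i + 1 + d\<close>.
\<close>

lemma cc_closed:
  "j \<le> n \<Longrightarrow> cc n j * qfact j * qfact (n - j) = (- 1) ^ j * q ^ ((n - j) * (n - 1)) * qfact n"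
proof (induction n arbitrary: j)
  case (Suc n)
  have q0: "q \<noteq> 0" using gen by simp
  consider "j = 0" | "j = Suc n" | i where "j = Suc i" "Suc i \<le> n"
    using Suc.prems by (metis Suc_le_mono le_less not0_implies_Suc less_Suc_eq_le Suc_leI)
  then show ?case
  proof cases
    case 1
    have "cc n 0 = q ^ (n * (n - 1))" using Suc.IH[of 0] qfact_nonzero[of n] by simp
    moreover have "2 * n + n * (n - 1) = Suc n * n" by (cases n) auto
    then have "q ^ (2 * n) * q ^ (n * (n - 1)) = q ^ (Suc n * n)" by (metis power_add)
    ultimately show ?thesis using 1 by simp
  next
    case 2
    have "cc n n = (- 1) ^ n" using Suc.IH[of n] qfact_nonzero[of n] by simp
    then show ?thesis using 2 by (simp add: cc_zero)
  next
    case 3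
    define d where "d = n - Suc i"
    have n: "n = Suc (i + d)" using 3 by (simp add: d_def)
    have 1: "cc n (Suc i) * qfact (Suc i) * qfact d = (- 1) ^ Suc i * q ^ (d * (n - 1)) * qfact n"
      using Suc.IH[of "Suc i"] 3 by (simp add: d_def)
    have 2: "cc n i * qfact i * qfact (Suc d) = (- 1) ^ i * q ^ (Suc d * (n - 1)) * qfact n"
      using Suc.IH[of i] n by (simp add: Suc_diff_le)
    have "cc (Suc n) j * qfact j * qfact (Suc n - j)
        = q ^ (2 * n) * qnum q (Suc d) * (cc n (Suc i) * qfact (Suc i) * qfact d)
          - qnum q (Suc i) * (cc n i * qfact i * qfact (Suc d))"
      using 3 n by (simp add: qfact_Suc algebra_simps)
    also have "\<dots> = (- 1) ^ j * qfact n *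
        (q ^ (2 * n) * q ^ (d * (n - 1)) * qnum q (Suc d) + q ^ (Suc d * (n - 1)) * qnum q (Suc i))"
      unfolding 1 2 using 3 by (simp add: algebra_simps)
    also have "q ^ (2 * n) * q ^ (d * (n - 1)) = q ^ (Suc d * n) * q ^ Suc i"
      unfolding power_add[symmetric] by (rule arg_cong[of _ _ "power q"]) (simp add: n algebra_simps)
    also have "q ^ (Suc d * (n - 1)) = q ^ (Suc d * n) * inverse q ^ Suc d"
    proof -
      have "Suc d * n = Suc d * (n - 1) + Suc d" using n by simp
      then have "q ^ (Suc d * n) = q ^ (Suc d * (n - 1)) * q ^ Suc d" by (metis power_add)
      moreover have "q ^ Suc d * inverse q ^ Suc d = 1" using q0 by (simp only: power_mult_distrib[symmetric]) simp
      ultimately show ?thesis by (simp only: mult.assoc mult_1_right)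
    qed
    also have "q ^ (Suc d * n) * q ^ Suc i * qnum q (Suc d) + q ^ (Suc d * n) * inverse q ^ Suc d * qnum q (Suc i)
        = q ^ (Suc d * n) * qnum q (Suc n)"
      using qnum_add[OF gen, of "Suc i" "Suc d"] n by (simp add: algebra_simps)
    finally show ?thesis using 3 n by (simp add: qfact_Suc ac_simps)
  qed
qed simp

text \<open>
  Each partial trace lowers the skew-symmetrizer by one step, with the factor
  \<open>(q\<^sup>n \<delta> - [n]) / [n + 1] = q\<^sup>-\<^sup>m [m - n] / [n + 1]\<close>.
\<close>

lemma tr_P_lp:
  assumes \<delta>: "q ^ m * \<delta> = qnum q m" and "j \<le> n" "n \<le> m"
  shows "(q ^ (m * (n - j)) * qfact n * qfact (m - n)) \<star> tr 0 n (P 0 n * lp 0 j)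
    = (qfact j * qfact (m - j)) \<star> e j"
  using assms(2,3)
proof (induction n rule: dec_induct)
  case (step n)
  let ?t = "\<lambda>n. tr 0 n (P 0 n * lp 0 j)"
  have lpA: "lp 0 j \<in> A n" using A_mono[OF lp_mem[of 0 j], of n] step by simp
  have "qnum q (Suc n) \<star> E (Suc n) (P 0 (Suc n) * lp 0 j) = (q ^ n * \<delta> - qnum q n) \<star> (P 0 n * lp 0 j)"
  proof (cases "n = 0")
    case True
    then show ?thesis using E_left[of "lp 0 j" 0 1] E_one[of 0] lpA by (simp add: qnum_1 gen scl_simps)
  qed (use E_P[OF lpA] in simp)
  then have "tr 0 n (qnum q (Suc n) \<star> E (Suc n) (P 0 (Suc n) * lp 0 j))
      = tr 0 n ((q ^ n * \<delta> - qnum q n) \<star> (P 0 n * lp 0 j))"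
    by simp
  then have 1: "qnum q (Suc n) \<star> ?t (Suc n) = (q ^ n * \<delta> - qnum q n) \<star> ?t n"
    by (simp only: tr_scl tr.simps add_0)
  have 2: "q ^ m * (q ^ n * \<delta> - qnum q n) = qnum q (m - n)"
  proof -
    have "q ^ m * q ^ n * \<delta> = q ^ n * qnum q m" using \<delta> by (simp add: ac_simps)
    also have "\<dots> = q ^ n * (q ^ (m - n) * qnum q n + inverse q ^ n * qnum q (m - n))"
      using qnum_add[OF gen, of "m - n" n] step by simp
    also have "\<dots> = q ^ m * qnum q n + qnum q (m - n)"
      using gen step by (simp add: distrib_left power_inverse flip: power_add mult.assoc)
    finally show ?thesis by (simp add: algebra_simps)
  qed
  have 3: "(q ^ m * qnum q (Suc n)) \<star> ?t (Suc n) = qnum q (m - n) \<star> ?t n"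
    using 1 2 by (metis scale_scale)
  have "m - n = Suc (m - Suc n)" using step by simp
  then have 4: "qfact (m - n) = qnum q (m - n) * qfact (m - Suc n)" by (metis qfact_Suc)
  have exp: "q ^ (m * (Suc n - j)) = q ^ (m * (n - j)) * q ^ m"
    using step by (simp add: Suc_diff_le power_add)
  have "(q ^ (m * (Suc n - j)) * qfact (Suc n) * qfact (m - Suc n)) \<star> ?t (Suc n)
      = (q ^ (m * (n - j)) * qfact n * qfact (m - Suc n)) \<star> ((q ^ m * qnum q (Suc n)) \<star> ?t (Suc n))"
    by (simp add: exp qfact_Suc ac_simps)
  also have "\<dots> = (q ^ (m * (n - j)) * qfact n * qfact (m - n)) \<star> ?t n"
    unfolding 3 4 by (simp add: ac_simps)
  also have "\<dots> = (qfact j * qfact (m - j)) \<star> e j" using step by simp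
  finally show ?case .
qed (simp add: e_def)

text \<open>
  The Gaussian binomials from the expansion and from the partial traces cancel, and the remaining power
  of \<open>q\<close> is \<open>m + (m - j) (m - 1) - m (m - j) = j\<close>.
\<close>

theorem product_formula:
  assumes \<delta>: "q ^ m * \<delta> = qnum q m" and s: "s \<in> A 0" "\<And>x. s * x = x * s"
  shows "q ^ m \<star> T m (pf s m) = (\<Sum>j\<le>m. (- q) ^ j \<star> (s ^ (m - j) * e j))"
proof -
  have "q ^ m \<star> T m (pf s m) = q ^ m \<star> T m (pf s m * 1)" by simp
  also have "\<dots> = (\<Sum>j\<le>m. q ^ m \<star> (cc m j \<star> (s ^ (m - j) * T m (lp 0 j))))"
    by (subst T_pf[OF s order_refl A_one]) (simp_all add: scale_sum_right)
  also have "\<dots> = (\<Sum>j\<le>m. (- q) ^ j \<star> (s ^ (m - j) * e j))"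
  proof (rule sum.cong[OF refl])
    fix j assume "j \<in> {..m}"
    then have j: "j \<le> m" by simp
    have q0: "q \<noteq> 0" using gen by simp
    let ?c = "q ^ (m * (m - j)) * qfact m"
    have c: "?c \<star> T m (lp 0 j) = (qfact j * qfact (m - j)) \<star> e j"
      using tr_P_lp[OF \<delta> j order_refl] by (simp add: T_def)
    have "?c \<star> ((q ^ m * cc m j) \<star> T m (lp 0 j)) = (q ^ m * (cc m j * qfact j * qfact (m - j))) \<star> e j"
      using c by (metis (no_types, lifting) mult.assoc scale_left_commute scale_scale)
    also have "\<dots> = ?c \<star> ((- q) ^ j \<star> e j)"
    proof -
      have "q ^ m * q ^ ((m - j) * (m - 1)) = q ^ (m * (m - j)) * q ^ j"
      proof (cases "m = 0")
        case False
        define d where "d = m - j"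
        have m: "m = j + d" using j by (simp add: d_def)
        have "m * d = d + d * (m - 1)" using False by (cases m) (auto simp: algebra_simps)
        then have "m + (m - j) * (m - 1) = m * (m - j) + j"
          using m by (simp add: d_def[symmetric])
        then show ?thesis by (metis power_add)
      qed (use j in simp)
      then show ?thesis using cc_closed[OF j] by (simp add: power_minus[of q] ac_simps)
    qed
    finally have "(q ^ m * cc m j) \<star> T m (lp 0 j) = (- q) ^ j \<star> e j"
      using q0 qfact_nonzero[of m] by (metis mult_eq_0_iff power_not_zero scale_left_imp_eq)
    then show "q ^ m \<star> (cc m j \<star> (s ^ (m - j) * T m (lp 0 j))) = (- q) ^ j \<star> (s ^ (m - j) * e j)"
      by (metis scale_scale scl_right)
  qed
  finally show ?thesis .
qed

end

section \<open>The Cayley-Hamilton identity\<close>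

locale reflection_ideal = reflection_tower +
  fixes J :: "'b set"
  assumes J_zero: "0 \<in> J"
    and J_diff: "x \<in> J \<Longrightarrow> y \<in> J \<Longrightarrow> x - y \<in> J"
    and J_left: "x \<in> J \<Longrightarrow> y * x \<in> J"
    and J_right: "x \<in> J \<Longrightarrow> x * y \<in> J"
    and J_E: "x \<in> J \<Longrightarrow> E i x \<in> J"
    and reflection: "r 1 * l * r 1 * l - l * r 1 * l * r 1 \<in> J"
begin

text \<open>
  Equality of operators over the algebra defined by the relations. The ring of coefficients is the free
  algebra, and \<open>J\<close> consists of the operators with entries in the ideal.
\<close>

definition eqv :: "'b \<Rightarrow> 'b \<Rightarrow> bool" (infix "\<simeq>" 50) where
  "x \<simeq> y \<longleftrightarrow> x - y \<in> J"

lemma eqv_refl [simp]: "x \<simeq> x"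
  by (simp add: eqv_def J_zero)

lemma eqv_sym: "x \<simeq> y \<Longrightarrow> y \<simeq> x"
  using J_diff[OF J_zero, of "x - y"] by (simp add: eqv_def)

lemma eqv_trans [trans]: "x \<simeq> y \<Longrightarrow> y \<simeq> z \<Longrightarrow> x \<simeq> z"
  using J_diff[of "x - y" "z - y"] eqv_sym[of y z] by (simp add: eqv_def)

lemma eqv_eq_trans [trans]: "x \<simeq> y \<Longrightarrow> y = z \<Longrightarrow> x \<simeq> z"
  and eq_eqv_trans [trans]: "x = y \<Longrightarrow> y \<simeq> z \<Longrightarrow> x \<simeq> z"
  by simp_all

lemma eqv_diff: "x \<simeq> y \<Longrightarrow> z \<simeq> w \<Longrightarrow> x - z \<simeq> y - w"
  using J_diff[of "x - y" "z - w"] by (simp add: eqv_def algebra_simps)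

lemma eqv_left: "x \<simeq> y \<Longrightarrow> z * x \<simeq> z * y"
  using J_left[of "x - y" z] by (simp add: eqv_def algebra_simps)

lemma eqv_right: "x \<simeq> y \<Longrightarrow> x * z \<simeq> y * z"
  using J_right[of "x - y" z] by (simp add: eqv_def algebra_simps)

lemma eqv_scl: "x \<simeq> y \<Longrightarrow> c \<star> x \<simeq> c \<star> y"
  using eqv_left[of x y "c \<star> 1"] by (simp add: scl_left)

lemma eqv_E: "x \<simeq> y \<Longrightarrow> E i x \<simeq> E i y"
  using J_E[of "x - y" i] by (simp add: eqv_def E_diff)

lemma eqv_tr: "x \<simeq> y \<Longrightarrow> tr a n x \<simeq> tr a n y"
  by (induction n arbitrary: x y) (auto intro: eqv_E)

text \<open>
  For \<open>i = 1\<close> this is the reflection equation. Conjugation by \<open>r\<^sub>i r\<^sub>i\<^sub>+\<^sub>1\<close> moves the relation one position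
  to the right.
\<close>

lemma r_ell_ell: "1 \<le> i \<Longrightarrow> r i * (ell i * ell (Suc i)) \<simeq> ell i * ell (Suc i) * r i"
proof (induction i rule: nat_induct_at_least)
  case base
  have "r 1 * (ell 1 * ell (Suc 1)) = r 1 * l * r 1 * l * rinv 1"
    by (simp add: ell_Suc ell_1 mult.assoc)
  also have "\<dots> \<simeq> l * r 1 * l * r 1 * rinv 1"
    using reflection by (intro eqv_right) (simp add: eqv_def)
  also have "\<dots> = ell 1 * ell (Suc 1) * r 1"
    by (simp add: ell_Suc ell_1 mult.assoc r_rinv rinv_r)
  finally show ?case .
next
  case (Suc i)
  let ?z = "r i * r (Suc i)" and ?z' = "rinv (Suc i) * rinv i"
  have zz: "?z * ?z' = 1" using Suc.hyps by (simp add: mult.assoc r_rinv r_rinv')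
  then have zz': "x * ?z * ?z' = x" for x by (simp only: mult.assoc mult_1_right)
  have "?z * r i = r (Suc i) * ?z" using braid[of i] Suc.hyps by (simp add: mult.assoc)
  moreover have "?z * ell i = ell (Suc i) * ?z"
  proof -
    have "r i * r (Suc i) * ell i = r i * ell i * r (Suc i)"
      using r_ell_comm[of "Suc i" i] Suc.hyps by (simp add: mult.assoc)
    then show ?thesis using r_ell[of i] Suc.hyps by (simp add: mult.assoc)
  qed
  moreover have "?z * ell (Suc i) = ell (Suc (Suc i)) * ?z"
  proof -
    have "r i * r (Suc i) * ell (Suc i) = r i * ell (Suc (Suc i)) * r (Suc i)"
      using r_ell[of "Suc i"] by (simp add: mult.assoc)
    then show ?thesis using r_ell_comm[of i "Suc (Suc i)"] Suc.hyps by (simp add: mult.assoc)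
  qed
  ultimately have z: "?z * (r i * (ell i * ell (Suc i))) = r (Suc i) * (ell (Suc i) * ell (Suc (Suc i))) * ?z"
    "?z * (ell i * ell (Suc i) * r i) = ell (Suc i) * ell (Suc (Suc i)) * r (Suc i) * ?z"
    by (metis mult.assoc)+
  have "?z * (r i * (ell i * ell (Suc i))) * ?z' \<simeq> ?z * (ell i * ell (Suc i) * r i) * ?z'"
    by (intro eqv_right eqv_left Suc.IH)
  then show ?case unfolding z by (simp only: zz')
qed

lemma r_lp: "a < i \<Longrightarrow> i < a + k \<Longrightarrow> r i * lp a k \<simeq> lp a k * r i"
proof (induction k)
  case (Suc k)
  show ?case
  proof (cases "i = a + k")
    case True
    then obtain j where k: "k = Suc j" using Suc.prems by (cases k) auto
    have "r i * lp a (Suc k) = (r i * lp a j) * (ell i * ell (Suc i))"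
      using True k by (simp add: mult.assoc)
    also have "r i * lp a j = lp a j * r i"
      using r_comm[OF lp_mem[of a j], of i] True k by simp
    also have "lp a j * r i * (ell i * ell (Suc i)) = lp a j * (r i * (ell i * ell (Suc i)))"
      by (simp only: mult.assoc)
    also have "\<dots> \<simeq> lp a j * (ell i * ell (Suc i) * r i)"
      using Suc.prems by (intro eqv_left r_ell_ell) simp
    also have "\<dots> = lp a (Suc k) * r i" using True k by (simp add: mult.assoc)
    finally show ?thesis .
  next
    case False
    have "r i * lp a (Suc k) = (r i * lp a k) * ell (a + Suc k)" by (simp add: mult.assoc)
    also have "\<dots> \<simeq> lp a k * r i * ell (a + Suc k)" using Suc False by (intro eqv_right) auto
    also have "\<dots> = lp a (Suc k) * r i"
      using r_ell_comm[of i "a + Suc k"] Suc.prems False by (simp add: mult.assoc)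
    finally show ?thesis .
  qed
qed simp

lemma asym_eqv_commute:
  assumes "\<And>i. 1 \<le> i \<Longrightarrow> i < k \<Longrightarrow> g i * x \<simeq> x * g i"
  shows "asym q g k * x \<simeq> x * asym q g k"
  using assms
proof (induction k)
  case (Suc k)
  show ?case
  proof (cases "k = 0")
    case False
    let ?P = "asym q g k" and ?h = "q ^ k \<star> 1 - qnum q k \<star> g k"
    have IH: "?P * x \<simeq> x * ?P" using Suc by simp
    have h: "?h * x \<simeq> x * ?h"
      using Suc.prems[of k] False
      by (simp add: left_diff_distrib right_diff_distrib scl_simps eqv_diff eqv_scl)
    have "?P * ?h * ?P * x = ?P * ?h * (?P * x)" by (simp only: mult.assoc)
    also have "\<dots> \<simeq> ?P * ?h * (x * ?P)" by (intro eqv_left IH)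
    also have "\<dots> = ?P * ((?h * x) * ?P)" by (simp only: mult.assoc)
    also have "\<dots> \<simeq> ?P * ((x * ?h) * ?P)" by (intro eqv_left eqv_right h)
    also have "\<dots> = (?P * x) * (?h * ?P)" by (simp only: mult.assoc)
    also have "\<dots> \<simeq> (x * ?P) * (?h * ?P)" by (intro eqv_right IH)
    also have "\<dots> = x * (?P * ?h * ?P)" by (simp only: mult.assoc)
    finally show ?thesis using False by (simp add: asym.simps(2) scl_simps eqv_scl)
  qed simp
qed simp

lemma P_lp: "P a k * lp a k \<simeq> W a k"
  unfolding W_def by (rule asym_eqv_commute) (rule r_lp, auto)

text \<open>
  The trace of \<open>r\<^sub>k\<^sup>-\<^sup>1\<close>. It equals \<open>q\<^bsup>-2m\<^esup>\<close> when \<open>q\<^sup>m \<delta> = [m]\<close>.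
\<close>

definition \<kappa> :: 'a where
  "\<kappa> = 1 - (q - inverse q) * \<delta>"

lemma E_rinv: "1 \<le> k \<Longrightarrow> E (Suc k) (rinv k) = \<kappa> \<star> 1"
  using scale_left_diff_distrib[of 1 "(q - inverse q) * \<delta>" 1]
  by (simp add: rinv_def E_diff E_scl E_r E_one \<kappa>_def)

text \<open>
  The first position is not traced over, so \<open>G k\<close> is a matrix over the coefficient ring. The inverse of
  \<open>r\<^sub>1\<close> rather than \<open>r\<^sub>1\<close> has to appear here because \<open>r\<^sub>1\<^sup>-\<^sup>1 L\<^sub>2 = L\<^sub>1 r\<^sub>1\<^sup>-\<^sup>1\<close>, so that \<open>L\<^sub>1\<close> can leave
  the trace to the left.
\<close>

definition G :: "nat \<Rightarrow> 'b" where
  "G k = (\<kappa> * q ^ k) \<star> e k - qnum q k \<star> tr 1 k (rinv 1 * W 1 k)"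

text \<open>
  After expanding the skew-symmetrizer, one of the two outer idempotents is moved around the trace,
  through the product of the barred copies, and merged with the other one. Replacing \<open>r\<^sub>1\<close> by its inverse
  turns the coefficient \<open>q\<^sup>k\<close> into \<open>q\<^sup>k - (q - q\<^sup>-\<^sup>1) [k] = q\<^sup>-\<^sup>k\<close>, which is \<open>\<kappa> q\<^sup>k\<close> by assumption.
\<close>

lemma G_trace:
  assumes "\<kappa> * q ^ k = inverse q ^ k"
  shows "tr 1 k (qnum q (Suc k) \<star> P 0 (Suc k) * lp 1 k) \<simeq> G k"
proof -
  let ?P = "P 1 k" and ?h = "q ^ k \<star> 1 - qnum q k \<star> r 1"
  have hA: "?h \<in> A (1 + k)" if "k > 0"
    using that A_mono[OF r_mem[of 1], of "1 + k"] by (intro A_diff A_scl A_one) auto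
  have hP: "?h * ?P * lp 1 k \<in> A (1 + k)" 
  proof (cases "k = 0")
    case False then show ?thesis using hA P_mem[of 1 k] lp_mem[of 1 k] by (intro A_mult) auto
  qed (simp add: A_scl A_one)
  have "tr 1 k (qnum q (Suc k) \<star> P 0 (Suc k) * lp 1 k) = tr 1 k (?P * (?h * ?P * lp 1 k))"
    using P_Suc_left[of k 0] by (simp add: scl_left mult.assoc flip: scl_left)
  also have "\<dots> = tr 1 k (?h * ?P * lp 1 k * ?P)"
    using tr_cyclic_P[of 1 1 k k, OF _ _ hP] by simp
  also have "\<dots> = tr 1 k (?h * (?P * lp 1 k) * ?P)" by (simp only: mult.assoc)
  also have "\<dots> \<simeq> tr 1 k (?h * W 1 k * ?P)"
    by (intro eqv_tr eqv_right eqv_left P_lp)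
  also have "\<dots> = tr 1 k (?h * W 1 k)"
    by (simp only: W_def mult.assoc P_idem)
  also have "?h = inverse q ^ k \<star> 1 - qnum q k \<star> rinv 1"
  proof -
    have "qnum q k * (q - inverse q) = q ^ k - inverse q ^ k"
      using generic_diff[OF gen] by (simp add: qnum_def)
    then have "qnum q k \<star> ((q - inverse q) \<star> 1) = q ^ k \<star> 1 - inverse q ^ k \<star> (1 :: 'b)"
      by (simp only: scale_scale) (simp only: scale_left_diff_distrib)
    then show ?thesis by (simp only: rinv_def scale_right_diff_distrib) simp
  qed
  also have "tr 1 k ((inverse q ^ k \<star> 1 - qnum q k \<star> rinv 1) * W 1 k) = G k"
    by (simp only: G_def assms left_diff_distrib scl_left tr_diff tr_scl tr_W mult_1)
  finally show ?thesis .
qed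

text \<open>
  The outermost factors of \<open>Z 1 k\<close> and of its inverse are removed by \<open>E_conj\<close>, because the other factors
  do not touch the last position. When \<open>r\<^sub>2\<close> is the only factor left, its inverse cancels against the
  \<open>r\<^sub>2\<close> on the right.
\<close>

lemma tr_sandwich:
  assumes "1 \<le> k" "v \<in> A (Suc k)"
  shows "tr 1 (Suc k) (rinv 1 * (Z 1 k * v * Zinv 1 k) * r 2) = tr 1 k (rinv 1 * v)"
  using assms
proof (induction k arbitrary: v rule: nat_induct_at_least)
  case base
  have "rinv 1 * (Z 1 1 * v * Zinv 1 1) * r 2 = rinv 1 * (r 2 * v)"
    by (simp add: mult.assoc numeral_2_eq_2 rinv_r)
  moreover have "E 3 (rinv 1 * (r 2 * v)) = rinv 1 * v"
    using E_left[of "rinv 1" 2 "r 2 * v"] E_right[of v 2 "r 2"] E_r[of 2] rinv_mem[of 1] base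
    by (simp add: numeral_3_eq_3 numeral_2_eq_2)
  ultimately show ?case by (simp add: numeral_3_eq_3 numeral_2_eq_2)
next
  case (Suc k)
  let ?n = "Suc (Suc k)"
  have A: "rinv 1 * Z 1 k \<in> A ?n" "Zinv 1 k * r 2 \<in> A ?n"
    using Z_mem[of 1 k] Zinv_mem[of 1 k] A_mono[OF rinv_mem[of 1], of ?n] A_mono[OF r_mem[of 2], of ?n] Suc.hyps
    by (auto intro!: A_mult)
  have "rinv 1 * (Z 1 (Suc k) * v * Zinv 1 (Suc k)) * r 2
      = (rinv 1 * Z 1 k) * (r ?n * v * rinv ?n) * (Zinv 1 k * r 2)"
    by (simp add: mult.assoc)
  also have "E (Suc ?n) \<dots> = (rinv 1 * Z 1 k) * E (Suc ?n) (r ?n * v * rinv ?n) * (Zinv 1 k * r 2)"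
    by (simp only: E_left[OF A(1)] E_right[OF A(2)])
  also have "E (Suc ?n) (r ?n * v * rinv ?n) = E ?n v"
    using E_conj[of ?n v] Suc.prems by (simp add: rinv_def)
  finally have "E (Suc ?n) (rinv 1 * (Z 1 (Suc k) * v * Zinv 1 (Suc k)) * r 2)
      = (rinv 1 * Z 1 k) * E ?n v * (Zinv 1 k * r 2)" .
  moreover have "E ?n v \<in> A (Suc k)" using Suc.prems by (rule E_mem)
  moreover have "E ?n (rinv 1 * v) = rinv 1 * E ?n v"
    using A_mono[OF rinv_mem[of 1], of "Suc k"] Suc.hyps by (intro E_left) auto
  ultimately show ?case using Suc.IH[of "E ?n v"] by (simp add: mult.assoc)
qed

text \<open>
  Once \<open>L\<^sub>1\<close> has left the trace, the skew-symmetrizer is expanded again, now around \<open>r\<^sub>2\<close>. The scalar part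
  leaves the coefficient \<open>e k\<close> and the trace \<open>\<kappa>\<close> of \<open>r\<^sub>1\<^sup>-\<^sup>1\<close>; in the other part the trace reduces to
  the one with a strand less.
\<close>

lemma G_step: "qnum q (Suc k) \<star> tr 1 (Suc k) (rinv 1 * W 1 (Suc k)) \<simeq> l * G k"
proof -
  let ?k = "Suc k"
  let ?Q = "P 2 k" and ?h = "q ^ k \<star> 1 - qnum q k \<star> r 2"
  have l2: "rinv 1 * ell 2 = l * rinv 1"
    by (simp add: numeral_2_eq_2 ell_Suc ell_1 mult.assoc rinv_r')
  have "rinv 1 * W 1 ?k = (rinv 1 * ell 2) * (lp 2 k * P 1 ?k)"
    using lp_Suc_left[of 1 k] by (simp add: W_def mult.assoc numeral_2_eq_2)
  also have "\<dots> = l * (rinv 1 * lp 2 k * P 1 ?k)"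
    by (simp only: l2 mult.assoc)
  finally have "qnum q ?k \<star> tr 1 ?k (rinv 1 * W 1 ?k) = l * tr 1 ?k (rinv 1 * lp 2 k * (qnum q ?k \<star> P 1 ?k))"
    by (simp only: tr_left[OF l_mem] scl_right tr_scl)
  also have "\<dots> \<simeq> l * G k"
  proof (rule eqv_left)
    have P2: "qnum q ?k \<star> P 1 ?k = ?Q * ?h * ?Q"
      using P_Suc_left[of k 1] by (simp add: numeral_2_eq_2)
    have rQ: "rinv 1 * ?Q = ?Q * rinv 1"
      using P_comm[of "rinv 1" 2 k] rinv_mem[of 1] by (simp add: numeral_2_eq_2)
    have mem: "rinv 1 * lp 2 k * (?Q * ?h) \<in> A (1 + ?k)"
    proof -
      have "?h \<in> A (1 + ?k)" if "k \<noteq> 0"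
        using that A_mono[OF r_mem[of 2], of "1 + ?k"] by (intro A_diff A_scl A_one) auto
      then have "?h \<in> A (1 + ?k)" by (cases "k = 0") (auto intro: A_one A_scl)
      then show ?thesis
        using A_mono[OF rinv_mem[of 1], of "1 + ?k"] lp_mem[of 2 k] P_mem[of 2 k]
        by (auto intro!: A_mult simp: numeral_2_eq_2)
    qed
    have "rinv 1 * W 2 k * (?Q * ?h) = rinv 1 * lp 2 k * (?Q * ?Q) * ?h"
      by (simp only: W_def mult.assoc)
    also have "\<dots> = rinv 1 * W 2 k * ?h" by (simp only: P_idem) (simp only: W_def mult.assoc)
    finally have WQ: "rinv 1 * W 2 k * (?Q * ?h) = rinv 1 * W 2 k * ?h" .
    have e_k: "tr 1 ?k (rinv 1 * W 2 k) = \<kappa> \<star> e k"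
    proof -
      have "tr 2 k (rinv 1 * W 2 k) = rinv 1 * e k"
        using tr_left[of "rinv 1" 2 k "W 2 k"] tr_W[of 2 k] rinv_mem[of 1] by (simp add: numeral_2_eq_2)
      moreover have "E 2 (rinv 1 * e k) = \<kappa> \<star> e k"
        using E_right[of "e k" 1 "rinv 1"] A_mono[OF e_mem, of 1 k] E_rinv[of 1]
        by (simp add: numeral_2_eq_2 scl_left)
      ultimately show ?thesis using tr_Suc_left[of 1 k] by (simp add: numeral_2_eq_2)
    qed
    have sandwich: "qnum q k \<star> tr 1 ?k (rinv 1 * W 2 k * r 2) = qnum q k \<star> tr 1 k (rinv 1 * W 1 k)"
    proof (cases "k = 0")
      case False
      then show ?thesis
        using tr_sandwich[of k "W 1 k"] W_mem[of 1 k] W_shift[of 1 k] by (simp add: numeral_2_eq_2)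
    qed simp
    have "tr 1 ?k (rinv 1 * lp 2 k * (qnum q ?k \<star> P 1 ?k)) = tr 1 ?k ((rinv 1 * lp 2 k * (?Q * ?h)) * ?Q)"
      by (simp only: P2 mult.assoc)
    also have "\<dots> = tr 1 ?k (?Q * (rinv 1 * lp 2 k * (?Q * ?h)))"
      using tr_cyclic_P[of 1 2 k ?k, OF _ _ mem] by simp
    also have "\<dots> = tr 1 ?k (rinv 1 * (?Q * lp 2 k) * (?Q * ?h))"
      by (simp only: rQ[symmetric] flip: mult.assoc)
    also have "\<dots> \<simeq> tr 1 ?k (rinv 1 * W 2 k * (?Q * ?h))"
      by (intro eqv_tr eqv_right eqv_left P_lp)
    also have "\<dots> = q ^ k \<star> tr 1 ?k (rinv 1 * W 2 k) - qnum q k \<star> tr 1 ?k (rinv 1 * W 2 k * r 2)"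
      by (simp only: WQ) (simp only: right_diff_distrib scl_right tr_diff tr_scl mult_1_right)
    also have "\<dots> = q ^ k \<star> (\<kappa> \<star> e k) - qnum q k \<star> tr 1 k (rinv 1 * W 1 k)"
      by (simp only: e_k sandwich)
    finally show "tr 1 ?k (rinv 1 * lp 2 k * (qnum q ?k \<star> P 1 ?k)) \<simeq> G k"
      by (simp only: G_def scale_scale mult.commute[of \<kappa>])
  qed
  finally show ?thesis .
qed

lemma G_expansion: "(- 1) ^ k \<star> G k \<simeq> \<kappa> \<star> (\<Sum>j\<le>k. (- q) ^ j \<star> (l ^ (k - j) * e j))"
proof (induction k)
  case 0
  show ?case by (simp add: G_def)
next
  case (Suc k)
  let ?S = "\<lambda>k. \<Sum>j\<le>k. (- q) ^ j \<star> (l ^ (k - j) * e j)"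
  have 1: "?S (Suc k) = (- q) ^ Suc k \<star> e (Suc k) + l * ?S k"
    by (simp add: sum_distrib_left scl_right Suc_diff_le mult.assoc)
  have "G (Suc k) \<simeq> (\<kappa> * q ^ Suc k) \<star> e (Suc k) - l * G k"
    unfolding G_def[of "Suc k"] by (intro eqv_diff eqv_refl G_step)
  then have "(- 1) ^ Suc k \<star> G (Suc k) \<simeq> (- 1) ^ Suc k \<star> ((\<kappa> * q ^ Suc k) \<star> e (Suc k) - l * G k)"
    by (rule eqv_scl)
  also have "\<dots> = \<kappa> \<star> ((- q) ^ Suc k \<star> e (Suc k)) - (- 1) \<star> (l * ((- 1) ^ k \<star> G k))"
    by (simp add: scl_simps power_minus[of q] ac_simps)
  also have "\<dots> \<simeq> \<kappa> \<star> ((- q) ^ Suc k \<star> e (Suc k)) - (- 1) \<star> (l * (\<kappa> \<star> ?S k))"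
    by (intro eqv_diff eqv_refl eqv_scl eqv_left Suc.IH)
  also have "\<dots> = \<kappa> \<star> ?S (Suc k)" unfolding 1 by (simp add: scl_simps)
  finally show ?case .
qed

theorem cayley_hamilton:
  assumes \<delta>: "q ^ m * \<delta> = qnum q m" and "P 0 (Suc m) = 0"
  shows "(\<Sum>j\<le>m. (- q) ^ j \<star> (l ^ (m - j) * e j)) \<in> J"
proof -
  have q0: "q \<noteq> 0" using gen by simp
  have "(q - inverse q) * (q ^ m * \<delta>) = q ^ m - inverse q ^ m"
    using \<delta> generic_diff[OF gen] by (simp add: qnum_def)
  then have \<kappa>: "\<kappa> * q ^ m = inverse q ^ m"
    by (simp add: \<kappa>_def algebra_simps)
  have "tr 1 m 0 = 0" using tr_scl[of 1 m 0 0] by simp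
  then have "0 \<simeq> G m" using G_trace[OF \<kappa>] assms(2) by simp
  then have "0 \<simeq> (- 1) ^ m \<star> G m" using eqv_scl by fastforce
  also note G_expansion
  finally have "(inverse \<kappa>) \<star> 0 \<simeq> inverse \<kappa> \<star> \<kappa> \<star> (\<Sum>j\<le>m. (- q) ^ j \<star> (l ^ (m - j) * e j))"
    by (rule eqv_scl)
  moreover have "\<kappa> \<noteq> 0" using \<kappa> q0 by auto
  ultimately show ?thesis using eqv_sym by (fastforce simp: eqv_def)
qed

end

section \<open>Row-finite matrices\<close>

text \<open>
  Square matrices over an arbitrary index set with finitely many nonzero entries in each row. They form
  a ring, also when the entries do not commute.
\<close>

typedef (overloaded) ('i, 'a::zero) rfm = "{A :: 'i \<Rightarrow> 'i \<Rightarrow> 'a. \<forall>i. finite {j. A i j \<noteq> 0}}"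
  morphisms ent Rfm
  by (rule exI[of _ "\<lambda>_ _. 0"]) simp

setup_lifting type_definition_rfm

lemma finite_row [simp]: "finite {j. ent X i j \<noteq> 0}"
  using ent[of X] by simp

lemma rfm_eqI: "(\<And>i j. ent X i j = ent Y i j) \<Longrightarrow> X = Y"
  by (metis ent_inject ext)

lemma finite_support_combine:
  assumes "finite {j. f j \<noteq> 0}" "finite {j. g j \<noteq> 0}" "\<And>j. f j = 0 \<Longrightarrow> g j = 0 \<Longrightarrow> h j = 0"
  shows "finite {j. h j \<noteq> 0}"
  by (rule finite_subset[of _ "{j. f j \<noteq> 0} \<union> {j. g j \<noteq> 0}"]) (use assms in auto)

instantiation rfm :: (type, ring_1) ring_1
begin

lift_definition zero_rfm :: "('a, 'b) rfm" is "\<lambda>_ _. 0" by simp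

lift_definition one_rfm :: "('a, 'b) rfm" is "\<lambda>i j. if i = j then 1 else 0" by simp

lift_definition plus_rfm :: "('a, 'b) rfm \<Rightarrow> ('a, 'b) rfm \<Rightarrow> ('a, 'b) rfm"
  is "\<lambda>A B i j. A i j + B i j"
  subgoal for A B i by (rule finite_support_combine[of "A i" "B i"]) auto
  done

lift_definition uminus_rfm :: "('a, 'b) rfm \<Rightarrow> ('a, 'b) rfm" is "\<lambda>A i j. - A i j" by simp

lift_definition minus_rfm :: "('a, 'b) rfm \<Rightarrow> ('a, 'b) rfm \<Rightarrow> ('a, 'b) rfm"
  is "\<lambda>A B i j. A i j - B i j"
  subgoal for A B i by (rule finite_support_combine[of "A i" "B i"]) auto
  done

lift_definition times_rfm :: "('a, 'b) rfm \<Rightarrow> ('a, 'b) rfm \<Rightarrow> ('a, 'b) rfm"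
  is "\<lambda>A B i j. \<Sum>k | A i k \<noteq> 0. A i k * B k j"
  subgoal premises * for A B i
  proof -
    have "{j. (\<Sum>k | A i k \<noteq> 0. A i k * B k j) \<noteq> 0} \<subseteq> (\<Union>k\<in>{k. A i k \<noteq> 0}. {j. B k j \<noteq> 0})"
      by (auto elim!: sum.not_neutral_contains_not_neutral)
    then show "finite {j. (\<Sum>k | A i k \<noteq> 0. A i k * B k j) \<noteq> 0}"
      by (rule finite_subset) (use * in auto)
  qed
  done

lemma ent_mult_eq:
  fixes X Y :: "('a, 'b) rfm"
  assumes "finite S" "\<And>k. k \<notin> S \<Longrightarrow> ent X i k = 0 \<or> ent Y k j = 0"
  shows "ent (X * Y) i j = (\<Sum>k\<in>S. ent X i k * ent Y k j)"
proof -
  have "ent (X * Y) i j = (\<Sum>k | ent X i k \<noteq> 0. ent X i k * ent Y k j)"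
    by (simp add: times_rfm.rep_eq)
  also have "\<dots> = (\<Sum>k\<in>S \<union> {k. ent X i k \<noteq> 0}. ent X i k * ent Y k j)"
    using assms(1) by (intro sum.mono_neutral_left) auto
  also have "\<dots> = (\<Sum>k\<in>S. ent X i k * ent Y k j)"
    using assms by (intro sum.mono_neutral_right) (auto, force)
  finally show ?thesis .
qed

instance
proof
  fix X Y Z :: "('a, 'b) rfm"
  show "X * Y * Z = X * (Y * Z)"
  proof (rule rfm_eqI)
    fix i j
    let ?S = "{k. ent X i k \<noteq> 0}" and ?T = "\<Union>k\<in>{k. ent X i k \<noteq> 0}. {j. ent Y k j \<noteq> 0}"
    have fin: "finite ?T" by simp
    have XY: "ent (X * Y) i h = (\<Sum>k\<in>?S. ent X i k * ent Y k h)" for h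
      by (simp add: times_rfm.rep_eq)
    have "ent (X * Y * Z) i j = (\<Sum>h\<in>?T. ent (X * Y) i h * ent Z h j)"
      by (rule ent_mult_eq[OF fin]) (auto simp: XY intro!: sum.neutral)
    also have "\<dots> = (\<Sum>k\<in>?S. ent X i k * (\<Sum>h\<in>?T. ent Y k h * ent Z h j))"
      by (simp add: XY sum_distrib_left sum_distrib_right mult.assoc) (rule sum.swap)
    also have "\<dots> = (\<Sum>k\<in>?S. ent X i k * ent (Y * Z) k j)"
      by (intro sum.cong refl arg_cong[of _ _ "(*) _"] ent_mult_eq[symmetric] fin) auto
    also have "\<dots> = ent (X * (Y * Z)) i j" by (simp add: times_rfm.rep_eq)
    finally show "ent (X * Y * Z) i j = ent (X * (Y * Z)) i j" .
  qed
  show "1 * X = X"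
    by (rule rfm_eqI) (subst ent_mult_eq[of "{_}"], auto simp: one_rfm.rep_eq)
  show "X * 1 = X"
    by (rule rfm_eqI) (subst ent_mult_eq[of "{_}"], auto simp: one_rfm.rep_eq)
  show "(X + Y) * Z = X * Z + Y * Z"
  proof (rule rfm_eqI)
    fix i j
    let ?S = "{k. ent X i k \<noteq> 0} \<union> {k. ent Y i k \<noteq> 0}"
    have "ent U i k = 0 \<or> ent Z k j = 0" if "k \<notin> ?S" "U \<in> {X, Y, X + Y}" for k U
      using that by (auto simp: plus_rfm.rep_eq)
    then have "ent (U * Z) i j = (\<Sum>k\<in>?S. ent U i k * ent Z k j)" if "U \<in> {X, Y, X + Y}" for U
      using that by (intro ent_mult_eq) auto
    then show "ent ((X + Y) * Z) i j = ent (X * Z + Y * Z) i j"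
      by (simp add: plus_rfm.rep_eq distrib_right sum.distrib)
  qed
  show "X * (Y + Z) = X * Y + X * Z"
    by (rule rfm_eqI) (simp add: times_rfm.rep_eq plus_rfm.rep_eq distrib_left sum.distrib)
  show "(0 :: ('a, 'b) rfm) \<noteq> 1"
  proof
    assume "(0 :: ('a, 'b) rfm) = 1"
    then have "ent (0 :: ('a, 'b) rfm) undefined undefined = ent 1 undefined undefined" by simp
    then show False by (simp add: zero_rfm.rep_eq one_rfm.rep_eq)
  qed
qed (rule rfm_eqI; simp add: plus_rfm.rep_eq zero_rfm.rep_eq minus_rfm.rep_eq uminus_rfm.rep_eq add.assoc;
     simp add: add.commute)+

end

lemmas ent_simps [simp] = zero_rfm.rep_eq one_rfm.rep_eq plus_rfm.rep_eq minus_rfm.rep_eq uminus_rfm.rep_eq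

lemma ent_sum: "ent (sum f S) i j = (\<Sum>x\<in>S. ent (f x) i j)"
  by (induction S rule: infinite_finite_induct) auto

section \<open>Operators on an infinite tensor power\<close>

text \<open>
  A basis of the tensor power is given by the maps from the positions to the basis of \<open>V\<close>. The positions
  are counted from 1, so that the position 0 is never acted on.
\<close>

type_synonym ('n, 'a) oper = "(nat \<Rightarrow> 'n, 'a) rfm"

lift_definition op1 :: "nat \<Rightarrow> ('n::finite, 'a::zero) matrix1 \<Rightarrow> ('n, 'a) oper" is
  "\<lambda>p M I J. if \<forall>r. r \<noteq> p \<longrightarrow> I r = J r then M $ I p $ J p else 0"
  subgoal for p M I
  proof (rule finite_subset[of _ "range (\<lambda>c. I(p := c))"], rule subsetI)
    fix J assume "J \<in> {J. (if \<forall>r. r \<noteq> p \<longrightarrow> I r = J r then M $ I p $ J p else 0) \<noteq> 0}"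
    then have "J = I(p := J p)" by (auto split: if_splits simp: fun_eq_iff)
    then show "J \<in> range (\<lambda>c. I(p := c))" by blast
  qed simp
  done

definition upd2 :: "nat \<Rightarrow> (nat \<Rightarrow> 'n) \<Rightarrow> 'n \<times> 'n \<Rightarrow> nat \<Rightarrow> 'n" where
  "upd2 p I u = I(p := fst u, Suc p := snd u)"

lemma inj_upd2: "inj (upd2 p I)"
proof (rule injI)
  fix u v assume "upd2 p I u = upd2 p I v"
  then have "upd2 p I u p = upd2 p I v p" "upd2 p I u (Suc p) = upd2 p I v (Suc p)" by simp_all
  then show "u = v" by (simp add: upd2_def prod_eq_iff)
qed

lemma upd2_at [simp]: "upd2 p I u p = fst u" "upd2 p I u (Suc p) = snd u"
  "r \<noteq> p \<Longrightarrow> r \<noteq> Suc p \<Longrightarrow> upd2 p I u r = I r"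
  by (simp_all add: upd2_def)

definition agree2 :: "nat \<Rightarrow> (nat \<Rightarrow> 'n) \<Rightarrow> (nat \<Rightarrow> 'n) \<Rightarrow> bool" where
  "agree2 p I J \<longleftrightarrow> (\<forall>r. r \<noteq> p \<and> r \<noteq> Suc p \<longrightarrow> I r = J r)"

lemma agree2_iff: "agree2 p I J \<longleftrightarrow> J = upd2 p I (J p, J (Suc p))"
  by (auto simp: agree2_def upd2_def fun_eq_iff)

lemma agree2_upd2 [simp]: "agree2 p (upd2 p I u) J \<longleftrightarrow> agree2 p I J" "agree2 p I (upd2 p J u) \<longleftrightarrow> agree2 p I J"
  by (auto simp: agree2_def)

lemma agree2_refl [simp]: "agree2 p I I"
  by (simp add: agree2_def)

lemma agree2_sym: "agree2 p I J \<longleftrightarrow> agree2 p J I"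
  by (auto simp: agree2_def)

lift_definition op2 :: "nat \<Rightarrow> ('n::finite, 'a::zero) matrix2 \<Rightarrow> ('n, 'a) oper" is
  "\<lambda>p M I J. if agree2 p I J then M $ (I p, I (Suc p)) $ (J p, J (Suc p)) else 0"
  subgoal for p M I
    by (rule finite_subset[of _ "range (upd2 p I)"]) (auto simp: agree2_iff[of p I] split: if_splits)
  done

lemma op2_mult_left:
  "ent (op2 p M * X) I J = (\<Sum>u\<in>UNIV. M $ (I p, I (Suc p)) $ u * ent X (upd2 p I u) J)"
proof -
  have "ent (op2 p M * X) I J = (\<Sum>K\<in>range (upd2 p I). ent (op2 p M) I K * ent X K J)"
    by (rule ent_mult_eq) (auto simp: op2.rep_eq agree2_iff[of p I])
  also have "\<dots> = (\<Sum>u\<in>UNIV. ent (op2 p M) I (upd2 p I u) * ent X (upd2 p I u) J)"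
    by (simp add: sum.reindex[OF inj_upd2])
  finally show ?thesis by (simp add: op2.rep_eq)
qed

lemma op2_mult_right:
  "ent (X * op2 p M) I J = (\<Sum>u\<in>UNIV. ent X I (upd2 p J u) * M $ u $ (J p, J (Suc p)))"
proof -
  have "ent (X * op2 p M) I J = (\<Sum>K\<in>range (upd2 p J). ent X I K * ent (op2 p M) K J)"
  proof (rule ent_mult_eq)
    fix K assume "K \<notin> range (upd2 p J)"
    then have "\<not> agree2 p K J" unfolding agree2_sym[of p K] agree2_iff[of p J] by blast
    then show "ent X I K = 0 \<or> ent (op2 p M) K J = 0" by (simp add: op2.rep_eq)
  qed simp
  also have "\<dots> = (\<Sum>u\<in>UNIV. ent X I (upd2 p J u) * ent (op2 p M) (upd2 p J u) J)"
    by (simp add: sum.reindex[OF inj_upd2])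
  finally show ?thesis by (simp add: op2.rep_eq)
qed

lemma op2_mult: "op2 p (M ** N) = op2 p M * op2 p (N :: ('n::finite, 'a::ring_1) matrix2)"
  by (rule rfm_eqI) (simp add: op2_mult_left, simp add: op2.rep_eq matrix_matrix_mult_def)

lemma op2_add: "op2 p (M + N) = op2 p M + op2 p (N :: ('n::finite, 'a::ring_1) matrix2)"
  by (rule rfm_eqI) (simp add: op2.rep_eq)

lemma op2_diff: "op2 p (M - N) = op2 p M - op2 p (N :: ('n::finite, 'a::ring_1) matrix2)"
  by (rule rfm_eqI) (simp add: op2.rep_eq)

lemma op2_one: "op2 p (mat 1) = (1 :: ('n::finite, 'a::ring_1) oper)"
  by (rule rfm_eqI) (auto simp: op2.rep_eq mat_def agree2_def fun_eq_iff)

lemma op2_first_copy: "op2 p (first_copy M) = op1 p (M :: ('n::finite, 'a::ring_1) matrix1)"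
  by (rule rfm_eqI) (auto simp: op2.rep_eq op1.rep_eq first_copy_def agree2_def)

subsection \<open>Operators that do not touch a position\<close>

text \<open>
  The matrix is the identity in the position \<open>p\<close>: both indices agree there, and the entry does not
  depend on their common value.
\<close>

definition indep :: "nat \<Rightarrow> ('n, 'a::ring_1) oper \<Rightarrow> bool" where
  "indep p X \<longleftrightarrow> (\<forall>I J. (I p \<noteq> J p \<longrightarrow> ent X I J = 0) \<and>
     (\<forall>a. I p = J p \<longrightarrow> ent X (I(p := a)) (J(p := a)) = ent X I J))"

lemma indep_zero: "indep p X \<Longrightarrow> I p \<noteq> J p \<Longrightarrow> ent X I J = 0"
  by (simp add: indep_def)

lemma indep_upd: "indep p X \<Longrightarrow> I p = J p \<Longrightarrow> ent X (I(p := a)) (J(p := a)) = ent X I J"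
  by (simp add: indep_def)

lemma indep_upd_left: "indep p X \<Longrightarrow> ent X (I(p := a)) J = (if J p = a then ent X I (J(p := I p)) else 0)"
  using indep_upd[of p X I "J(p := I p)" a] indep_zero[of p X "I(p := a)" J] by (auto simp: fun_upd_idem)

lemma indep_one: "indep p 1"
  unfolding indep_def by (auto simp: fun_eq_iff)

lemma indep_add: "indep p X \<Longrightarrow> indep p Y \<Longrightarrow> indep p (X + Y)"
  unfolding indep_def by simp

lemma mult_indep_left:
  fixes X Y :: "('n, 'a::ring_1) oper"
  assumes "indep p X"
  shows "ent (X * Y) (I(p := b)) J = (\<Sum>K | ent X I K \<noteq> 0. ent X I K * ent Y (K(p := b)) J)"
proof -
  let ?S = "{K. ent X I K \<noteq> 0}"
  have Ip: "K p = I p" if "K \<in> ?S" for K using that indep_zero[OF assms, of I K] by force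
  have inj: "inj_on (\<lambda>K. K(p := b)) ?S"
  proof (rule inj_onI)
    fix K K' assume K: "K \<in> ?S" "K' \<in> ?S" "K(p := b) = K'(p := b)"
    have "K p = K' p" using K(1,2)[THEN Ip] by simp
    then show "K = K'" using K(3) by (metis fun_upd_triv fun_upd_upd)
  qed
  have "ent (X * Y) (I(p := b)) J = (\<Sum>K\<in>(\<lambda>K. K(p := b)) ` ?S. ent X (I(p := b)) K * ent Y K J)"
  proof (rule ent_mult_eq)
    fix K assume K: "K \<notin> (\<lambda>K. K(p := b)) ` ?S"
    show "ent X (I(p := b)) K = 0 \<or> ent Y K J = 0"
    proof (rule ccontr)
      assume "\<not> ?thesis"
      then have "ent X (I(p := b)) K \<noteq> 0" by simp
      then have "K p = b" "ent X I (K(p := I p)) \<noteq> 0"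
        unfolding indep_upd_left[OF assms] by (auto split: if_splits)
      then have "K(p := I p) \<in> ?S" "K = (K(p := I p))(p := b)" by (auto simp: fun_upd_idem)
      then show False using K by blast
    qed
  qed simp
  also have "\<dots> = (\<Sum>K\<in>?S. ent X (I(p := b)) (K(p := b)) * ent Y (K(p := b)) J)"
    by (simp add: sum.reindex[OF inj])
  also have "\<dots> = (\<Sum>K\<in>?S. ent X I K * ent Y (K(p := b)) J)"
    using Ip by (intro sum.cong refl) (simp add: indep_upd[OF assms])
  finally show ?thesis .
qed

lemma indep_mult:
  fixes X Y :: "('n, 'a::ring_1) oper"
  assumes X: "indep p X" and Y: "indep p Y"
  shows "indep p (X * Y)"
  unfolding indep_def
proof (intro allI conjI impI)
  fix I J :: "nat \<Rightarrow> 'n"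
  assume "I p \<noteq> J p"
  then have "ent X I K = 0 \<or> ent Y K J = 0" for K
    using indep_zero[OF X, of I K] indep_zero[OF Y, of K J] by metis
  then show "ent (X * Y) I J = 0" by (simp add: ent_mult_eq[of "{}"])
next
  fix I J :: "nat \<Rightarrow> 'n" and a assume IJ: "I p = J p"
  have "ent (X * Y) (I(p := a)) (J(p := a)) = (\<Sum>K | ent X I K \<noteq> 0. ent X I K * ent Y (K(p := a)) (J(p := a)))"
    by (rule mult_indep_left[OF X])
  also have "\<dots> = (\<Sum>K | ent X I K \<noteq> 0. ent X I K * ent Y K J)"
  proof (intro sum.cong refl)
    fix K assume "K \<in> {K. ent X I K \<noteq> 0}"
    then have "K p = J p" using indep_zero[OF X, of I K] IJ by force
    then show "ent X I K * ent Y (K(p := a)) (J(p := a)) = ent X I K * ent Y K J"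
      by (simp add: indep_upd[OF Y])
  qed
  finally show "ent (X * Y) (I(p := a)) (J(p := a)) = ent (X * Y) I J"
    by (simp add: times_rfm.rep_eq)
qed

lemma indep_op2: "p \<noteq> s \<Longrightarrow> p \<noteq> Suc s \<Longrightarrow> indep p (op2 s M)"
  unfolding indep_def op2.rep_eq agree2_def by (auto split: if_splits)

lemma indep_op1: "p \<noteq> s \<Longrightarrow> indep p (op1 s M)"
  unfolding indep_def op1.rep_eq by (auto split: if_splits)

lemma indep_upd2:
  assumes "indep p X" "indep (Suc p) X"
  shows "ent X (upd2 p I u) J = (if u = (J p, J (Suc p)) then ent X I (upd2 p J (I p, I (Suc p))) else 0)"
proof (cases "u = (J p, J (Suc p))")
  case True
  then show ?thesis using assms
    by (simp add: upd2_def indep_upd_left[of p] indep_upd_left[of "Suc p"] fun_upd_twist)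
next
  case False
  then have "upd2 p I u p \<noteq> J p \<or> upd2 p I u (Suc p) \<noteq> J (Suc p)" by (auto simp: prod_eq_iff)
  then show ?thesis using False assms indep_zero by metis
qed

lemma indep_upd2_right:
  assumes "indep p X" "indep (Suc p) X"
  shows "ent X I (upd2 p J u) = (if u = (I p, I (Suc p)) then ent X I (upd2 p J (I p, I (Suc p))) else 0)"
proof (cases "u = (I p, I (Suc p))")
  case False
  then have "upd2 p J u p \<noteq> I p \<or> upd2 p J u (Suc p) \<noteq> I (Suc p)" by (auto simp: prod_eq_iff)
  then show ?thesis using False assms indep_zero by metis
qed simp

lemma op2_commute:
  fixes X :: "('n::finite, 'a::ring_1) oper"
  assumes "indep p X" "indep (Suc p) X" "\<And>u v x. M $ u $ v * x = x * M $ u $ v"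
  shows "op2 p M * X = X * op2 p M"
proof (rule rfm_eqI)
  fix I J :: "nat \<Rightarrow> 'n"
  show "ent (op2 p M * X) I J = ent (X * op2 p M) I J"
    unfolding op2_mult_left op2_mult_right indep_upd2[OF assms(1,2)]
    by (subst (2) indep_upd2_right[OF assms(1,2)])
       (simp add: if_distrib[of "\<lambda>x. x * _"] if_distrib[of "\<lambda>x. _ * x"] assms(3) cong: if_cong)
qed

text \<open>
  The scalars form the coefficient ring, so these matrices are not central in general.
\<close>

lift_definition dg :: "'a::zero \<Rightarrow> ('i, 'a) rfm" is "\<lambda>d i j. if i = j then d else 0" by simp

lemma dg_mult_left [simp]: "ent (dg d * X) i j = d * ent X i j"
  by (subst ent_mult_eq[of "{i}"]) (auto simp: dg.rep_eq)

lemma dg_mult_right [simp]: "ent (X * dg d) i j = ent X i j * d"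
  by (subst ent_mult_eq[of "{j}"]) (auto simp: dg.rep_eq)

lemma dg_add: "dg (c + d) = dg c + dg (d :: 'a::ring_1)"
  by (rule rfm_eqI) (simp add: dg.rep_eq)

lemma dg_diff: "dg (c - d) = dg c - dg (d :: 'a::ring_1)"
  by (rule rfm_eqI) (simp add: dg.rep_eq)

lemma dg_mult: "dg (c * d) = dg c * dg (d :: 'a::ring_1)"
  by (rule rfm_eqI) (simp add: dg.rep_eq)

lemma dg_one: "dg 1 = (1 :: ('i, 'a::ring_1) rfm)"
  by (rule rfm_eqI) (simp add: dg.rep_eq)

lemma dg_zero: "dg 0 = (0 :: ('i, 'a::ring_1) rfm)"
  by (rule rfm_eqI) (simp add: dg.rep_eq)

lemma indep_dg: "indep p (dg d :: ('n, 'a::ring_1) oper)"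
  unfolding indep_def dg.rep_eq by (auto simp: fun_eq_iff)

lemma indep_scale: "indep p X \<Longrightarrow> indep p (dg d * X)"
  by (rule indep_mult[OF indep_dg])

section \<open>Partial R-traces\<close>

text \<open>
  The result is again an operator on the infinite tensor power, acting as the identity in the position
  that has been traced over.
\<close>

lift_definition ptr :: "nat \<Rightarrow> ('n::finite, 'a::ring_1) matrix1 \<Rightarrow> ('n, 'a) oper \<Rightarrow> ('n, 'a) oper" is
  "\<lambda>p C X I J. if I p = J p then \<Sum>a\<in>UNIV. \<Sum>b\<in>UNIV. C $ a $ b * X (I(p := b)) (J(p := a)) else 0"
  subgoal premises fin for p C X I
  proof (rule finite_subset[of _ "\<Union>b. (\<lambda>K. K(p := I p)) ` {K. X (I(p := b)) K \<noteq> 0}"], rule subsetI)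
    fix J
    assume "J \<in> {J. (if I p = J p then \<Sum>a\<in>UNIV. \<Sum>b\<in>UNIV. C $ a $ b * X (I(p := b)) (J(p := a)) else 0) \<noteq> 0}"
    then have J: "J p = I p" "(\<Sum>a\<in>UNIV. \<Sum>b\<in>UNIV. C $ a $ b * X (I(p := b)) (J(p := a))) \<noteq> 0"
      by (auto split: if_splits)
    then obtain a where "(\<Sum>b\<in>UNIV. C $ a $ b * X (I(p := b)) (J(p := a))) \<noteq> 0"
      by (meson sum.neutral)
    then obtain b where "C $ a $ b * X (I(p := b)) (J(p := a)) \<noteq> 0"
      by (meson sum.neutral)
    then have "X (I(p := b)) (J(p := a)) \<noteq> 0" by auto
    moreover have "J = (J(p := a))(p := I p)" using J(1) by (simp add: fun_upd_idem)
    ultimately show "J \<in> (\<Union>b. (\<lambda>K. K(p := I p)) ` {K. X (I(p := b)) K \<noteq> 0})" by blast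
  next
    show "finite (\<Union>b. (\<lambda>K. K(p := I p)) ` {K. X (I(p := b)) K \<noteq> 0})" using fin by simp
  qed
  done

lemma ptr_add: "ptr p C (X + Y) = ptr p C X + ptr p C Y"
  by (rule rfm_eqI) (simp add: ptr.rep_eq distrib_left sum.distrib)

lemma ptr_one: "ptr p C 1 = dg (\<Sum>a\<in>UNIV. C $ a $ a)"
proof (rule rfm_eqI)
  fix I J :: "nat \<Rightarrow> 'a"
  have "I p = J p \<Longrightarrow> (I(p := b) = J(p := a)) = (b = a \<and> I = J)" for a b
    by (auto simp: fun_eq_iff)
  then show "ent (ptr p C 1) I J = ent (dg (\<Sum>a\<in>UNIV. C $ a $ a)) I J"
    by (auto simp: ptr.rep_eq dg.rep_eq if_distrib[of "\<lambda>x. _ * x"] cong: if_cong)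
qed

lemma indep_ptr_same: "indep p (ptr p C X)"
  unfolding indep_def ptr.rep_eq by simp

lemma indep_ptr: "indep r X \<Longrightarrow> indep r (ptr p C X)"
proof (cases "r = p")
  case False
  assume X: "indep r X"
  show ?thesis
    unfolding indep_def
  proof (intro allI conjI impI)
    fix I J :: "nat \<Rightarrow> 'a"
    assume "I r \<noteq> J r"
    then have "ent X (I(p := b)) (J(p := a)) = 0" for a b using False by (intro indep_zero[OF X]) simp
    then show "ent (ptr p C X) I J = 0" by (simp add: ptr.rep_eq)
  next
    fix I J :: "nat \<Rightarrow> 'a" and c
    assume "I r = J r"
    then have "ent X (I(p := b, r := c)) (J(p := a, r := c)) = ent X (I(p := b)) (J(p := a))" for a b
      using False by (intro indep_upd[OF X]) simp
    then show "ent (ptr p C X) (I(r := c)) (J(r := c)) = ent (ptr p C X) I J"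
      using False by (simp add: ptr.rep_eq fun_upd_twist)
  qed
qed (simp add: indep_ptr_same)

lemma sum_pairs:
  fixes f :: "'n::finite \<times> 'n \<Rightarrow> 'a::comm_monoid_add"
  shows "(\<Sum>u\<in>UNIV. f u) = (\<Sum>c\<in>UNIV. \<Sum>d\<in>UNIV. f (c, d))"
  by (simp add: sum.cartesian_product UNIV_Times_UNIV[symmetric] del: UNIV_Times_UNIV)

context
  fixes C :: "('n::finite, 'a::ring_1) matrix1"
  assumes central: "\<And>a b x. C $ a $ b * x = x * C $ a $ b"
begin

lemma central_left: "x * (C $ a $ b * y) = C $ a $ b * (x * y)"
  by (metis central mult.assoc)

lemma ptr_left:
  assumes X: "indep p X"
  shows "ptr p C (X * Y) = X * ptr p C Y"
proof (rule rfm_eqI)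
  fix I J :: "nat \<Rightarrow> 'n"
  let ?S = "{K. ent X I K \<noteq> 0}"
  have XE: "ent (X * ptr p C Y) I J = (\<Sum>K\<in>?S. ent X I K * ent (ptr p C Y) K J)"
    by (simp add: times_rfm.rep_eq)
  have Kp: "K p = I p" if "K \<in> ?S" for K using that indep_zero[OF X, of I K] by force
  show "ent (ptr p C (X * Y)) I J = ent (X * ptr p C Y) I J"
  proof (cases "I p = J p")
    case False
    then have "ent X I K * ent (ptr p C Y) K J = 0" if "K \<in> ?S" for K
      using Kp[OF that] by (simp add: ptr.rep_eq)
    then show ?thesis unfolding XE using False by (simp add: ptr.rep_eq sum.neutral)
  next
    case True
    have "ent (ptr p C (X * Y)) I J
        = (\<Sum>a\<in>UNIV. \<Sum>b\<in>UNIV. \<Sum>K\<in>?S. ent X I K * (C $ a $ b * ent Y (K(p := b)) (J(p := a))))"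
      using True by (simp add: ptr.rep_eq mult_indep_left[OF X] sum_distrib_left central_left)
    also have "\<dots> = (\<Sum>K\<in>?S. \<Sum>a\<in>UNIV. \<Sum>b\<in>UNIV. ent X I K * (C $ a $ b * ent Y (K(p := b)) (J(p := a))))"
      by (simp add: sum.swap[of _ ?S])
    also have "\<dots> = ent (X * ptr p C Y) I J"
      unfolding XE using True Kp by (intro sum.cong refl) (simp add: ptr.rep_eq sum_distrib_left)
    finally show ?thesis .
  qed
qed

lemma ptr_right:
  assumes X: "indep p X"
  shows "ptr p C (Y * X) = ptr p C Y * X"
proof (rule rfm_eqI)
  fix I J :: "nat \<Rightarrow> 'n"
  let ?S = "\<Union>b. (\<lambda>K. K(p := I p)) ` {K. ent Y (I(p := b)) K \<noteq> 0}"
  have fin: "finite ?S" by simp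
  have Kp: "K p = I p" if "K \<in> ?S" for K using that by auto
  have S: "K \<in> ?S" if "ent Y (I(p := b)) (K(p := a)) \<noteq> 0" "K p = I p" for K a b
  proof -
    have "K = (K(p := a))(p := I p)" using that by (simp add: fun_upd_idem)
    then show ?thesis using that by blast
  qed
  have EX: "ent (ptr p C Y * X) I J = (\<Sum>K\<in>?S. ent (ptr p C Y) I K * ent X K J)"
  proof (rule ent_mult_eq[OF fin])
    fix K assume "K \<notin> ?S"
    then have "\<forall>a b. K p = I p \<longrightarrow> ent Y (I(p := b)) (K(p := a)) = 0" using S by blast
    then show "ent (ptr p C Y) I K = 0 \<or> ent X K J = 0"
      by (simp add: ptr.rep_eq)
  qed
  show "ent (ptr p C (Y * X)) I J = ent (ptr p C Y * X) I J"
  proof (cases "I p = J p")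
    case False
    then have "ent (ptr p C Y) I K * ent X K J = 0" if "K \<in> ?S" for K
      using Kp[OF that] indep_zero[OF X, of K J] by simp
    then have "ent (ptr p C Y * X) I J = 0"
      unfolding EX by (intro sum.neutral ballI)
    then show ?thesis using False by (simp add: ptr.rep_eq)
  next
    case True
    have YX: "ent (Y * X) (I(p := b)) (J(p := a)) = (\<Sum>K\<in>?S. ent Y (I(p := b)) (K(p := a)) * ent X K J)" for a b
    proof -
      have inj: "inj_on (\<lambda>K. K(p := a)) ?S"
      proof (rule inj_onI)
        fix K K' assume K: "K \<in> ?S" "K' \<in> ?S" "K(p := a) = K'(p := a)"
        have "K = (K(p := a))(p := I p)" using Kp[OF K(1)] by (simp add: fun_upd_idem)
        also have "\<dots> = (K'(p := a))(p := I p)" by (simp only: K(3))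
        also have "\<dots> = K'" using Kp[OF K(2)] by (simp add: fun_upd_idem)
        finally show "K = K'" .
      qed
      have "ent (Y * X) (I(p := b)) (J(p := a))
          = (\<Sum>K\<in>(\<lambda>K. K(p := a)) ` ?S. ent Y (I(p := b)) K * ent X K (J(p := a)))"
      proof (rule ent_mult_eq)
        fix K assume K: "K \<notin> (\<lambda>K. K(p := a)) ` ?S"
        show "ent Y (I(p := b)) K = 0 \<or> ent X K (J(p := a)) = 0"
        proof (rule ccontr)
          assume *: "\<not> ?thesis"
          then have "K p = a" using indep_zero[OF X, of K "J(p := a)"] by auto
          then have "K = (K(p := I p))(p := a)" by (simp add: fun_upd_idem)
          moreover have "K(p := I p) \<in> ?S"
            by (rule S[of b _ a]) (use * \<open>K p = a\<close> in \<open>auto simp: fun_upd_idem\<close>)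
          ultimately show False using K by blast
        qed
      qed (use fin in blast)
      also have "\<dots> = (\<Sum>K\<in>?S. ent Y (I(p := b)) (K(p := a)) * ent X (K(p := a)) (J(p := a)))"
        by (simp only: sum.reindex[OF inj] o_def)
      also have "\<dots> = (\<Sum>K\<in>?S. ent Y (I(p := b)) (K(p := a)) * ent X K J)"
      proof (rule sum.cong[OF refl])
        fix K assume "K \<in> ?S"
        then have "K p = J p" using Kp True by metis
        then show "ent Y (I(p := b)) (K(p := a)) * ent X (K(p := a)) (J(p := a))
          = ent Y (I(p := b)) (K(p := a)) * ent X K J"
          by (simp only: indep_upd[OF X])
      qed
      finally show ?thesis .
    qed
    have "ent (ptr p C (Y * X)) I J
        = (\<Sum>a\<in>UNIV. \<Sum>b\<in>UNIV. \<Sum>K\<in>?S. C $ a $ b * ent Y (I(p := b)) (K(p := a)) * ent X K J)"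
      unfolding ptr.rep_eq if_P[OF True] YX by (simp only: sum_distrib_left mult.assoc)
    also have "\<dots> = (\<Sum>K\<in>?S. \<Sum>a\<in>UNIV. \<Sum>b\<in>UNIV. C $ a $ b * ent Y (I(p := b)) (K(p := a)) * ent X K J)"
      by (simp only: sum.swap[of _ ?S])
    also have "\<dots> = ent (ptr p C Y * X) I J"
      unfolding EX
    proof (rule sum.cong[OF refl])
      fix K assume "K \<in> ?S"
      then have "I p = K p" using Kp by metis
      then show "(\<Sum>a\<in>UNIV. \<Sum>b\<in>UNIV. C $ a $ b * ent Y (I(p := b)) (K(p := a)) * ent X K J)
          = ent (ptr p C Y) I K * ent X K J"
        by (simp add: ptr.rep_eq sum_distrib_right)
    qed
    finally show ?thesis .
  qed
qed

lemma ptr_op2: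
  assumes "\<And>i j. (\<Sum>a\<in>UNIV. \<Sum>b\<in>UNIV. C $ a $ b * M $ (i, b) $ (j, a)) = (if i = j then 1 else 0)"
  shows "ptr (Suc p) C (op2 p M) = 1"
proof (rule rfm_eqI)
  fix I J :: "nat \<Rightarrow> 'n"
  have "agree2 p (I(Suc p := b)) (J(Suc p := a)) = agree2 p I J" for a b
    by (simp add: agree2_def)
  moreover have "I = J \<longleftrightarrow> I (Suc p) = J (Suc p) \<and> agree2 p I J \<and> I p = J p"
    by (auto simp: agree2_def fun_eq_iff)
  ultimately show "ent (ptr (Suc p) C (op2 p M)) I J = ent 1 I J"
    using assms by (cases "agree2 p I J") (simp_all add: ptr.rep_eq op2.rep_eq)
qed

text \<open>
  As \<open>X\<close> is the identity in the position \<open>p + 1\<close>, its entries factor out of the trace, and only a numerical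
  contraction of \<open>C\<close>, \<open>M\<close> and \<open>M'\<close> remains.
\<close>

lemma ptr_conj_entry:
  assumes X: "indep (Suc p) X"
    and central': "\<And>u v x. M $ u $ v * x = x * M $ u $ v"
  shows "ent (ptr (Suc p) C (op2 p M * X * op2 p M')) I J = (if I (Suc p) = J (Suc p) then
    \<Sum>d\<in>UNIV. \<Sum>c\<in>UNIV. ent X (I(p := c)) (J(p := d)) *
      (\<Sum>a\<in>UNIV. \<Sum>b\<in>UNIV. C $ a $ b * (\<Sum>h\<in>UNIV. M $ (I p, b) $ (c, h) * M' $ (d, h) $ (J p, a))) else 0)"
proof (cases "I (Suc p) = J (Suc p)")
  case False
  then show ?thesis by (simp add: ptr.rep_eq)
next
    case True
    let ?m = "\<lambda>a b c d. \<Sum>h\<in>UNIV. M $ (I p, b) $ (c, h) * M' $ (d, h) $ (J p, a)"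
    let ?x = "\<lambda>c d. ent X (I(p := c)) (J(p := d))"
    have x: "ent X (upd2 p I (c, h)) (upd2 p J (d, g)) = (if h = g then ?x c d else 0)" for c d g h
    proof (cases "h = g")
      case False
      then show ?thesis by (auto intro: indep_zero[OF X])
    next
      case True
      then show ?thesis
        unfolding upd2_def using indep_upd[OF X, of "I(p := c)" "J(p := d)" h] \<open>I (Suc p) = J (Suc p)\<close> by simp
    qed
    have u: "upd2 p (I(Suc p := b)) v = upd2 p I v" for I :: "nat \<Rightarrow> 'n" and b v
      by (auto simp: upd2_def)
    have "ent (op2 p M * X * op2 p M') (I(Suc p := b)) (J(Suc p := a))
        = (\<Sum>d\<in>UNIV. \<Sum>c\<in>UNIV. ?x c d * ?m a b c d)" for a b
    proof -
      have "ent (op2 p M * X * op2 p M') (I(Suc p := b)) (J(Suc p := a))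
        = (\<Sum>d\<in>UNIV. \<Sum>g\<in>UNIV. \<Sum>c\<in>UNIV. \<Sum>h\<in>UNIV.
            M $ (I p, b) $ (c, h) * (if h = g then ?x c d else 0) * M' $ (d, g) $ (J p, a))"
        by (simp add: op2_mult_right op2_mult_left u sum_pairs x sum_distrib_right)
      also have "\<dots> = (\<Sum>d\<in>UNIV. \<Sum>c\<in>UNIV. \<Sum>h\<in>UNIV. M $ (I p, b) $ (c, h) * ?x c d * M' $ (d, h) $ (J p, a))"
        by (subst (2) sum.swap, subst (3) sum.swap)
           (simp add: if_distrib[of "\<lambda>x. x * _"] if_distrib[of "\<lambda>x. _ * x"] cong: if_cong, rule sum.swap)
      finally show ?thesis by (simp add: sum_distrib_left central' mult.assoc)
    qed
    then have "ent (ptr (Suc p) C (op2 p M * X * op2 p M')) I J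
      = (\<Sum>a\<in>UNIV. \<Sum>b\<in>UNIV. C $ a $ b * (\<Sum>d\<in>UNIV. \<Sum>c\<in>UNIV. ?x c d * ?m a b c d))"
      using True by (simp add: ptr.rep_eq)
    also have "\<dots> = (\<Sum>a\<in>UNIV. \<Sum>b\<in>UNIV. \<Sum>d\<in>UNIV. \<Sum>c\<in>UNIV. ?x c d * (C $ a $ b * ?m a b c d))"
      by (simp only: sum_distrib_left central_left)
    also have "\<dots> = (\<Sum>d\<in>UNIV. \<Sum>c\<in>UNIV. \<Sum>a\<in>UNIV. \<Sum>b\<in>UNIV. ?x c d * (C $ a $ b * ?m a b c d))"
      (is "(\<Sum>a\<in>UNIV. \<Sum>b\<in>UNIV. \<Sum>d\<in>UNIV. \<Sum>c\<in>UNIV. ?f a b d c) = _")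
    proof -
      have "(\<Sum>a\<in>UNIV. \<Sum>b\<in>UNIV. \<Sum>d\<in>UNIV. \<Sum>c\<in>UNIV. ?f a b d c) = (\<Sum>(a, b)\<in>UNIV. \<Sum>(d, c)\<in>UNIV. ?f a b d c)"
        by (simp add: sum_pairs)
      also have "\<dots> = (\<Sum>(d, c)\<in>UNIV. \<Sum>(a, b)\<in>UNIV. ?f a b d c)"
        by (simp add: case_prod_unfold) (rule sum.swap)
      finally show ?thesis by (simp add: sum_pairs)
    qed
    finally show ?thesis by (simp only: sum_distrib_left[symmetric] if_P[OF True])
qed

lemma ptr_conj:
  assumes M: "\<And>c d i j. (\<Sum>a\<in>UNIV. \<Sum>b\<in>UNIV. C $ a $ b * (\<Sum>h\<in>UNIV. M $ (i, b) $ (c, h) * M' $ (d, h) $ (j, a)))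
      = (if i = j then C $ d $ c else 0)"
    and X: "indep (Suc p) X"
    and central': "\<And>u v x. M $ u $ v * x = x * M $ u $ v"
  shows "ptr (Suc p) C (op2 p M * X * op2 p M') = ptr p C X"
proof (rule rfm_eqI)
  fix I J :: "nat \<Rightarrow> 'n"
  show "ent (ptr (Suc p) C (op2 p M * X * op2 p M')) I J = ent (ptr p C X) I J"
  proof (cases "I (Suc p) = J (Suc p)")
    case False
    then have "ent X (I(p := b)) (J(p := a)) = 0" for a b by (intro indep_zero[OF X]) simp
    then show ?thesis using False by (simp add: ptr.rep_eq)
  next
    case True
    show ?thesis
      unfolding ptr_conj_entry[OF X central'] if_P[OF True] M by (simp add: ptr.rep_eq central)
  qed
qed

lemma ptr_ptr:
  "ent (ptr p C (ptr (Suc p) C X)) I J = (if I p = J p \<and> I (Suc p) = J (Suc p) then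
     \<Sum>u\<in>UNIV. \<Sum>v\<in>UNIV. C $ fst u $ fst v * C $ snd u $ snd v * ent X (upd2 p I v) (upd2 p J u) else 0)"
proof -
  have "(\<Sum>a\<in>UNIV. \<Sum>b\<in>UNIV. C $ a $ b * (\<Sum>a'\<in>UNIV. \<Sum>b'\<in>UNIV. C $ a' $ b' * ent X (I(p := b, Suc p := b')) (J(p := a, Suc p := a'))))
     = (\<Sum>a\<in>UNIV. \<Sum>a'\<in>UNIV. \<Sum>b\<in>UNIV. \<Sum>b'\<in>UNIV. C $ a $ b * C $ a' $ b' * ent X (I(p := b, Suc p := b')) (J(p := a, Suc p := a')))"
    by (simp only: sum_distrib_left mult.assoc) (intro sum.cong refl sum.swap)
  then show ?thesis by (simp add: ptr.rep_eq sum_pairs upd2_def)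
qed

lemma ptr_cyclic:
  fixes M :: "('n, 'a) matrix2"
  assumes M: "\<And>u v. (\<Sum>w\<in>UNIV. C $ fst u $ fst w * C $ snd u $ snd w * M $ w $ v)
      = (\<Sum>w\<in>UNIV. M $ u $ w * (C $ fst w $ fst v * C $ snd w $ snd v))"
    and central': "\<And>u v x. M $ u $ v * x = x * M $ u $ v"
  shows "ptr p C (ptr (Suc p) C (op2 p M * X)) = ptr p C (ptr (Suc p) C (X * op2 p M))"
proof (rule rfm_eqI)
  fix I J :: "nat \<Rightarrow> 'n"
  let ?C = "\<lambda>u v. C $ fst u $ fst v * C $ snd u $ snd v"
  let ?x = "\<lambda>v u. ent X (upd2 p I v) (upd2 p J u)"
  have uu: "upd2 p (upd2 p I v) w = upd2 p I w" for I :: "nat \<Rightarrow> 'n" and v w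
    by (auto simp: upd2_def fun_eq_iff)
  have "(\<Sum>u\<in>UNIV. \<Sum>v\<in>UNIV. ?C u v * ent (op2 p M * X) (upd2 p I v) (upd2 p J u))
      = (\<Sum>u\<in>UNIV. \<Sum>v\<in>UNIV. \<Sum>w\<in>UNIV. ?C u v * M $ v $ w * ?x w u)"
    by (simp add: op2_mult_left uu sum_distrib_left mult.assoc)
  also have "\<dots> = (\<Sum>u\<in>UNIV. \<Sum>w\<in>UNIV. (\<Sum>v\<in>UNIV. ?C u v * M $ v $ w) * ?x w u)"
    by (simp only: sum_distrib_right) (intro sum.cong refl sum.swap)
  also have "\<dots> = (\<Sum>u\<in>UNIV. \<Sum>w\<in>UNIV. (\<Sum>v\<in>UNIV. M $ u $ v * ?C v w) * ?x w u)"
    by (simp only: M)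
  also have "\<dots> = (\<Sum>u\<in>UNIV. \<Sum>v\<in>UNIV. \<Sum>w\<in>UNIV. ?C v w * ?x w u * M $ u $ v)"
    by (simp only: sum_distrib_right central' mult.assoc) (intro sum.cong refl sum.swap)
  also have "\<dots> = (\<Sum>v\<in>UNIV. \<Sum>w\<in>UNIV. \<Sum>u\<in>UNIV. ?C v w * ?x w u * M $ u $ v)"
    by (subst sum.swap) (intro sum.cong refl sum.swap)
  also have "\<dots> = (\<Sum>u\<in>UNIV. \<Sum>v\<in>UNIV. ?C u v * ent (X * op2 p M) (upd2 p I v) (upd2 p J u))"
    by (simp add: op2_mult_right uu sum_distrib_left mult.assoc)
  finally show "ent (ptr p C (ptr (Suc p) C (op2 p M * X))) I J = ent (ptr p C (ptr (Suc p) C (X * op2 p M))) I J"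
    by (simp add: ptr_ptr)
qed

end

section \<open>Operators on finite tensor powers\<close>

text \<open>
  The entries of \<open>I\<close> in the positions \<open>a + 1, \<dots>, a + n\<close>. The offset \<open>a\<close> serves to place the braid
  relation, which is given on the third tensor power, at any position.
\<close>

definition window :: "nat \<Rightarrow> nat \<Rightarrow> (nat \<Rightarrow> 'n) \<Rightarrow> 'n list" where
  "window a n I = map I [Suc a..<Suc (a + n)]"

definition agree_off :: "nat \<Rightarrow> nat \<Rightarrow> (nat \<Rightarrow> 'n) \<Rightarrow> (nat \<Rightarrow> 'n) \<Rightarrow> bool" where
  "agree_off a n I J \<longleftrightarrow> (\<forall>r. \<not> (a < r \<and> r \<le> a + n) \<longrightarrow> I r = J r)"

definition ins :: "nat \<Rightarrow> nat \<Rightarrow> (nat \<Rightarrow> 'n) \<Rightarrow> 'n list \<Rightarrow> nat \<Rightarrow> 'n" where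
  "ins a n I xs = (\<lambda>r. if a < r \<and> r \<le> a + n then xs ! (r - Suc a) else I r)"

lemma length_window [simp]: "length (window a n I) = n"
  by (simp add: window_def)

lemma nth_window [simp]: "r < n \<Longrightarrow> window a n I ! r = I (Suc (a + r))"
  by (simp add: window_def del: upt_Suc)

lemma window_ins: "length xs = n \<Longrightarrow> window a n (ins a n I xs) = xs"
  by (rule nth_equalityI) (simp_all add: ins_def)

lemma agree_off_ins: "agree_off a n I (ins a n I xs)" "agree_off a n (ins a n I xs) I"
  by (auto simp: agree_off_def ins_def)

lemma ins_window: "agree_off a n I J \<Longrightarrow> ins a n I (window a n J) = J"
proof
  fix r assume "agree_off a n I J"
  then show "ins a n I (window a n J) r = J r"
    by (cases "a < r \<and> r \<le> a + n") (auto simp: ins_def agree_off_def)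
qed

lemma agree_off_sym: "agree_off a n I J \<Longrightarrow> agree_off a n J I"
  by (auto simp: agree_off_def)

lemma agree_off_trans: "agree_off a n I J \<Longrightarrow> agree_off a n J K \<Longrightarrow> agree_off a n I K"
  by (auto simp: agree_off_def)

lemma window_eq_iff: "agree_off a n I J \<Longrightarrow> window a n I = window a n J \<longleftrightarrow> I = J"
  by (metis ins_window agree_off_sym agree_off_trans)

lemma finite_lists [simp]: "finite {xs :: 'n::finite list. length xs = n}"
  using finite_lists_length_eq[of "UNIV :: 'n set" n] by simp

lift_definition emb :: "nat \<Rightarrow> nat \<Rightarrow> ('n::finite, 'a::zero) tensor_op \<Rightarrow> ('n, 'a) oper" is
  "\<lambda>a n A I J. if agree_off a n I J then A (window a n I) (window a n J) else 0"
  subgoal for a n A I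
  proof (rule finite_subset[of _ "ins a n I ` {xs. length xs = n}"], rule subsetI)
    fix J assume "J \<in> {J. (if agree_off a n I J then A (window a n I) (window a n J) else 0) \<noteq> 0}"
    then have "J = ins a n I (window a n J)" by (simp add: ins_window split: if_splits)
    then show "J \<in> ins a n I ` {xs. length xs = n}" by (rule image_eqI) simp
  qed simp
  done

lemma sum_agree_off:
  fixes I :: "nat \<Rightarrow> 'n::finite"
  shows "finite {K. agree_off a n I K}" "(\<Sum>K | agree_off a n I K. f K) = (\<Sum>xs | length xs = n. f (ins a n I xs))"
proof -
  have eq: "{K. agree_off a n I K} = ins a n I ` {xs. length xs = n}"
  proof (intro equalityI subsetI)
    fix K assume "K \<in> {K. agree_off a n I K}"
    then have "K = ins a n I (window a n K)" by (simp add: ins_window)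
    then show "K \<in> ins a n I ` {xs. length xs = n}" by (rule image_eqI) simp
  qed (auto simp: agree_off_ins)
  have "inj_on (ins a n I) {xs. length xs = n}"
    by (rule inj_on_inverseI[of _ "window a n"]) (simp add: window_ins)
  then show "(\<Sum>K | agree_off a n I K. f K) = (\<Sum>xs | length xs = n. f (ins a n I xs))"
    by (simp add: eq sum.reindex)
  show "finite {K. agree_off a n I K}" unfolding eq by simp
qed

lemma emb_cong: "(\<And>I J. length I = n \<Longrightarrow> length J = n \<Longrightarrow> A I J = B I J) \<Longrightarrow> emb a n A = emb a n B"
  by (rule rfm_eqI) (simp add: emb.rep_eq)

lemma emb_mult: "emb a n (tmul n A B) = emb a n A * emb a n (B :: ('n::finite, 'a::ring_1) tensor_op)"
proof (rule rfm_eqI)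
  fix I J :: "nat \<Rightarrow> 'n"
  have fin: "finite {K. agree_off a n I K}" by (rule sum_agree_off)
  have ag: "agree_off a n (ins a n I xs) J \<longleftrightarrow> agree_off a n I J" for xs
    by (metis agree_off_ins agree_off_trans)
  have "ent (emb a n A * emb a n B) I J
      = (\<Sum>K | agree_off a n I K. ent (emb a n A) I K * ent (emb a n B) K J)"
    by (rule ent_mult_eq[OF fin]) (simp add: emb.rep_eq)
  also have "\<dots> = (\<Sum>xs | length xs = n. ent (emb a n A) I (ins a n I xs) * ent (emb a n B) (ins a n I xs) J)"
    by (rule sum_agree_off)
  also have "\<dots> = ent (emb a n (tmul n A B)) I J"
    by (auto simp: emb.rep_eq tmul_def agree_off_ins ag window_ins intro!: sum.cong)
  finally show "ent (emb a n (tmul n A B)) I J = ent (emb a n A * emb a n B) I J" by simp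
qed

lemma emb_tone: "emb a n tone = (1 :: ('n::finite, 'a::ring_1) oper)"
proof (rule rfm_eqI)
  fix I J :: "nat \<Rightarrow> 'n"
  have "agree_off a n I I" by (simp add: agree_off_def)
  then show "ent (emb a n tone) I J = ent (1 :: ('n, 'a) oper) I J"
    by (auto simp: emb.rep_eq tone_def window_eq_iff)
qed

lemma emb_tprod: "emb a n (tprod n As) = prod_list (map (emb a n) (As :: ('n::finite, 'a::ring_1) tensor_op list))"
  by (induction As) (simp_all add: tprod_def emb_tone emb_mult)

lemma emb_diff: "emb a n (\<lambda>I J. A I J - B I J) = emb a n A - emb a n (B :: ('n::finite, 'a::ring_1) tensor_op)"
  by (rule rfm_eqI) (simp add: emb.rep_eq)

lemma emb_scale: "emb a n (\<lambda>I J. c * A I J) = dg c * emb a n (A :: ('n::finite, 'a::ring_1) tensor_op)"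
  by (rule rfm_eqI) (simp add: emb.rep_eq)

lemma emb_at1:
  assumes "1 \<le> p" "p \<le> n"
  shows "emb a n (at1 p M) = op1 (a + p) (M :: ('n::finite, 'a::ring_1) matrix1)"
proof (rule rfm_eqI)
  fix I J :: "nat \<Rightarrow> 'n"
  have "(agree_off a n I J \<and> (\<forall>r<n. Suc r \<noteq> p \<longrightarrow> I (Suc (a + r)) = J (Suc (a + r))))
      \<longleftrightarrow> (\<forall>r. r \<noteq> a + p \<longrightarrow> I r = J r)" (is "?l = ?r")
  proof
    assume l: ?l
    show ?r
    proof (intro allI impI)
      fix r assume r: "r \<noteq> a + p"
      show "I r = J r"
      proof (cases "a < r \<and> r \<le> a + n")
        case True
        then have "r = Suc (a + (r - Suc a))" "r - Suc a < n" "Suc (r - Suc a) \<noteq> p" using r by auto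
        then show ?thesis using l by metis
      qed (use l in \<open>auto simp: agree_off_def\<close>)
    qed
  qed (use assms in \<open>auto simp: agree_off_def\<close>)
  then show "ent (emb a n (at1 p M)) I J = ent (op1 (a + p) M) I J"
    using assms by (auto simp: emb.rep_eq op1.rep_eq at1_def)
qed

lemma emb_at2:
  assumes "1 \<le> p" "p < n"
  shows "emb a n (at2 p M) = op2 (a + p) (M :: ('n::finite, 'a::ring_1) matrix2)"
proof (rule rfm_eqI)
  fix I J :: "nat \<Rightarrow> 'n"
  have "(agree_off a n I J \<and> (\<forall>r<n. Suc r \<noteq> p \<and> Suc r \<noteq> Suc p \<longrightarrow> I (Suc (a + r)) = J (Suc (a + r))))
      \<longleftrightarrow> agree2 (a + p) I J" (is "?l = ?r")
  proof
    assume l: ?l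
    show ?r
      unfolding agree2_def
    proof (intro allI impI)
      fix r assume r: "r \<noteq> a + p \<and> r \<noteq> Suc (a + p)"
      show "I r = J r"
      proof (cases "a < r \<and> r \<le> a + n")
        case True
        then have "r = Suc (a + (r - Suc a))" "r - Suc a < n" "Suc (r - Suc a) \<noteq> p" "Suc (r - Suc a) \<noteq> Suc p"
          using r by auto
        then show ?thesis using l by metis
      qed (use l in \<open>auto simp: agree_off_def\<close>)
    qed
  qed (use assms in \<open>auto simp: agree_off_def agree2_def\<close>)
  then show "ent (emb a n (at2 p M)) I J = ent (op2 (a + p) M) I J"
    using assms by (auto simp: emb.rep_eq op2.rep_eq at2_def)
qed

section \<open>Central coefficients\<close>

text \<open>
  The embedding of the ground field into a ring of matrix entries. It is used for the field itself, for
  the free algebra on the matrix entries and for the polynomials over the latter.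
\<close>

locale coefficients =
  fixes \<iota> :: "'k::field \<Rightarrow> 'a::ring_1"
  assumes \<iota>_add: "\<iota> (c + d) = \<iota> c + \<iota> d"
    and \<iota>_mult: "\<iota> (c * d) = \<iota> c * \<iota> d"
    and \<iota>_one: "\<iota> 1 = 1"
    and \<iota>_central: "\<iota> c * x = x * \<iota> c"
begin

lemma \<iota>_zero: "\<iota> 0 = 0"
  using \<iota>_add[of 0 0] by simp

lemma \<iota>_minus: "\<iota> (- c) = - \<iota> c"
  using \<iota>_add[of c "- c"] by (simp add: \<iota>_zero eq_neg_iff_add_eq_0 add.commute)

lemma \<iota>_diff: "\<iota> (c - d) = \<iota> c - \<iota> d"
  using \<iota>_add[of c "- d"] by (simp add: \<iota>_minus)

lemma \<iota>_sum: "\<iota> (sum f S) = (\<Sum>x\<in>S. \<iota> (f x))"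
  by (induction S rule: infinite_finite_induct) (simp_all add: \<iota>_zero \<iota>_add)

definition scl :: "'k \<Rightarrow> ('i, 'a) rfm \<Rightarrow> ('i, 'a) rfm" where
  "scl c X = dg (\<iota> c) * X"

lemma ent_scl [simp]: "ent (scl c X) i j = \<iota> c * ent X i j"
  by (simp add: scl_def)

lemma \<iota>_left: "x * (\<iota> c * y) = \<iota> c * (x * y)"
  by (metis \<iota>_central mult.assoc)

lemma scl_right: "X * scl c Y = scl c (X * Y)"
  by (rule rfm_eqI) (simp add: times_rfm.rep_eq \<iota>_left sum_distrib_left)

lemma scaled_ring_scl: "scaled_ring (scl :: 'k \<Rightarrow> ('i, 'a) rfm \<Rightarrow> ('i, 'a) rfm)"
proof
  fix c d and X Y :: "('i, 'a) rfm"
  show "scl c (X + Y) = scl c X + scl c Y" "scl (c + d) X = scl c X + scl d X"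
    "scl c (scl d X) = scl (c * d) X" "scl 1 X = X" "scl c X * Y = scl c (X * Y)"
    by (simp_all add: scl_def \<iota>_add \<iota>_mult \<iota>_one dg_add dg_mult dg_one distrib_left distrib_right mult.assoc)
  show "X * scl c Y = scl c (X * Y)" by (rule scl_right)
qed

lemma tlift_tmul: "tlift \<iota> (tmul n A B) = tmul n (tlift \<iota> A) (tlift \<iota> B)"
  by (auto simp: tlift_def tmul_def fun_eq_iff \<iota>_sum \<iota>_mult)

lemma tlift_tone: "tlift \<iota> tone = tone"
  by (auto simp: tlift_def tone_def fun_eq_iff \<iota>_one \<iota>_zero)

lemma tlift_tprod: "tlift \<iota> (tprod n As) = tprod n (map (tlift \<iota>) As)"
  by (induction As) (simp_all add: tprod_def tlift_tone tlift_tmul)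

lemma tlift_at2: "tlift \<iota> (at2 p M) = at2 p (map_matrix \<iota> M)"
  by (auto simp: tlift_def at2_def fun_eq_iff \<iota>_zero)

lemma map_matrix_mult: "map_matrix \<iota> (M ** N) = map_matrix \<iota> M ** map_matrix \<iota> N"
  by (simp add: vec_eq_iff matrix_matrix_mult_def \<iota>_sum \<iota>_mult)

lemma braid_op2:
  assumes "braiding R" "1 \<le> i"
  shows "op2 i (map_matrix \<iota> R) * op2 (Suc i) (map_matrix \<iota> R) * op2 i (map_matrix \<iota> R)
    = op2 (Suc i) (map_matrix \<iota> R) * op2 i (map_matrix \<iota> R) * op2 (Suc i) (map_matrix \<iota> R)"
proof -
  let ?e = "\<lambda>As. emb (i - 1) 3 (tlift \<iota> (tprod 3 As))"
  have "?e [at2 1 R, at2 2 R, at2 1 R] = ?e [at2 2 R, at2 1 R, at2 2 R]"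
    using assms by (intro emb_cong) (simp add: braiding_def tlift_def)
  then show ?thesis
    using assms by (simp add: tlift_tprod emb_tprod tlift_at2 emb_at2 mult.assoc)
qed

end

section \<open>Skew-invertible Hecke symmetries\<close>

locale skew_invertible_hecke =
  fixes q :: "'k::field" and R \<Psi> :: "('n::finite, 'k) matrix2"
  assumes hecke_R: "hecke_symmetry q R" and generic_q: "generic q" and skew: "skew_inverse R \<Psi>"
begin

abbreviation "C \<equiv> Cmat \<Psi>"

text \<open>
  The inverse of \<open>R\<close>, by the Hecke relation.
\<close>

definition R' :: "('n, 'k) matrix2" where
  "R' = R - mat (q - inverse q)"

lemma R'_entry: "R' $ u $ v = R $ u $ v - (if u = v then q - inverse q else 0)"
  by (simp add: R'_def mat_def)

lemma R_quadratic: "op2 p R * op2 p R = 1 + dg (q - inverse q) * (op2 p R :: ('n, 'k) oper)"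
proof -
  let ?r = "op2 p R :: ('n, 'k) oper"
  have m: "op2 p (mat c) = (dg c :: ('n, 'k) oper)" for c
    by (rule rfm_eqI) (auto simp: op2.rep_eq dg.rep_eq mat_def agree2_def fun_eq_iff)
  have comm: "X * dg c = dg c * X" for c and X :: "('n, 'k) oper"
    by (rule rfm_eqI) (simp add: mult.commute)
  have "op2 p ((mat q - R) ** (mat (inverse q) + R)) = op2 p (0 :: ('n, 'k) matrix2)"
    using hecke_R by (simp add: hecke_symmetry_def)
  also have "op2 p (0 :: ('n, 'k) matrix2) = 0"
    by (rule rfm_eqI) (simp add: op2.rep_eq)
  finally have "(dg q - ?r) * (dg (inverse q) + ?r) = 0"
    by (simp add: op2_mult op2_add op2_diff m)
  moreover have "dg q * dg (inverse q) = (1 :: ('n, 'k) oper)"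
    using generic_q by (simp add: dg_mult[symmetric] dg_one)
  moreover have "(dg q - ?r) * (dg (inverse q) + ?r)
      = dg q * dg (inverse q) + dg q * ?r - ?r * dg (inverse q) - ?r * ?r"
    by (simp add: left_diff_distrib distrib_left)
  ultimately have "?r * ?r = 1 + dg q * ?r - dg (inverse q) * ?r"
    using comm[of ?r] by simp
  then show ?thesis by (simp add: dg_diff left_diff_distrib)
qed

lemma op2_R': "op2 p R' = op2 p R - dg (q - inverse q)"
  by (rule rfm_eqI) (auto simp: op2.rep_eq dg.rep_eq R'_entry agree2_def fun_eq_iff)

lemma op2_R_R': "op2 p R * op2 p R' = 1" "op2 p R' * op2 p R = 1"
proof -
  have "X * dg c = dg c * X" for c and X :: "('n, 'k) oper"
    by (rule rfm_eqI) (simp add: mult.commute)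
  then show "op2 p R * op2 p R' = 1" "op2 p R' * op2 p R = 1"
    by (simp_all add: op2_R' right_diff_distrib left_diff_distrib R_quadratic)
qed

lemma op2_inject: "op2 p M = op2 p N \<Longrightarrow> M = (N :: ('n, 'b::ring_1) matrix2)"
proof -
  assume eq: "op2 p M = op2 p N"
  have "M $ u $ v = N $ u $ v" for u v
  proof -
    have "ent (op2 p M) (upd2 p (\<lambda>_. undefined) u) (upd2 p (\<lambda>_. undefined) v)
        = ent (op2 p N) (upd2 p (\<lambda>_. undefined) u) (upd2 p (\<lambda>_. undefined) v)"
      by (simp add: eq)
    then show ?thesis by (simp add: op2.rep_eq)
  qed
  then show ?thesis by (simp add: vec_eq_iff)
qed

lemma R_R': "R ** R' = mat 1" "R' ** R = mat 1"
  by (rule op2_inject[of 1], simp add: op2_mult op2_R_R' op2_one)+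

lemma matrix_inv_R: "matrix_inv R = R'"
proof -
  note RR = R_R'
  then have "R ** matrix_inv R = mat 1 \<and> matrix_inv R ** R = mat 1"
    using someI[of "\<lambda>A. R ** A = mat 1 \<and> A ** R = mat 1" R'] by (simp add: matrix_inv_def)
  then have "matrix_inv R = (R' ** R) ** matrix_inv R" using RR by simp
  also have "\<dots> = R' ** (R ** matrix_inv R)" by (rule matrix_mul_assoc[symmetric])
  finally show ?thesis using \<open>R ** matrix_inv R = mat 1 \<and> matrix_inv R ** R = mat 1\<close> by simp
qed

definition \<delta> :: 'k where
  "\<delta> = (\<Sum>a\<in>UNIV. C $ a $ a)"

lemma trace_R: "(\<Sum>a\<in>UNIV. \<Sum>b\<in>UNIV. C $ a $ b * R $ (i, b) $ (j, a)) = (if i = j then 1 else 0)"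
proof -
  have "(\<Sum>a\<in>UNIV. \<Sum>b\<in>UNIV. C $ a $ b * R $ (i, b) $ (j, a))
      = (\<Sum>a\<in>UNIV. \<Sum>b\<in>UNIV. \<Sum>k\<in>UNIV. R $ (i, b) $ (j, a) * \<Psi> $ (a, k) $ (b, k))"
    by (simp add: Cmat_def sum_distrib_left mult.commute)
  also have "\<dots> = (\<Sum>k\<in>UNIV. \<Sum>b\<in>UNIV. \<Sum>a\<in>UNIV. R $ (i, b) $ (j, a) * \<Psi> $ (a, k) $ (b, k))"
  proof -
    let ?t = "\<lambda>a b k. R $ (i, b) $ (j, a) * \<Psi> $ (a, k) $ (b, k)"
    have "(\<Sum>a\<in>UNIV. \<Sum>b\<in>UNIV. \<Sum>k\<in>UNIV. ?t a b k) = (\<Sum>a\<in>UNIV. \<Sum>k\<in>UNIV. \<Sum>b\<in>UNIV. ?t a b k)"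
      by (rule sum.cong[OF refl]) (rule sum.swap)
    also have "\<dots> = (\<Sum>k\<in>UNIV. \<Sum>a\<in>UNIV. \<Sum>b\<in>UNIV. ?t a b k)" by (rule sum.swap)
    also have "\<dots> = (\<Sum>k\<in>UNIV. \<Sum>b\<in>UNIV. \<Sum>a\<in>UNIV. ?t a b k)"
      by (rule sum.cong[OF refl]) (rule sum.swap)
    finally show ?thesis .
  qed
  also have "\<dots> = (\<Sum>k\<in>UNIV. if i = k \<and> k = j then 1 else 0)"
    using skew unfolding skew_inverse_def by simp
  also have "\<dots> = (\<Sum>k\<in>UNIV. if k = i then (if i = j then 1 else 0) else 0)"
    by (intro sum.cong) auto
  finally show ?thesis by simp
qed

text \<open>
  Skew-invertibility says that the matrix obtained from \<open>R\<close> by exchanging the second lower with the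
  first upper index has a right inverse. This matrix is square, hence invertible, and a family is
  determined by its contraction with it.
\<close>

lemma skew_cancel:
  assumes "\<And>x y. (\<Sum>d\<in>UNIV. \<Sum>c\<in>UNIV. R $ (x, c) $ (y, d) * f c d) = (\<Sum>d\<in>UNIV. \<Sum>c\<in>UNIV. R $ (x, c) $ (y, d) * g c d)"
  shows "f c d = g c d"
proof -
  define A :: "'k ^ ('n \<times> 'n) ^ ('n \<times> 'n)" where "A = (\<chi> u v. R $ (fst u, fst v) $ (snd u, snd v))"
  define B :: "'k ^ ('n \<times> 'n) ^ ('n \<times> 'n)" where "B = (\<chi> u v. \<Psi> $ (snd u, snd v) $ (fst u, fst v))"
  have "A ** B = mat 1"
    using skew unfolding skew_inverse_def
    by (auto simp: vec_eq_iff matrix_matrix_mult_def A_def B_def sum_pairs mat_def)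
  then have BA: "B ** A = mat 1" by (simp add: matrix_left_right_inverse)
  define v w :: "'k ^ ('n \<times> 'n)" where "v = (\<chi> u. f (fst u) (snd u))" and "w = (\<chi> u. g (fst u) (snd u))"
  have "A *v v = A *v w"
    unfolding vec_eq_iff matrix_vector_mult_def A_def v_def w_def
  proof (intro allI)
    fix u
    have "(\<Sum>c\<in>UNIV. \<Sum>d\<in>UNIV. R $ (fst u, c) $ (snd u, d) * f c d)
        = (\<Sum>d\<in>UNIV. \<Sum>c\<in>UNIV. R $ (fst u, c) $ (snd u, d) * f c d)"
      by (rule sum.swap)
    also have "\<dots> = (\<Sum>d\<in>UNIV. \<Sum>c\<in>UNIV. R $ (fst u, c) $ (snd u, d) * g c d)" by (rule assms)
    also have "\<dots> = (\<Sum>c\<in>UNIV. \<Sum>d\<in>UNIV. R $ (fst u, c) $ (snd u, d) * g c d)" by (rule sum.swap)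
    finally show "(\<chi> i. \<Sum>j\<in>UNIV. (\<chi> u v. R $ (fst u, fst v) $ (snd u, snd v)) $ i $ j * (\<chi> u. f (fst u) (snd u)) $ j) $ u
      = (\<chi> i. \<Sum>j\<in>UNIV. (\<chi> u v. R $ (fst u, fst v) $ (snd u, snd v)) $ i $ j * (\<chi> u. g (fst u) (snd u)) $ j) $ u"
      by (simp add: sum_pairs)
  qed
  then have "(B ** A) *v v = (B ** A) *v w" by (simp flip: matrix_vector_mul_assoc)
  then have "v = w" by (simp add: BA)
  then have "v $ (c, d) = w $ (c, d)" by simp
  then show ?thesis by (simp add: v_def w_def)
qed

text \<open>
  For a matrix \<open>X\<close>, let \<open>\<phi>(X)\<close> be the R-trace of \<open>R X\<^sub>1 R\<^sup>-\<^sup>1\<close> over the second position; the claim is that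
  \<open>\<phi>(X)\<close> is the scalar \<open>Tr\<^sub>R X\<close>. By skew-invertibility it suffices to prove this for the slices of \<open>R\<close>.
  There it follows from the braid relation \<open>R\<^sub>2 R\<^sub>1 R\<^sub>2\<^sup>-\<^sup>1 = R\<^sub>1\<^sup>-\<^sup>1 R\<^sub>2 R\<^sub>1\<close>, because the R-trace of \<open>R\<^sub>2\<close> over the
  third position is the identity.
\<close>

lemma conj_trace:
  "(\<Sum>a\<in>UNIV. \<Sum>b\<in>UNIV. C $ a $ b * (\<Sum>h\<in>UNIV. R $ (i, b) $ (c, h) * R' $ (d, h) $ (j, a)))
    = (if i = j then C $ d $ c else 0)"
proof -
  interpret coefficients "\<lambda>x :: 'k. x" by standard (simp_all add: distrib_right mult.commute)
  have id: "map_matrix (\<lambda>x. x) R = R" by (simp add: vec_eq_iff)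
  let ?\<phi> = "\<lambda>c d. \<Sum>a\<in>UNIV. \<Sum>b\<in>UNIV. C $ a $ b * (\<Sum>h\<in>UNIV. R $ (i, b) $ (c, h) * R' $ (d, h) $ (j, a))"
  let ?r = "\<lambda>p. op2 p R :: ('n, 'k) oper" and ?r' = "\<lambda>p. op2 p R' :: ('n, 'k) oper"
  have ind: "indep (Suc 2) (?r 1)" by (rule indep_op2) simp_all
  have cR: "R $ u $ v * x = x * R $ u $ v" for u v x by (rule mult.commute)
  have cC: "C $ a $ b * x = x * C $ a $ b" for a b x by (rule mult.commute)
  have braid: "?r 1 * ?r 2 * ?r 1 = ?r 2 * ?r 1 * ?r 2"
    using braid_op2[of R 1] hecke_R by (simp add: id hecke_symmetry_def numeral_2_eq_2)
  have "?r 2 * ?r 1 * ?r' 2 = ?r' 1 * (?r 1 * ?r 2 * ?r 1) * ?r' 2"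
    by (simp add: op2_R_R' flip: mult.assoc)
  also have "\<dots> = ?r' 1 * ?r 2 * ?r 1 * (?r 2 * ?r' 2)" by (simp only: braid) (simp only: mult.assoc)
  finally have conj: "?r 2 * ?r 1 * ?r' 2 = ?r' 1 * ?r 2 * ?r 1" by (simp add: op2_R_R')
  have "ptr 3 C (?r' 1 * ?r 2 * ?r 1) = ?r' 1 * ptr 3 C (?r 2) * ?r 1"
    by (simp add: ptr_left[OF cC] ptr_right[OF cC] indep_op2)
  also have "ptr 3 C (?r 2) = 1"
    using ptr_op2[OF cC, of R 2] trace_R by (simp add: numeral_3_eq_3 numeral_2_eq_2)
  finally have one: "ptr (Suc 2) C (?r 2 * ?r 1 * ?r' 2) = 1" using conj by (simp add: op2_R_R')
  have "(\<Sum>d\<in>UNIV. \<Sum>c\<in>UNIV. R $ (x, c) $ (y, d) * ?\<phi> c d)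
      = (if x = y \<and> i = j then 1 else 0)" for x y
  proof -
    define I :: "nat \<Rightarrow> 'n" where "I = (\<lambda>_. x)(1 := x, 2 := i)"
    define J :: "nat \<Rightarrow> 'n" where "J = (\<lambda>_. x)(1 := y, 2 := j)"
    have IJ: "I 1 = x" "I 2 = i" "J 1 = y" "J 2 = j" "I (Suc 2) = x" "J (Suc 2) = x"
      by (simp_all add: I_def J_def)
    have "ent (op2 1 R) (I(2 := c)) (J(2 := d)) = R $ (x, c) $ (y, d)" for c d
      by (auto simp: op2.rep_eq agree2_def I_def J_def numeral_2_eq_2)
    then have "(\<Sum>d\<in>UNIV. \<Sum>c\<in>UNIV. R $ (x, c) $ (y, d) * ?\<phi> c d)
        = ent (ptr (Suc 2) C (?r 2 * ?r 1 * ?r' 2)) I J"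
      unfolding ptr_conj_entry[OF cC ind cR] IJ by simp
    moreover have "I = J \<longleftrightarrow> x = y \<and> i = j"
    proof
      assume "I = J"
      then have "I 1 = J 1" "I 2 = J 2" by simp_all
      then show "x = y \<and> i = j" by (simp only: IJ)
    qed (simp add: I_def J_def)
    ultimately show ?thesis unfolding one by (simp only: one_rfm.rep_eq)
  qed
  moreover have "(\<Sum>d\<in>UNIV. \<Sum>c\<in>UNIV. R $ (x, c) $ (y, d) * (if i = j then C $ d $ c else 0))
      = (if x = y \<and> i = j then 1 else 0)" for x y
    using trace_R[of x y] by (cases "i = j") (simp_all add: mult.commute)
  ultimately show ?thesis by (intro skew_cancel[of ?\<phi>]) simp
qed

lemma conj_trace_R:
  "(\<Sum>a\<in>UNIV. \<Sum>b\<in>UNIV. C $ a $ b * (\<Sum>h\<in>UNIV. R $ (i, b) $ (c, h) * R $ (d, h) $ (j, a)))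
    = (if i = j then C $ d $ c else 0) + (if d = j \<and> i = c then q - inverse q else 0)"
proof -
  let ?l = "q - inverse q"
  have R: "R $ u $ v = R' $ u $ v + (if u = v then ?l else 0)" for u v by (simp add: R'_entry)
  have "(\<Sum>h\<in>UNIV. R $ (i, b) $ (c, h) * (if (d, h) = (j, a) then ?l else 0))
      = (if d = j then ?l * R $ (i, b) $ (c, a) else 0)" for a b
    by (auto simp: if_distrib[of "\<lambda>x. _ * x"] mult.commute cong: if_cong)
  then have h: "(\<Sum>h\<in>UNIV. R $ (i, b) $ (c, h) * R $ (d, h) $ (j, a))
      = (\<Sum>h\<in>UNIV. R $ (i, b) $ (c, h) * R' $ (d, h) $ (j, a)) + (if d = j then ?l * R $ (i, b) $ (c, a) else 0)" for a b
    by (subst (2) R) (simp add: distrib_left sum.distrib)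
  have "(\<Sum>a\<in>UNIV. \<Sum>b\<in>UNIV. C $ a $ b * (if d = j then ?l * R $ (i, b) $ (c, a) else 0))
      = (if d = j then ?l * (\<Sum>a\<in>UNIV. \<Sum>b\<in>UNIV. C $ a $ b * R $ (i, b) $ (c, a)) else 0)"
    by (simp add: sum_distrib_left mult.left_commute)
  then show ?thesis
    unfolding h distrib_left sum.distrib conj_trace by (simp add: trace_R)
qed

lemma sum_rotate:
  fixes f :: "'n \<Rightarrow> 'n \<Rightarrow> 'n \<Rightarrow> 'n \<Rightarrow> 'k"
  shows "(\<Sum>y\<in>UNIV. \<Sum>x\<in>UNIV. \<Sum>u\<in>UNIV. \<Sum>v\<in>UNIV. f y x u v)
    = (\<Sum>u\<in>UNIV. \<Sum>y\<in>UNIV. \<Sum>v\<in>UNIV. \<Sum>x\<in>UNIV. f y x u v)"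
proof -
  have "(\<Sum>y\<in>UNIV. \<Sum>x\<in>UNIV. \<Sum>u\<in>UNIV. \<Sum>v\<in>UNIV. f y x u v)
      = (\<Sum>y\<in>UNIV. \<Sum>u\<in>UNIV. \<Sum>x\<in>UNIV. \<Sum>v\<in>UNIV. f y x u v)"
    by (rule sum.cong[OF refl]) (rule sum.swap)
  also have "\<dots> = (\<Sum>u\<in>UNIV. \<Sum>y\<in>UNIV. \<Sum>x\<in>UNIV. \<Sum>v\<in>UNIV. f y x u v)"
    by (rule sum.swap)
  also have "\<dots> = (\<Sum>u\<in>UNIV. \<Sum>y\<in>UNIV. \<Sum>v\<in>UNIV. \<Sum>x\<in>UNIV. f y x u v)"
    by (rule sum.cong[OF refl], rule sum.cong[OF refl]) (rule sum.swap)
  finally show ?thesis .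
qed

text \<open>
  The products of \<open>R\<close> and \<open>C \<otimes> C\<close> in either order have the same trace against every \<open>X\<^sub>1 R X'\<^sub>1\<close>: by
  \<open>conj_trace_R\<close> both traces are \<open>Tr\<^sub>R X Tr\<^sub>R X' + (q - q\<^sup>-\<^sup>1) Tr\<^sub>R (X X')\<close>. These matrices span all
  matrices because \<open>R\<close> is skew-invertible.
\<close>

lemma C_C_R:
  "(\<Sum>w\<in>UNIV. C $ fst u $ fst w * C $ snd u $ snd w * R $ w $ v)
    = (\<Sum>w\<in>UNIV. R $ u $ w * (C $ fst w $ fst v * C $ snd w $ snd v))"
proof -
  obtain d y where u: "u = (d, y)" by fastforce
  obtain a x where v: "v = (a, x)" by fastforce
  let ?f = "\<lambda>x y. \<Sum>u\<in>UNIV. \<Sum>v\<in>UNIV. C $ d $ u * C $ y $ v * R $ (u, v) $ (a, x)"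
  let ?g = "\<lambda>x y. \<Sum>u\<in>UNIV. \<Sum>v\<in>UNIV. R $ (d, y) $ (u, v) * (C $ u $ a * C $ v $ x)"
  let ?l = "q - inverse q"
  have "?f x y = ?g x y"
  proof (rule skew_cancel[of ?f ?g])
    fix b c
    let ?s = "\<lambda>y x u v. R $ (b, x) $ (c, y) * (C $ d $ u * C $ y $ v * R $ (u, v) $ (a, x))"
    let ?t = "\<lambda>y x u v. R $ (b, x) $ (c, y) * (R $ (d, y) $ (u, v) * (C $ u $ a * C $ v $ x))"
    have "(\<Sum>y\<in>UNIV. \<Sum>x\<in>UNIV. R $ (b, x) $ (c, y) * ?f x y)
        = (\<Sum>u\<in>UNIV. \<Sum>y\<in>UNIV. \<Sum>v\<in>UNIV. \<Sum>x\<in>UNIV. ?s y x u v)"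
      by (simp only: sum_distrib_left) (rule sum_rotate)
    also have "\<dots> = (\<Sum>u\<in>UNIV. C $ d $ u * (\<Sum>y\<in>UNIV. \<Sum>v\<in>UNIV. C $ y $ v * (\<Sum>x\<in>UNIV. R $ (u, v) $ (a, x) * R $ (b, x) $ (c, y))))"
      by (simp only: sum_distrib_left) (simp only: ac_simps)
    also have "\<dots> = C $ d $ c * C $ b $ a + (if b = c then ?l * C $ d $ a else 0)"
      unfolding conj_trace_R
      by (simp add: distrib_left sum.distrib if_distrib[of "\<lambda>x. _ * x"] mult.commute cong: if_cong)
    finally have f: "(\<Sum>y\<in>UNIV. \<Sum>x\<in>UNIV. R $ (b, x) $ (c, y) * ?f x y)
      = C $ d $ c * C $ b $ a + (if b = c then ?l * C $ d $ a else 0)" .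
    have "(\<Sum>y\<in>UNIV. \<Sum>x\<in>UNIV. R $ (b, x) $ (c, y) * ?g x y)
        = (\<Sum>y\<in>UNIV. \<Sum>x\<in>UNIV. \<Sum>u\<in>UNIV. \<Sum>v\<in>UNIV. ?t y x u v)"
      by (simp only: sum_distrib_left)
    also have "\<dots> = (\<Sum>x\<in>UNIV. \<Sum>y\<in>UNIV. \<Sum>u\<in>UNIV. \<Sum>v\<in>UNIV. ?t y x u v)"
      by (rule sum.swap)
    also have "\<dots> = (\<Sum>u\<in>UNIV. \<Sum>x\<in>UNIV. \<Sum>v\<in>UNIV. \<Sum>y\<in>UNIV. ?t y x u v)"
      by (rule sum_rotate)
    also have "\<dots> = (\<Sum>u\<in>UNIV. \<Sum>v\<in>UNIV. \<Sum>x\<in>UNIV. \<Sum>y\<in>UNIV. ?t y x u v)"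
      by (rule sum.cong[OF refl]) (rule sum.swap)
    also have "\<dots> = (\<Sum>u\<in>UNIV. C $ u $ a * (\<Sum>v\<in>UNIV. \<Sum>x\<in>UNIV. C $ v $ x * (\<Sum>y\<in>UNIV. R $ (b, x) $ (c, y) * R $ (d, y) $ (u, v))))"
      by (simp only: sum_distrib_left) (simp only: ac_simps)
    also have "\<dots> = C $ d $ c * C $ b $ a + (if b = c then ?l * C $ d $ a else 0)"
      unfolding conj_trace_R
      by (simp add: distrib_left sum.distrib if_distrib[of "\<lambda>x. _ * x"] mult.commute cong: if_cong)
    finally show "(\<Sum>y\<in>UNIV. \<Sum>x\<in>UNIV. R $ (b, x) $ (c, y) * ?f x y)
      = (\<Sum>y\<in>UNIV. \<Sum>x\<in>UNIV. R $ (b, x) $ (c, y) * ?g x y)"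
      using f by simp
  qed
  then show ?thesis unfolding u v by (simp add: sum_pairs)
qed

end

section \<open>The tower of operator algebras\<close>

definition A_upto :: "nat \<Rightarrow> ('n, 'a::ring_1) oper set" where
  "A_upto k = {X. \<forall>p>k. indep p X}"

locale hecke_model = skew_invertible_hecke q R \<Psi> + coefficients \<iota>
  for q :: "'k::field" and R \<Psi> :: "('n::finite, 'k) matrix2" and \<iota> :: "'k \<Rightarrow> 'a::ring_1"
begin

definition r :: "nat \<Rightarrow> ('n, 'a) oper" where
  "r p = op2 p (map_matrix \<iota> R)"

definition E :: "nat \<Rightarrow> ('n, 'a) oper \<Rightarrow> ('n, 'a) oper" where
  "E p = ptr p (map_matrix \<iota> C)"

lemma op2_map_R': "op2 p (map_matrix \<iota> R') = r p - scl (q - inverse q) (1 :: ('n, 'a) oper)"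
  unfolding r_def by (rule rfm_eqI) (auto simp: op2.rep_eq R'_entry agree2_def \<iota>_diff \<iota>_zero fun_eq_iff)

lemma map_matrix_one: "map_matrix \<iota> (mat 1) = mat 1"
  by (simp add: vec_eq_iff mat_def \<iota>_one \<iota>_zero)

lemma r_R': "r p * op2 p (map_matrix \<iota> R') = 1"
  unfolding r_def by (simp only: op2_mult[symmetric] map_matrix_mult[symmetric] R_R'(1) map_matrix_one op2_one)

lemma C_central: "map_matrix \<iota> C $ a $ b * x = x * map_matrix \<iota> C $ a $ b"
  by (simp add: \<iota>_central)

lemma scl_dg: "scl c (1 :: ('n, 'a) oper) = dg (\<iota> c)"
  by (simp add: scl_def)

sublocale markov_tower scl q \<delta> r E A_upto
proof -
  interpret scaled_ring "scl :: 'k \<Rightarrow> ('n, 'a) oper \<Rightarrow> ('n, 'a) oper"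
    by (rule scaled_ring_scl)
  show "markov_tower (scl :: 'k \<Rightarrow> ('n, 'a) oper \<Rightarrow> ('n, 'a) oper) q \<delta> r E A_upto"
  proof (unfold_locales)
    show "generic q" by (rule generic_q)
    show "r i * r i = 1 + scl (q - inverse q) (r i)" for i
      using r_R'[of i] by (simp add: op2_map_R' right_diff_distrib scl_right[of "r i" _ 1] algebra_simps)
    show "r i * r (Suc i) * r i = r (Suc i) * r i * r (Suc i)" if "1 \<le> i" for i
      unfolding r_def using hecke_R that by (intro braid_op2) (simp_all add: hecke_symmetry_def)
    show "(1 :: ('n, 'a) oper) \<in> A_upto k" for k by (simp add: A_upto_def indep_one)
    show "x + y \<in> A_upto k" "x * y \<in> A_upto k" if "x \<in> A_upto k" "y \<in> A_upto k" for k and x y :: "('n, 'a) oper"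
      using that by (auto simp: A_upto_def intro: indep_add indep_mult)
    show "scl c x \<in> A_upto k" if "x \<in> A_upto k" for k c and x :: "('n, 'a) oper"
      using that by (auto simp: A_upto_def scl_def intro: indep_scale)
    show "x \<in> A_upto (Suc k)" if "x \<in> A_upto k" for k and x :: "('n, 'a) oper"
      using that by (auto simp: A_upto_def)
    show "r i \<in> A_upto (Suc i)" for i
      by (auto simp: A_upto_def r_def intro!: indep_op2)
    show "r i * x = x * r i" if "x \<in> A_upto k" "k < i" for k i x
      unfolding r_def using that by (intro op2_commute) (auto simp: A_upto_def \<iota>_central)
    show "E i (x + y) = E i x + E i y" for i x y by (simp add: E_def ptr_add)
    show "E i (scl c x) = scl c (E i x)" for i c x
      unfolding scl_def E_def by (rule ptr_left[OF C_central indep_dg])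
    show "E (Suc k) x \<in> A_upto k" if "x \<in> A_upto (Suc k)" for k x
    proof -
      have "indep p (E (Suc k) x)" if "p > k" for p
        using \<open>x \<in> A_upto (Suc k)\<close> that unfolding E_def A_upto_def
        by (cases "p = Suc k") (auto intro: indep_ptr_same indep_ptr)
      then show ?thesis by (simp add: A_upto_def)
    qed
    show "E (Suc k) (x * y) = x * E (Suc k) y" "E (Suc k) (y * x) = E (Suc k) y * x" if "x \<in> A_upto k" for k x y
      unfolding E_def using that by (auto simp: A_upto_def intro: ptr_left[OF C_central] ptr_right[OF C_central])
    show "E (Suc k) 1 = scl \<delta> 1" for k
      by (simp add: E_def ptr_one scl_dg \<delta>_def \<iota>_sum)
    show "E (Suc k) (r k) = 1" for k
      unfolding E_def r_def
    proof (rule ptr_op2[OF C_central])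
      fix i j
      have "(\<Sum>a\<in>UNIV. \<Sum>b\<in>UNIV. map_matrix \<iota> C $ a $ b * map_matrix \<iota> R $ (i, b) $ (j, a))
          = \<iota> (\<Sum>a\<in>UNIV. \<Sum>b\<in>UNIV. C $ a $ b * R $ (i, b) $ (j, a))"
        by (simp add: \<iota>_sum \<iota>_mult)
      then show "(\<Sum>a\<in>UNIV. \<Sum>b\<in>UNIV. map_matrix \<iota> C $ a $ b * map_matrix \<iota> R $ (i, b) $ (j, a))
          = (if i = j then 1 else 0)"
        by (simp only: trace_R if_distrib[of \<iota>] \<iota>_one \<iota>_zero)
    qed
    show "E (Suc k) (r k * x * (r k - scl (q - inverse q) 1)) = E k x" if "x \<in> A_upto k" for k x
      unfolding op2_map_R'[symmetric] unfolding E_def r_def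
    proof (rule ptr_conj[OF C_central])
      fix c d i j
      have "(\<Sum>a\<in>UNIV. \<Sum>b\<in>UNIV. map_matrix \<iota> C $ a $ b *
            (\<Sum>h\<in>UNIV. map_matrix \<iota> R $ (i, b) $ (c, h) * map_matrix \<iota> R' $ (d, h) $ (j, a)))
          = \<iota> (\<Sum>a\<in>UNIV. \<Sum>b\<in>UNIV. C $ a $ b * (\<Sum>h\<in>UNIV. R $ (i, b) $ (c, h) * R' $ (d, h) $ (j, a)))"
        by (simp add: \<iota>_sum \<iota>_mult)
      then show "(\<Sum>a\<in>UNIV. \<Sum>b\<in>UNIV. map_matrix \<iota> C $ a $ b *
            (\<Sum>h\<in>UNIV. map_matrix \<iota> R $ (i, b) $ (c, h) * map_matrix \<iota> R' $ (d, h) $ (j, a)))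
          = (if i = j then map_matrix \<iota> C $ d $ c else 0)"
        by (simp only: conj_trace if_distrib[of \<iota>] nth_map_matrix \<iota>_zero)
      show "indep (Suc k) x" using that by (simp add: A_upto_def)
      show "map_matrix \<iota> R $ u $ v * y = y * map_matrix \<iota> R $ u $ v" for u v y
        by (simp add: \<iota>_central)
    qed
    show "E k (E (Suc k) (r k * x)) = E k (E (Suc k) (x * r k))" for k x
      unfolding E_def r_def
    proof (rule ptr_cyclic[OF C_central])
      fix u v
      have "\<iota> (\<Sum>w\<in>UNIV. C $ fst u $ fst w * C $ snd u $ snd w * R $ w $ v)
          = \<iota> (\<Sum>w\<in>UNIV. R $ u $ w * (C $ fst w $ fst v * C $ snd w $ snd v))"
        by (simp only: C_C_R)
      then show "(\<Sum>w\<in>UNIV. map_matrix \<iota> C $ fst u $ fst w * map_matrix \<iota> C $ snd u $ snd w * map_matrix \<iota> R $ w $ v)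
          = (\<Sum>w\<in>UNIV. map_matrix \<iota> R $ u $ w * (map_matrix \<iota> C $ fst w $ fst v * map_matrix \<iota> C $ snd w $ snd v))"
        by (simp add: \<iota>_sum \<iota>_mult)
      show "map_matrix \<iota> R $ u $ v * y = y * map_matrix \<iota> R $ u $ v" for u v y
        by (simp add: \<iota>_central)
    qed
  qed
qed

lemma emb_skew_symm:
  "k \<le> n \<Longrightarrow> emb 0 n (tlift \<iota> (skew_symm q R n k)) = asym q r k"
proof (induction k)
  case (Suc k)
  have tl: "tlift \<iota> (\<lambda>I J. c * X I J) = (\<lambda>I J. \<iota> c * tlift \<iota> X I J)" for c and X :: "('n, 'k) tensor_op"
    by (simp add: tlift_def \<iota>_mult fun_eq_iff)
  have tl': "tlift \<iota> (\<lambda>I J. X I J - Y I J) = (\<lambda>I J. tlift \<iota> X I J - tlift \<iota> Y I J)" for X Y :: "('n, 'k) tensor_op"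
    by (simp add: tlift_def \<iota>_diff fun_eq_iff)
  show ?case
  proof (cases "k = 0")
    case False
    have f: "emb 0 n (tlift \<iota> (\<lambda>I J. q ^ k * tone I J - qnum q k * at2 k R I J))
        = scl (q ^ k) 1 - scl (qnum q k) (r k)"
      using False Suc.prems
      by (simp add: tl tl' emb_diff emb_scale tlift_tone tlift_at2 emb_tone emb_at2 scl_def r_def)
    show ?thesis
      using False Suc by (simp add: tl emb_scale tlift_tprod emb_tprod f asym.simps(2) mult.assoc flip: scl_def)
  qed (simp add: tlift_tone emb_tone)
qed (simp add: tlift_tone emb_tone)

section \<open>The R-trace as an iterated partial trace\<close>

text \<open>
  The product over the positions above \<open>a\<close> only; splitting off its first factor gives the induction.
\<close>

lemma tprod_at1:
  fixes M :: "('n, 'k) matrix1"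
  assumes "length I = n" "length J = n" "a \<le> n"
  shows "tprod n (map (\<lambda>i. at1 i M) [Suc a..<Suc n]) I J
    = (if take a I = take a J then \<Prod>i=a..<n. M $ (I ! i) $ (J ! i) else 0)"
  using assms(3,1)
proof (induction a arbitrary: I rule: inc_induct)
  case base
  then show ?case using assms(2) by (simp add: tprod_def tone_def)
next
  case (step a)
  let ?Q = "tprod n (map (\<lambda>i. at1 i M) [Suc (Suc a)..<Suc n])"
  let ?K = "I[a := J ! a]"
  have len: "length ?K = n" using step.prems by simp
  have "tprod n (map (\<lambda>i. at1 i M) [Suc a..<Suc n]) I J = (\<Sum>K | length K = n. at1 (Suc a) M I K * ?Q K J)"
    using step.hyps by (simp add: upt_conv_Cons[of "Suc a"] tprod_def tmul_def del: upt_Suc)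
  also have "\<dots> = (\<Sum>K\<in>{?K}. at1 (Suc a) M I K * ?Q K J)"
  proof (rule sum.mono_neutral_right)
    show "\<forall>K\<in>{K. length K = n} - {?K}. at1 (Suc a) M I K * ?Q K J = 0"
    proof
      fix K assume K: "K \<in> {K. length K = n} - {?K}"
      show "at1 (Suc a) M I K * ?Q K J = 0"
      proof (rule ccontr)
        assume "\<not> ?thesis"
        then have 1: "at1 (Suc a) M I K \<noteq> 0" and 2: "?Q K J \<noteq> 0" by auto
        have "take (Suc a) K = take (Suc a) J" using 2 step.IH[of K] K by (auto split: if_splits)
        then have "take (Suc a) K ! a = take (Suc a) J ! a" by simp
        then have "K ! a = J ! a" by simp
        moreover have "\<forall>r<n. r \<noteq> a \<longrightarrow> I ! r = K ! r"
          using 1 step.prems by (auto simp: at1_def split: if_splits)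
        ultimately have "K ! i = ?K ! i" if "i < n" for i
          using that step.prems by (cases "i = a") simp_all
        then have "K = ?K" using K step.prems by (intro nth_equalityI) simp_all
        then show False using K by simp
      qed
    qed
  qed (use len in simp_all)
  also have "\<dots> = M $ (I ! a) $ (J ! a) * ?Q ?K J"
    using step by (simp add: at1_def)
  also have "?Q ?K J = (if take (Suc a) ?K = take (Suc a) J then \<Prod>i=Suc a..<n. M $ (?K ! i) $ (J ! i) else 0)"
    by (rule step.IH[OF len])
  also have "(take (Suc a) ?K = take (Suc a) J) = (take a I = take a J)"
    using step assms(2) by (simp add: take_Suc_conv_app_nth)
  also have "(\<Prod>i=Suc a..<n. M $ (?K ! i) $ (J ! i)) = (\<Prod>i=Suc a..<n. M $ (I ! i) $ (J ! i))"
    by (intro prod.cong) auto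
  finally show ?case using step.hyps by (simp add: prod.atLeast_Suc_lessThan)
qed

definition cprod :: "'n list \<Rightarrow> 'n list \<Rightarrow> 'k" where
  "cprod I J = (\<Prod>i<length I. C $ (I ! i) $ (J ! i))"

lemma cprod_snoc: "length I = length J \<Longrightarrow> cprod (I @ [a]) (J @ [b]) = cprod I J * C $ a $ b"
  by (simp add: cprod_def nth_append)

lemma R_trace_eq:
  "R_trace \<iota> \<Psi> n X = (\<Sum>I | length I = n. \<Sum>K | length K = n. \<iota> (cprod I K) * X K I)"
proof -
  have "tprod n (map (\<lambda>i. at1 i C) [1..<Suc n]) I K = cprod I K" if "length I = n" "length K = n" for I K
    using tprod_at1[of I n K 0 C] that by (simp add: cprod_def atLeast0LessThan)
  then show ?thesis
    by (auto simp: R_trace_def ttrace_def tmul_def tlift_def intro!: sum.cong)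
qed

lemma sum_snoc:
  fixes f :: "'n list \<Rightarrow> 'c::comm_monoid_add"
  shows "(\<Sum>I | length I = Suc n. f I) = (\<Sum>I | length I = n. \<Sum>a\<in>UNIV. f (I @ [a]))"
proof -
  have "{I :: 'n list. length I = Suc n} = (\<lambda>(I, a). I @ [a]) ` ({I. length I = n} \<times> UNIV)"
    by (auto simp: length_Suc_conv_rev image_iff)
  moreover have "inj_on (\<lambda>(I, a). I @ [a]) ({I :: 'n list. length I = n} \<times> UNIV)"
    by (auto simp: inj_on_def)
  ultimately have "(\<Sum>I | length I = Suc n. f I) = (\<Sum>(I, a)\<in>{I. length I = n} \<times> UNIV. f (I @ [a]))"
    by (simp add: sum.reindex case_prod_unfold)
  then show ?thesis by (simp add: sum.cartesian_product)
qed

definition last_trace :: "('n, 'a) tensor_op \<Rightarrow> ('n, 'a) tensor_op" where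
  "last_trace X I J = (\<Sum>a\<in>UNIV. \<Sum>b\<in>UNIV. \<iota> (C $ a $ b) * X (I @ [b]) (J @ [a]))"

lemma E_emb: "E (Suc n) (emb 0 (Suc n) X) = emb 0 n (last_trace X)"
proof (rule rfm_eqI)
  fix I J :: "nat \<Rightarrow> 'n"
  have w: "window 0 (Suc n) (I(Suc n := b)) = window 0 n I @ [b]" for I :: "nat \<Rightarrow> 'n" and b
    by (rule nth_equalityI) (auto simp: nth_append less_Suc_eq)
  have "agree_off 0 n I J \<longleftrightarrow> I (Suc n) = J (Suc n) \<and> agree_off 0 (Suc n) (I(Suc n := b)) (J(Suc n := a))" for a b
    by (auto simp: agree_off_def le_Suc_eq)
  then show "ent (E (Suc n) (emb 0 (Suc n) X)) I J = ent (emb 0 n (last_trace X)) I J"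
    by (auto simp: E_def ptr.rep_eq emb.rep_eq w last_trace_def)
qed

lemma R_trace_Suc: "R_trace \<iota> \<Psi> (Suc n) X = R_trace \<iota> \<Psi> n (last_trace X)"
proof -
  have "R_trace \<iota> \<Psi> (Suc n) X = (\<Sum>I | length I = n. \<Sum>a\<in>UNIV. \<Sum>K | length K = n. \<Sum>b\<in>UNIV.
      \<iota> (cprod I K) * (\<iota> (C $ a $ b) * X (K @ [b]) (I @ [a])))"
    unfolding R_trace_eq sum_snoc by (intro sum.cong refl) (simp add: cprod_snoc \<iota>_mult mult.assoc)
  also have "\<dots> = (\<Sum>I | length I = n. \<Sum>K | length K = n. \<Sum>a\<in>UNIV. \<Sum>b\<in>UNIV.
      \<iota> (cprod I K) * (\<iota> (C $ a $ b) * X (K @ [b]) (I @ [a])))"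
    by (rule sum.cong[OF refl]) (rule sum.swap)
  also have "\<dots> = R_trace \<iota> \<Psi> n (last_trace X)"
    unfolding R_trace_eq last_trace_def sum_distrib_left ..
  finally show ?thesis .
qed

lemma tr_emb: "tr 0 n (emb 0 n X) = dg (R_trace \<iota> \<Psi> n X)"
proof (induction n arbitrary: X)
  case 0
  have "{I :: 'n list. length I = 0} = {[]}" by auto
  then have "R_trace \<iota> \<Psi> 0 X = X [] []" by (simp add: R_trace_eq cprod_def \<iota>_one)
  moreover have "emb 0 0 X = dg (X [] [])"
    by (rule rfm_eqI) (auto simp: emb.rep_eq dg.rep_eq agree_off_def window_def)
  ultimately show ?case by simp
next
  case (Suc n)
  then show ?case by (simp add: E_emb R_trace_Suc)
qed

end

section \<open>Barred copies and elementary symmetric polynomials as operators\<close>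

locale hecke_model_matrix = hecke_model q R \<Psi> \<iota>
  for q :: "'k::field" and R \<Psi> :: "('n::finite, 'k) matrix2" and \<iota> :: "'k \<Rightarrow> 'a::ring_1" +
  fixes L :: "('n, 'a) matrix1"
begin

sublocale reflection_tower scl q \<delta> r E A_upto "op1 (Suc 0) L"
  by unfold_locales (auto simp: A_upto_def intro: indep_op1)

lemma emb_bar_copy: "1 \<le> k \<Longrightarrow> k \<le> n \<Longrightarrow> emb 0 n (bar_copy \<iota> R n L k) = ell k"
proof (induction k)
  case (Suc k)
  show ?case
  proof (cases "k = 0")
    case False
    then show ?thesis
      using Suc op2_map_R'[of k]
      by (simp add: emb_tprod tlift_at2 emb_at2 ell_Suc matrix_inv_R rinv_def mult.assoc flip: r_def)
  qed (use Suc.prems in \<open>simp add: emb_at1 ell_1\<close>)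
qed simp

text \<open>
  Stated with a separate length \<open>j\<close> because the barred copies depend on the ambient tensor power \<open>n\<close>.
\<close>

lemma prod_bar_copy: "j \<le> n \<Longrightarrow> prod_list (map (\<lambda>k. emb 0 n (bar_copy \<iota> R n L k)) [1..<Suc j]) = lp 0 j"
  by (induction j) (simp_all add: emb_bar_copy del: bar_copy.simps)

lemma dg_elem_symm: "dg (elem_symm \<iota> q R \<Psi> L k) = e k"
proof (cases "k = 0")
  case False
  have "emb 0 k (tmul k (tlift \<iota> (skew_symm q R k k)) (tprod k (map (bar_copy \<iota> R k L) [1..<Suc k])))
      = P 0 k * lp 0 k"
    using prod_bar_copy[of k k] by (simp add: emb_mult emb_tprod emb_skew_symm o_def del: upt_Suc)
  then show ?thesis using False by (simp add: elem_symm_def e_def flip: tr_emb)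
qed (simp add: elem_symm_def e_def dg_one)

end

section \<open>Bi-rank and skew-symmetrizers\<close>

lemma ideal_add:
  assumes "x \<in> two_sided_ideal G" "y \<in> two_sided_ideal G"
  shows "x + y \<in> two_sided_ideal G"
  using assms(2)
proof (induction y rule: two_sided_ideal.induct)
  case (step y g a b)
  have "x + y + a * g * b \<in> two_sided_ideal G"
    by (rule two_sided_ideal.step) (use step in auto)
  then show ?case by (simp add: add.assoc)
qed (use assms(1) in simp)

lemma ideal_left: "x \<in> two_sided_ideal G \<Longrightarrow> c * x \<in> two_sided_ideal G"
proof (induction x rule: two_sided_ideal.induct)
  case (step x g a b)
  have "c * x + c * a * g * b \<in> two_sided_ideal G"
    by (rule two_sided_ideal.step) (use step in auto)
  then show ?case by (simp add: distrib_left mult.assoc)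
qed (simp add: two_sided_ideal.zero)

lemma ideal_right: "x \<in> two_sided_ideal G \<Longrightarrow> x * c \<in> two_sided_ideal G"
proof (induction x rule: two_sided_ideal.induct)
  case (step x g a b)
  have "x * c + a * g * (b * c) \<in> two_sided_ideal G"
    by (rule two_sided_ideal.step) (use step in auto)
  then show ?case by (simp add: distrib_right mult.assoc)
qed (simp add: two_sided_ideal.zero)

lemma ideal_gen: "g \<in> G \<Longrightarrow> g \<in> two_sided_ideal G"
  using two_sided_ideal.step[OF two_sided_ideal.zero, of g G 1 1] by simp

lemma ideal_minus: "x \<in> two_sided_ideal G \<Longrightarrow> - x \<in> two_sided_ideal G"
  using ideal_left[of x G "- 1"] by simp

lemma ideal_diff: "x \<in> two_sided_ideal G \<Longrightarrow> y \<in> two_sided_ideal G \<Longrightarrow> x - y \<in> two_sided_ideal G"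
  using ideal_add[of x G "- y"] ideal_minus[of y G] by simp

lemma ideal_sum: "(\<And>i. i \<in> S \<Longrightarrow> f i \<in> two_sided_ideal G) \<Longrightarrow> sum f S \<in> two_sided_ideal G"
  by (induction S rule: infinite_finite_induct) (auto intro: two_sided_ideal.zero ideal_add)

subsection \<open>The free algebra\<close>

text \<open>
  The words, as the monomial basis of the free algebra.
\<close>

definition wd :: "'g list \<Rightarrow> ('g, 'k::zero_neq_one) free_algebra" where
  "wd w = Poly_Mapping.single (Word w) 1"

lemma wd_append: "wd (u @ v) = wd u * (wd v :: ('g, 'k::field) free_algebra)"
  by (simp add: wd_def mult_single plus_fword_def)

lemma gen_wd: "gen g = wd [g]"
  by (simp add: gen_def wd_def)

lemma scal_wd: "scal c * wd w = Poly_Mapping.single (Word w) (c :: 'k::field)"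
  by (simp add: scal_def wd_def mult_single)

lemma sum_singles: "x = (\<Sum>w\<in>Poly_Mapping.keys x. Poly_Mapping.single w (Poly_Mapping.lookup x w))"
  by (rule poly_mapping_eqI) (auto simp: lookup_sum lookup_single when_def in_keys_iff)

lemma additive_induct:
  fixes x :: "'g \<Rightarrow>\<^sub>0 'k::comm_monoid_add"
  assumes "\<And>w c. Q (Poly_Mapping.single w c)" "\<And>x y. Q x \<Longrightarrow> Q y \<Longrightarrow> Q (x + y)"
  shows "Q x"
proof -
  have "Q (\<Sum>w\<in>S. Poly_Mapping.single w (f w))" for S and f :: "'g \<Rightarrow> 'k"
    by (induction S rule: infinite_finite_induct) (use assms assms(1)[of _ 0] in auto)
  then show ?thesis by (subst sum_singles)
qed

lemma scal_coefficients: "coefficients (scal :: 'k::field \<Rightarrow> ('g, 'k) free_algebra)"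
proof
  fix c d :: 'k and x :: "('g, 'k) free_algebra"
  show "scal (c + d) = scal c + (scal d :: ('g, 'k) free_algebra)" by (simp add: scal_def single_add)
  show "scal (c * d) = scal c * (scal d :: ('g, 'k) free_algebra)" by (simp add: scal_def mult_single)
  show "scal 1 = (1 :: ('g, 'k) free_algebra)" by (simp add: scal_def)
  show "scal c * x = x * scal c"
    by (induction x rule: additive_induct)
       (simp_all add: scal_def mult_single mult.commute distrib_left distrib_right)
qed

lemma free_vector_space: "vector_space (\<lambda>c x. scal c * (x :: ('g, 'k::field) free_algebra))"
proof -
  interpret coefficients "scal :: 'k \<Rightarrow> ('g, 'k) free_algebra" by (rule scal_coefficients)
  show ?thesis by standard (simp_all add: distrib_left distrib_right \<iota>_add \<iota>_mult \<iota>_one mult.assoc)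
qed

lemma expand_wds: "x = (\<Sum>w\<in>Poly_Mapping.keys x. scal (Poly_Mapping.lookup x w) * wd (letters w))"
  for x :: "('g, 'k::field) free_algebra"
  by (simp add: scal_wd sum_singles[symmetric])

lemma tensor_degree_span:
  "tensor_degree k = module.span (\<lambda>(c :: 'k::field) x. scal c * x) (wd ` {w :: 'n::finite list. length w = k})"
  (is "_ = module.span ?s ?B")
proof -
  interpret vector_space ?s by (rule free_vector_space)
  show ?thesis
  proof (intro equalityI subsetI)
    fix x :: "('n, 'k) free_algebra" assume x: "x \<in> tensor_degree k"
    have "(\<Sum>w\<in>Poly_Mapping.keys x. scal (Poly_Mapping.lookup x w) * wd (letters w)) \<in> span ?B"
      using x by (intro span_sum span_scale span_base) (auto simp: tensor_degree_def)
    then show "x \<in> span ?B" using expand_wds[of x] by simp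
  next
    fix x :: "('n, 'k) free_algebra" assume "x \<in> span ?B"
    then show "x \<in> tensor_degree k"
    proof (induction rule: span_induct_alt)
      case base
      then show ?case by (simp add: tensor_degree_def)
    next
      case (step c x y)
      then obtain w where w: "x = wd w" "length w = k" by auto
      have "Poly_Mapping.keys (scal c * x + y) \<subseteq> Poly_Mapping.keys (scal c * x) \<union> Poly_Mapping.keys y"
        by (rule Poly_Mapping.keys_add)
      moreover have "Poly_Mapping.keys (scal c * x) \<subseteq> {Word w}"
        by (simp add: w(1) scal_wd)
      ultimately show ?case using step(2) w(2) by (fastforce simp: tensor_degree_def)
    qed
  qed
qed

text \<open>
  The dimension of the quotient is a truncated difference of dimensions. It is zero only if a basis of
  the component of the ideal is also a basis of the whole component, which is finite-dimensional.
\<close>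

lemma wedge_dim_eq_0_iff:
  "wedge_dim q R k = 0 \<longleftrightarrow> (\<forall>w :: 'n::finite list. length w = k \<longrightarrow> wd w \<in> wedge_ideal q (R :: ('n, 'k::field) matrix2))"
proof -
  let ?s = "\<lambda>c x. scal c * (x :: ('n, 'k) free_algebra)"
  interpret vector_space ?s by (rule free_vector_space)
  let ?T = "tensor_degree k :: ('n, 'k) free_algebra set" and ?J = "wedge_ideal q R"
  let ?B = "wd ` {w :: 'n list. length w = k} :: ('n, 'k) free_algebra set"
  have T: "?T = span ?B" by (rule tensor_degree_span)
  have fin: "finite ?B" by simp
  have sub: "subspace (?J \<inter> ?T)"
    unfolding T by (intro subspace_inter subspace_span)
      (auto simp: subspace_def wedge_ideal_def two_sided_ideal.zero ideal_add ideal_left)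
  obtain B1 where B1: "B1 \<subseteq> ?J \<inter> ?T" "independent B1" "?J \<inter> ?T \<subseteq> span B1" "card B1 = dim (?J \<inter> ?T)"
    by (rule basis_exists)
  obtain B2 where B2: "B1 \<subseteq> B2" "B2 \<subseteq> ?T" "independent B2" "?T \<subseteq> span B2"
    using maximal_independent_subset_extend[of B1 ?T] B1 by (metis Int_subset_iff)
  have "finite B2" using independent_span_bound[OF fin B2(3)] B2(2) T by simp
  have dimT: "dim ?T = card B2"
  proof (rule dim_eq_card[OF _ B2(3)])
    show "span B2 = span ?T"
      using span_mono[OF B2(2)] span_minimal[OF B2(4) subspace_span] by blast
  qed
  show ?thesis
  proof
    assume "wedge_dim q R k = 0"
    then have "card B2 \<le> card B1"
      using B1(4) dimT by (simp add: wedge_dim_def free_dim_def)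
    then have "B1 = B2" using card_seteq[OF \<open>finite B2\<close> B2(1)] by simp
    then have "?T \<subseteq> ?J \<inter> ?T" using B2(4) span_minimal[OF B1(1) sub] by blast
    moreover have "?B \<subseteq> ?T" unfolding T by (rule span_superset)
    ultimately show "\<forall>w. length w = k \<longrightarrow> wd w \<in> ?J" by blast
  next
    assume "\<forall>w. length w = k \<longrightarrow> wd w \<in> ?J"
    then have "?B \<subseteq> ?J \<inter> ?T" unfolding T by (auto intro: span_base)
    then have "?T \<subseteq> ?J \<inter> ?T" using span_minimal[OF _ sub] T by simp
    then have "?J \<inter> ?T = ?T" by blast
    then show "wedge_dim q R k = 0" by (simp add: wedge_dim_def)
  qed
qed

text \<open>
  A denominator of degree 0 is a nonzero constant, so the dimensions are the coefficients of a polynomial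
  of degree \<open>m\<close> up to this constant.
\<close>

lemma bi_rank_wedge_dim:
  assumes "bi_rank q R m 0" "m > 0"
  shows "wedge_dim q R m \<noteq> 0" "wedge_dim q R (Suc m) = 0"
proof -
  obtain num den :: "rat poly" where nd: "den \<noteq> 0" "degree num = m" "degree den = 0"
    and eq: "fps_of_poly den * Abs_fps (\<lambda>k. of_nat (wedge_dim q R k)) = fps_of_poly num"
    using assms unfolding bi_rank_def by blast
  obtain d where d: "den = [:d:]" using nd(3) degree_eq_zeroE by blast
  have "coeff num k = d * of_nat (wedge_dim q R k)" for k
    using arg_cong[OF eq, of "\<lambda>f. fps_nth f k"] by (simp add: d fps_of_poly_const)
  moreover have "coeff num m \<noteq> 0" using nd(2) assms(2) by (metis degree_0 leading_coeff_0_iff less_irrefl)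
  moreover have "coeff num (Suc m) = 0" using nd(2) by (simp add: coeff_eq_0)
  moreover have "d \<noteq> 0" using nd(1) d by simp
  ultimately show "wedge_dim q R m \<noteq> 0" "wedge_dim q R (Suc m) = 0" by auto
qed

context skew_invertible_hecke
begin

sublocale scalar: hecke_model q R \<Psi> "\<lambda>x. x"
  by unfold_locales (simp_all add: mult.commute)

definition wedge_relation :: "'n \<Rightarrow> 'n \<Rightarrow> ('n, 'k) free_algebra" where
  "wedge_relation i j = scal (inverse q) * gen i * gen j +
    (\<Sum>k\<in>UNIV. \<Sum>l\<in>UNIV. scal (R $ (i, j) $ (k, l)) * gen k * gen l)"

lemma wedge_ideal_eq: "wedge_ideal q R = two_sided_ideal (range (\<lambda>(i, j). wedge_relation i j))"
  by (simp add: wedge_ideal_def wedge_relation_def)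

lemma wedge_relation_sandwich:
  "wd u * wedge_relation i j * wd v = scal (inverse q) * wd (u @ [i, j] @ v) +
    (\<Sum>w\<in>UNIV. scal (R $ (i, j) $ w) * wd (u @ [fst w, snd w] @ v))"
proof -
  interpret coefficients "scal :: 'k \<Rightarrow> ('n, 'k) free_algebra" by (rule scal_coefficients)
  have "wd (u @ [i] @ [j] @ v) = wd u * (wd [i] * (wd [j] * (wd v :: ('n, 'k) free_algebra)))" for i j
    by (simp only: wd_append)
  then have "wd u * (scal c * gen i * gen j) * wd v = scal c * wd (u @ [i, j] @ v)" for c :: 'k and i j
    by (simp add: gen_wd \<iota>_left mult.assoc)
  then show ?thesis
    by (simp add: wedge_relation_def distrib_left distrib_right sum_distrib_left sum_distrib_right
        sum.cartesian_product UNIV_Times_UNIV[symmetric] case_prod_unfold del: UNIV_Times_UNIV)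
qed

lemma window_split:
  fixes K :: "nat \<Rightarrow> 'n"
  assumes "1 \<le> p" "p < k"
  shows "window 0 k (upd2 p K w) = window 0 (p - 1) K @ [fst w, snd w] @ window (Suc p) (k - Suc p) K"
proof (rule nth_equalityI)
  fix x assume "x < length (window 0 k (upd2 p K w))"
  then have x: "x < k" by simp
  consider "x < p - 1" | "x = p - 1" | "x = p" | "p < x" by linarith
  then show "window 0 k (upd2 p K w) ! x = (window 0 (p - 1) K @ [fst w, snd w] @ window (Suc p) (k - Suc p) K) ! x"
    using x assms by cases (auto simp: nth_append nth_Cons' upd2_def)
qed (use assms in simp)

lemma sandwich_window:
  assumes "1 \<le> p" "p < k"
  shows "scal (inverse q) * wd (window 0 k K) + (\<Sum>w\<in>UNIV. scal (R $ (K p, K (Suc p)) $ w) * wd (window 0 k (upd2 p K w)))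
    = wd (window 0 (p - 1) K) * wedge_relation (K p) (K (Suc p)) * wd (window (Suc p) (k - Suc p) K)"
proof -
  have "K = upd2 p K (K p, K (Suc p))" by (simp add: upd2_def fun_eq_iff)
  then have "window 0 k K = window 0 (p - 1) K @ [K p, K (Suc p)] @ window (Suc p) (k - Suc p) K"
    using window_split[OF assms, of K "(K p, K (Suc p))"] by simp
  then show ?thesis by (simp add: wedge_relation_sandwich window_split[OF assms])
qed

text \<open>
  The row of an operator with index \<open>I\<close>, as an element of the tensor algebra. Modulo the ideal, each
  generator acts on rows by the sign character, so the skew-symmetrizer fixes them.
\<close>

definition row :: "nat \<Rightarrow> (nat \<Rightarrow> 'n) \<Rightarrow> ('n, 'k) oper \<Rightarrow> ('n, 'k) free_algebra" where
  "row k I Y = (\<Sum>K | agree_off 0 k I K. scal (ent Y I K) * wd (window 0 k K))"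

lemma row_r:
  assumes "1 \<le> p" "p < k"
  shows "row k I (Y * scalar.r p) + scal (inverse q) * row k I Y \<in> wedge_ideal q R"
proof -
  interpret coefficients "scal :: 'k \<Rightarrow> ('n, 'k) free_algebra" by (rule scal_coefficients)
  let ?S = "{K. agree_off 0 k I K}"
  let ?h = "\<lambda>(J, u). (upd2 p J u, (J p, J (Suc p)))"
  have upd: "agree_off 0 k I (upd2 p J u) \<longleftrightarrow> agree_off 0 k I J" for J u
    using assms by (auto simp: agree_off_def upd2_def)
  have id: "map_matrix (\<lambda>x. x) R = R" by (simp add: vec_eq_iff)
  have "row k I (Y * scalar.r p)
      = (\<Sum>J\<in>?S. \<Sum>u\<in>UNIV. scal (ent Y I (upd2 p J u)) * scal (R $ u $ (J p, J (Suc p))) * wd (window 0 k J))"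
    by (simp add: row_def scalar.r_def id op2_mult_right \<iota>_sum \<iota>_mult sum_distrib_right)
  also have "\<dots> = (\<Sum>(J, u)\<in>?S \<times> UNIV. scal (ent Y I (upd2 p J u)) * scal (R $ u $ (J p, J (Suc p))) * wd (window 0 k J))"
    by (simp add: sum.cartesian_product)
  also have "\<dots> = (\<Sum>(K, w)\<in>?S \<times> UNIV. scal (ent Y I K) * scal (R $ (K p, K (Suc p)) $ w) * wd (window 0 k (upd2 p K w)))"
    by (rule sum.reindex_bij_witness[of _ ?h ?h]) (auto simp: upd, auto simp: upd2_def fun_eq_iff)
  also have "\<dots> = (\<Sum>K\<in>?S. scal (ent Y I K) * (\<Sum>w\<in>UNIV. scal (R $ (K p, K (Suc p)) $ w) * wd (window 0 k (upd2 p K w))))"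
    by (simp add: sum.cartesian_product[symmetric] sum_distrib_left mult.assoc)
  finally have 1: "row k I (Y * scalar.r p)
      = (\<Sum>K\<in>?S. scal (ent Y I K) * (\<Sum>w\<in>UNIV. scal (R $ (K p, K (Suc p)) $ w) * wd (window 0 k (upd2 p K w))))" .
  have 2: "scal (inverse q) * row k I Y = (\<Sum>K\<in>?S. scal (ent Y I K) * (scal (inverse q) * wd (window 0 k K)))"
    unfolding row_def sum_distrib_left by (intro sum.cong refl \<iota>_left[symmetric])
  have "row k I (Y * scalar.r p) + scal (inverse q) * row k I Y = (\<Sum>K\<in>?S. scal (ent Y I K) *
      (scal (inverse q) * wd (window 0 k K) + (\<Sum>w\<in>UNIV. scal (R $ (K p, K (Suc p)) $ w) * wd (window 0 k (upd2 p K w)))))"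
    unfolding 1 2 by (simp only: sum.distrib distrib_left add.commute)
  also have "\<dots> \<in> wedge_ideal q R"
    unfolding sandwich_window[OF assms] wedge_ideal_eq
    by (intro ideal_sum ideal_left ideal_right ideal_gen) auto
  finally show ?thesis .
qed

text \<open>
  The row of the identity with index \<open>I\<close> is a word, and modulo the ideal it equals the row of the
  skew-symmetrizer, which is zero.
\<close>

lemma asym_zero_imp_wedge_dim:
  assumes "scalar.asym q scalar.r k = 0"
  shows "wedge_dim q R k = 0"
  unfolding wedge_dim_eq_0_iff
proof (intro allI impI)
  interpret c: coefficients "scal :: 'k \<Rightarrow> ('n, 'k) free_algebra" by (rule scal_coefficients)
  fix w :: "'n list" assume w: "length w = k"
  define I where "I = ins 0 k (\<lambda>_. undefined) w"
  let ?D = "{Y. row k I Y \<in> wedge_ideal q R}"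
  have row_add: "row k I (Y + Z) = row k I Y + row k I Z" for Y Z
    by (simp add: row_def c.\<iota>_add distrib_right sum.distrib)
  have row_scl: "row k I (scalar.scl c Y) = scal c * row k I Y" for c Y
    by (simp add: row_def c.\<iota>_mult sum_distrib_left mult.assoc)
  have row_0: "row k I 0 = 0" by (simp add: row_def c.\<iota>_zero)
  have "1 * scalar.asym q scalar.r k - 1 \<in> ?D"
  proof (rule scalar.asym_modulo[OF generic_q])
    show "Y * scalar.r i + scalar.scl (inverse q) Y \<in> ?D" if "1 \<le> i" "i < k" for Y i
      using row_r[OF that, of I Y] by (simp add: row_add row_scl)
  qed (auto simp: row_0 row_add row_scl wedge_ideal_eq two_sided_ideal.zero
      intro: ideal_add ideal_left)
  then have "row k I (- 1) \<in> wedge_ideal q R" using assms by simp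
  then have "row k I (scalar.scl (- 1) (- 1)) \<in> wedge_ideal q R"
    unfolding row_scl wedge_ideal_eq by (rule ideal_left)
  then have "row k I 1 \<in> wedge_ideal q R" by simp
  also have "row k I 1 = (\<Sum>K\<in>{I}. scal (ent 1 I K) * wd (window 0 k K))"
    unfolding row_def
    by (rule sum.mono_neutral_right) (auto simp: sum_agree_off(1) c.\<iota>_zero agree_off_def)
  also have "\<dots> = wd w" using w by (simp add: c.\<iota>_one I_def window_ins)
  finally show "wd w \<in> wedge_ideal q R" .
qed

text \<open>
  A column of the skew-symmetrizer defines a linear functional \<open>\<psi>\<close> on the tensors of degree \<open>k\<close>. It vanishes
  on the ideal, because the generators act on the skew-symmetrizer by \<open>- q\<^sup>-\<^sup>1\<close>. If the ideal contains all
  words of length \<open>k\<close>, then all entries of the column are zero.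
\<close>

lemma wedge_dim_zero_imp_asym:
  assumes "wedge_dim q R k = 0"
  shows "scalar.asym q scalar.r k = 0"
proof (rule rfm_eqI)
  fix I J :: "nat \<Rightarrow> 'n"
  interpret c: coefficients "scal :: 'k \<Rightarrow> ('n, 'k) free_algebra" by (rule scal_coefficients)
  let ?P = "scalar.asym q scalar.r k"
  define \<psi> :: "('n, 'k) free_algebra \<Rightarrow> 'k" where
    "\<psi> x = (\<Sum>w | length w = k. Poly_Mapping.lookup x (Word w) * ent ?P (ins 0 k I w) J)" for x
  have \<psi>_add: "\<psi> (x + y) = \<psi> x + \<psi> y" for x y
    by (simp add: \<psi>_def lookup_add distrib_right sum.distrib)
  have \<psi>_wd: "\<psi> (scal c * wd w) = (if length w = k then c * ent ?P (ins 0 k I w) J else 0)" for c w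
  proof -
    have "\<psi> (scal c * wd w) = (\<Sum>w' | length w' = k. if w' = w then c * ent ?P (ins 0 k I w) J else 0)"
      unfolding \<psi>_def scal_wd by (intro sum.cong refl) (auto simp: lookup_single)
    then show ?thesis by (simp add: sum.delta)
  qed
  have \<psi>_sum: "\<psi> (sum f S) = (\<Sum>x\<in>S. \<psi> (f x))" for f and S :: "('n \<times> 'n) set"
    by (induction S rule: infinite_finite_induct) (simp_all add: \<psi>_add, simp_all add: \<psi>_def)
  have rel: "\<psi> (Poly_Mapping.single u \<alpha> * wedge_relation i j * Poly_Mapping.single v \<beta>) = 0" for u v \<alpha> \<beta> i j
  proof -
    let ?u = "letters u" and ?v = "letters v"
    have "Poly_Mapping.single u \<alpha> * wedge_relation i j * Poly_Mapping.single v \<beta>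
        = scal \<alpha> * wd ?u * wedge_relation i j * (scal \<beta> * wd ?v)"
      by (simp add: scal_wd)
    also have "\<dots> = scal \<alpha> * ((wd ?u * wedge_relation i j) * (scal \<beta> * wd ?v))"
      by (simp only: mult.assoc)
    also have "\<dots> = scal (\<alpha> * \<beta>) * (wd ?u * wedge_relation i j * wd ?v)"
      by (simp only: c.\<iota>_left[of "wd ?u * wedge_relation i j"]) (simp only: c.\<iota>_mult mult.assoc)
    also have "\<dots> = scal (\<alpha> * \<beta> * inverse q) * wd (?u @ [i, j] @ ?v)
        + (\<Sum>w\<in>UNIV. scal (\<alpha> * \<beta> * R $ (i, j) $ w) * wd (?u @ [fst w, snd w] @ ?v))"
      by (simp only: wedge_relation_sandwich) (simp add: distrib_left sum_distrib_left c.\<iota>_mult mult.assoc)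
    finally have eq: "\<psi> (Poly_Mapping.single u \<alpha> * wedge_relation i j * Poly_Mapping.single v \<beta>)
        = \<psi> (scal (\<alpha> * \<beta> * inverse q) * wd (?u @ [i, j] @ ?v))
        + (\<Sum>w\<in>UNIV. \<psi> (scal (\<alpha> * \<beta> * R $ (i, j) $ w) * wd (?u @ [fst w, snd w] @ ?v)))"
      by (simp add: \<psi>_add \<psi>_sum)
    show ?thesis
    proof (cases "length ?u + 2 + length ?v = k")
      case False
      then show ?thesis unfolding eq \<psi>_wd by auto
    next
      case True
      let ?p = "Suc (length ?u)" and ?K = "ins 0 k I (?u @ [i, j] @ ?v)"
      have p: "0 < ?p" "?p < 0 + k" using True by auto
      have id: "map_matrix (\<lambda>x. x) R = R" by (simp add: vec_eq_iff)
      have K: "upd2 ?p ?K w = ins 0 k I (?u @ [fst w, snd w] @ ?v)" for w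
        using True by (auto simp: upd2_def ins_def fun_eq_iff nth_append nth_Cons')
      have Kp: "?K ?p = i" "?K (Suc ?p) = j"
        using True by (auto simp: ins_def nth_append)
      have "ent (scalar.r ?p * ?P) ?K J = ent (scalar.scl (- inverse q) ?P) ?K J"
        using scalar.gen_P[OF p] by simp
      then have "(\<Sum>w\<in>UNIV. R $ (i, j) $ w * ent ?P (ins 0 k I (?u @ [fst w, snd w] @ ?v)) J)
          = - inverse q * ent ?P ?K J"
        by (simp only: scalar.r_def id op2_mult_left K Kp scalar.ent_scl)
      then have "\<alpha> * \<beta> * (inverse q * ent ?P ?K J + (\<Sum>w\<in>UNIV. R $ (i, j) $ w * ent ?P (ins 0 k I (?u @ [fst w, snd w] @ ?v)) J)) = 0"
        by simp
      then show ?thesis unfolding eq \<psi>_wd using True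
        by (simp add: distrib_left sum_distrib_left mult.assoc)
    qed
  qed
  have rel': "\<psi> (a * wedge_relation i j * b) = 0" for a b i j
  proof (induction a rule: additive_induct)
    case (1 u \<alpha>)
    show ?case
      by (induction b rule: additive_induct) (simp_all add: rel distrib_left \<psi>_add)
  qed (simp add: distrib_right \<psi>_add)
  have ideal: "\<psi> x = 0" if "x \<in> wedge_ideal q R" for x
    using that unfolding wedge_ideal_eq
    by (induction rule: two_sided_ideal.induct) (auto simp: \<psi>_add rel', simp add: \<psi>_def)
  have zero: "ent ?P (ins 0 k I w) J = 0" if "length w = k" for w
  proof -
    have "wd w \<in> wedge_ideal q R" using assms that by (simp add: wedge_dim_eq_0_iff)
    then have "\<psi> (scal 1 * wd w) = 0" by (simp add: c.\<iota>_one ideal)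
    then show ?thesis using that by (simp add: \<psi>_wd)
  qed
  have "ins 0 k I (window 0 k I) = I" by (rule ins_window) (simp add: agree_off_def)
  then show "ent ?P I J = ent 0 I J" using zero[of "window 0 k I"] by simp
qed

lemma skew_symm_zero:
  assumes "wedge_dim q R k = 0" "length I = k" "length J = k"
  shows "skew_symm q R k k I J = 0"
proof -
  let ?I = "ins 0 k (\<lambda>_. undefined) I" and ?J = "ins 0 k (\<lambda>_. undefined) J"
  have "emb 0 k (tlift (\<lambda>x. x) (skew_symm q R k k)) = 0"
    using wedge_dim_zero_imp_asym[OF assms(1)] by (simp add: scalar.emb_skew_symm)
  then have "ent (emb 0 k (tlift (\<lambda>x. x) (skew_symm q R k k))) ?I ?J = 0" by simp
  moreover have "agree_off 0 k ?I ?J" by (simp add: agree_off_def ins_def)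
  ultimately show ?thesis using assms by (simp add: emb.rep_eq window_ins tlift_def)
qed

lemma trace_identity:
  assumes "bi_rank q R m 0" "m > 0"
  shows "q ^ m * \<delta> = qnum q m"
proof (rule scalar.trace_one)
  show "scalar.asym q (\<lambda>i. scalar.r (0 + i)) (Suc m) = 0"
    using wedge_dim_zero_imp_asym[OF bi_rank_wedge_dim(2)[OF assms]] by simp
  show "scalar.asym q (\<lambda>i. scalar.r (0 + i)) m \<noteq> 0"
    using asym_zero_imp_wedge_dim bi_rank_wedge_dim(1)[OF assms] by auto
qed (use assms in simp)

end

section \<open>Polynomials with a central variable\<close>

lemma const_add: "const (a + b) = const a + const b"
  by (simp add: const_def single_add)

lemma const_zero: "const 0 = 0"
  by (simp add: const_def)

lemma const_one: "const 1 = 1"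
  by (simp add: const_def)

lemma const_mult: "const (a * b) = const a * const (b :: 'a::ring_1)"
  by (simp add: const_def mult_single)

lemma const_diff: "const (a - b) = const a - const (b :: 'a::ring_1)"
  by (simp add: const_def single_diff)

lemma const_sum: "const (sum f S) = (\<Sum>x\<in>S. const (f x))"
  by (induction S rule: infinite_finite_induct) (simp_all add: const_add const_zero)

lemma cvar_central: "cvar * x = x * (cvar :: 'a::ring_1 cpoly)"
  by (induction x rule: additive_induct) (simp_all add: cvar_def mult_single distrib_left distrib_right add.commute)

lemma cscal_coefficients: "coefficients (cscal :: 'k::field \<Rightarrow> ('n, 'k) entry_algebra cpoly)"
proof -
  interpret coefficients "scal :: 'k \<Rightarrow> ('n, 'k) entry_algebra" by (rule scal_coefficients)
  show ?thesis
  proof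
    fix c d :: 'k and x :: "('n, 'k) entry_algebra cpoly"
    show "cscal (c + d) = cscal c + (cscal d :: ('n, 'k) entry_algebra cpoly)"
      by (simp add: cscal_def \<iota>_add const_add)
    show "cscal (c * d) = cscal c * (cscal d :: ('n, 'k) entry_algebra cpoly)"
      by (simp add: cscal_def \<iota>_mult const_mult)
    show "cscal 1 = (1 :: ('n, 'k) entry_algebra cpoly)"
      by (simp add: cscal_def \<iota>_one const_one)
    show "cscal c * x = x * cscal c"
      by (induction x rule: additive_induct)
         (simp_all add: cscal_def const_def mult_single distrib_left distrib_right \<iota>_central)
  qed
qed

subsection \<open>Elementary symmetric polynomials do not depend on the ambient coefficients\<close>

lemma tlift_const_tmul: "tlift const (tmul n A B) = tmul n (tlift const A) (tlift const (B :: ('n, 'a::ring_1) tensor_op))"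
  by (auto simp: tlift_def tmul_def fun_eq_iff const_sum const_mult)

lemma tlift_const_tone: "tlift const tone = (tone :: ('n, 'a::ring_1 cpoly) tensor_op)"
  by (auto simp: tlift_def tone_def fun_eq_iff const_one const_zero)

lemma tlift_const_tprod:
  "tlift const (tprod n As) = tprod n (map (tlift const) (As :: ('n, 'a::ring_1) tensor_op list))"
  by (induction As) (simp_all add: tprod_def tlift_const_tone tlift_const_tmul)

lemma tlift_const_scal: "tlift const (tlift scal X) = tlift cscal X"
  by (simp add: tlift_def cscal_def fun_eq_iff)

lemma tlift_const_bar_copy:
  "tlift const (bar_copy scal R n L k) = bar_copy cscal R n (map_matrix const L) k"
proof (induction k)
  case 0
  show ?case by (auto simp: tlift_def at1_def fun_eq_iff const_zero)
next
  case (Suc k)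
  have "tlift const (at1 1 L) = at1 1 (map_matrix const L)"
    by (auto simp: tlift_def at1_def fun_eq_iff const_zero)
  then show ?case using Suc by (simp add: tlift_const_tprod tlift_const_scal)
qed

lemma const_R_trace:
  fixes \<Psi> :: "('n::finite, 'k::field) matrix2" and X :: "('n, ('n, 'k) entry_algebra) tensor_op"
  shows "const (R_trace scal \<Psi> n X) = R_trace cscal \<Psi> n (tlift const X)"
proof -
  have "const (ttrace n A) = ttrace n (tlift const A)" for A :: "('n, ('n, 'k) entry_algebra) tensor_op"
    by (simp add: ttrace_def const_sum tlift_def)
  then show ?thesis by (simp add: R_trace_def tlift_const_tmul tlift_const_scal)
qed

lemma const_elem_symm:
  fixes L :: "('n::finite, ('n, 'k::field) entry_algebra) matrix1"
  shows "const (elem_symm scal q R \<Psi> L k) = elem_symm cscal q R \<Psi> (map_matrix const L) k"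
  by (simp add: elem_symm_def const_one const_R_trace tlift_const_tmul tlift_const_tprod tlift_const_scal
      tlift_const_bar_copy o_def)

section \<open>Operators in the first position\<close>

lemma op1_mult: "op1 p (M ** N) = op1 p M * op1 p (N :: ('n::finite, 'a::ring_1) matrix1)"
proof -
  have fc: "first_copy M ** first_copy N = first_copy (M ** N)"
  proof -
    have "(\<Sum>w\<in>UNIV. (if snd u = snd w then M $ fst u $ fst w else 0) * (if snd w = snd v then N $ fst w $ fst v else 0))
        = (if snd u = snd v then \<Sum>k\<in>UNIV. M $ fst u $ k * N $ k $ fst v else 0)" for u v :: "'n \<times> 'n"
    proof -
      have "(\<Sum>w\<in>UNIV. (if snd u = snd w then M $ fst u $ fst w else 0) * (if snd w = snd v then N $ fst w $ fst v else 0))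
        = (\<Sum>k\<in>UNIV. \<Sum>l\<in>UNIV. if l = snd u then (if snd u = snd v then M $ fst u $ k * N $ k $ fst v else 0) else 0)"
        unfolding UNIV_Times_UNIV[symmetric] sum.cartesian_product by (intro sum.cong refl) auto
      then show ?thesis by simp
    qed
    then show ?thesis by (simp add: vec_eq_iff matrix_matrix_mult_def first_copy_def)
  qed
  have "op1 p (M ** N) = op2 p (first_copy M ** first_copy N)" by (simp only: fc op2_first_copy)
  also have "\<dots> = op1 p M * op1 p N" by (simp only: op2_mult op2_first_copy)
  finally show ?thesis .
qed

lemma op1_mat: "op1 p (mat c) = (dg c :: ('n::finite, 'a::ring_1) oper)"
  by (rule rfm_eqI) (auto simp: op1.rep_eq dg.rep_eq mat_def fun_eq_iff)

lemma op1_add: "op1 p (M + N) = op1 p M + op1 p (N :: ('n::finite, 'a::ring_1) matrix1)"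
  by (rule rfm_eqI) (auto simp: op1.rep_eq)

lemma op1_diff: "op1 p (M - N) = op1 p M - op1 p (N :: ('n::finite, 'a::ring_1) matrix1)"
  by (rule rfm_eqI) (auto simp: op1.rep_eq)

lemma op1_power: "op1 p M ^ k = op1 p (mpow (M :: ('n::finite, 'a::ring_1) matrix1) k)"
  by (induction k) (simp_all add: op1_mult op1_mat dg_one)

lemma dg_inject: "dg c = (dg d :: ('i, 'a::zero) rfm) \<Longrightarrow> c = d"
  by (drule arg_cong[of _ _ "\<lambda>X. ent X undefined undefined"]) (simp add: dg.rep_eq)

lemma dg_power: "dg c ^ k = dg (c ^ k :: 'a::ring_1)"
  by (induction k) (simp_all add: dg_mult dg_one)

lemma dg_sum: "dg (sum f S) = (\<Sum>x\<in>S. dg (f x :: 'a::ring_1))"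
  by (induction S rule: infinite_finite_induct) (simp_all add: dg_add dg_zero)

context hecke_model_matrix
begin

text \<open>
  Scalar matrices are not changed by conjugation, so adding a scalar to \<open>L\<close> adds it to every barred copy.
\<close>

lemma emb_bar_copy_shift:
  "1 \<le> k \<Longrightarrow> k \<le> n \<Longrightarrow> emb 0 n (bar_copy \<iota> R n (L + mat (\<iota> h)) k) = ell k + scl h 1"
proof (induction k)
  case (Suc k)
  show ?case
  proof (cases "k = 0")
    case False
    have "emb 0 n (bar_copy \<iota> R n (L + mat (\<iota> h)) (Suc k)) = r k * (ell k + scl h 1) * rinv k"
      using Suc op2_map_R'[of k] False
      by (simp add: emb_tprod tlift_at2 emb_at2 matrix_inv_R rinv_def mult.assoc flip: r_def)
    also have "\<dots> = ell (Suc k) + scl h 1"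
      using False r_rinv[of k] by (simp add: ell_Suc distrib_left distrib_right scl_left scl_right)
    finally show ?thesis .
  qed (use Suc.prems in \<open>simp add: emb_at1 ell_1 op1_add op1_mat scl_dg\<close>)
qed simp

lemma pf_eq_prod_list:
  "pf s m = prod_list (map (\<lambda>k. scl (q ^ (2 * (k - 1))) s - ell k) [1..<Suc m])"
  by (induction m) simp_all

end

section \<open>The product formula for the characteristic polynomial\<close>

context skew_invertible_hecke
begin

text \<open>
  With \<open>h = 1 / (q - q\<^sup>-\<^sup>1)\<close>, the identity \<open>q\<^bsup>2(k-1)\<^esup> q\<^bsup>-(k-1)\<^esup> [k - 1] = (q\<^bsup>2(k-1)\<^esup> - 1) h\<close> turns the
  \<open>k\<close>-th factor into \<open>q\<^bsup>2(k-1)\<^esup> (t - h)\<close> minus the barred copy of \<open>L = L\<^sup>~ - h\<close>.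
\<close>

lemma mre_product_formula:
  assumes \<delta>: "q ^ m * \<delta> = qnum q m"
  shows "mre_char_poly q R \<Psi> m = cscal (q ^ m) * R_trace cscal \<Psi> m
    (tmul m (tlift cscal (skew_symm q R m m)) (tprod m (map (mre_factor q R m) [1..<Suc m])))"
proof -
  let ?h = "inverse (q - inverse q)"
  let ?L = "map_matrix const (re_matrix q) :: ('n, ('n, 'k) entry_algebra cpoly) matrix1"
  let ?t = "cvar - cscal ?h :: ('n, 'k) entry_algebra cpoly"
  interpret M: hecke_model_matrix q R \<Psi> "cscal :: 'k \<Rightarrow> ('n, 'k) entry_algebra cpoly" ?L
    by (intro hecke_model_matrix.intro hecke_model.intro skew_invertible_hecke_axioms cscal_coefficients)
  have t_central: "?t * x = x * ?t" for x
    by (simp add: left_diff_distrib right_diff_distrib cvar_central M.\<iota>_central)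
  have gm: "map_matrix const gen_matrix = ?L + mat (cscal ?h)"
    by (auto simp: vec_eq_iff re_matrix_def mat_def const_diff cscal_def const_zero)
  have factor: "emb 0 m (mre_factor q R m k) = M.scl (q ^ (2 * (k - 1))) (dg ?t) - M.ell k"
    if k: "1 \<le> k" "k \<le> m" for k
  proof -
    let ?j = "k - 1"
    have q: "q \<noteq> 0" "q - inverse q \<noteq> 0" using generic_q generic_diff by auto
    have "q ^ (2 * ?j) * (inverse q ^ ?j * qnum q ?j) = (q ^ (2 * ?j) - 1) * ?h"
    proof -
      have "q ^ (2 * ?j) * inverse q ^ ?j = q ^ ?j"
        using q by (simp add: mult_2 power_add power_inverse)
      moreover have "q ^ ?j * (q ^ ?j - inverse q ^ ?j) = q ^ (2 * ?j) - 1"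
        using q by (simp add: right_diff_distrib mult_2 power_add power_inverse)
      ultimately show ?thesis by (simp add: qnum_def divide_inverse flip: mult.assoc)
    qed
    then have "cscal (q ^ (2 * ?j)) * cscal (inverse q ^ ?j * qnum q ?j)
        = cscal (q ^ (2 * ?j)) * cscal ?h - (cscal ?h :: ('n, 'k) entry_algebra cpoly)"
      by (simp add: left_diff_distrib M.\<iota>_diff flip: M.\<iota>_mult)
    then have "cscal (q ^ (2 * ?j)) * (cvar - cscal (inverse q ^ ?j * qnum q ?j))
        = cscal (q ^ (2 * ?j)) * ?t + cscal ?h"
      by (simp add: right_diff_distrib)
    then have "emb 0 m (mre_factor q R m k)
        = dg (cscal (q ^ (2 * ?j)) * ?t + cscal ?h) - emb 0 m (bar_copy cscal R m (?L + mat (cscal ?h)) k)"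
      unfolding mre_factor_def by (simp only: emb_diff emb_scale emb_tone mult_1_right gm)
    also have "\<dots> = M.scl (q ^ (2 * ?j)) (dg ?t) - M.ell k"
      using k by (simp add: M.emb_bar_copy_shift dg_add dg_mult M.scl_dg) (simp add: M.scl_def)
    finally show ?thesis .
  qed
  have "emb 0 m (tprod m (map (mre_factor q R m) [1..<Suc m])) = M.pf (dg ?t) m"
    unfolding emb_tprod M.pf_eq_prod_list map_map by (rule arg_cong[of _ _ prod_list]) (auto simp: factor simp del: upt_Suc)
  then have "dg (cscal (q ^ m) * R_trace cscal \<Psi> m
      (tmul m (tlift cscal (skew_symm q R m m)) (tprod m (map (mre_factor q R m) [1..<Suc m]))))
    = M.scl (q ^ m) (M.T m (M.pf (dg ?t) m))"
    by (simp add: dg_mult M.scl_def M.T_def emb_mult M.emb_skew_symm flip: M.tr_emb del: upt_Suc)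
  also have "\<dots> = (\<Sum>j\<le>m. M.scl ((- q) ^ j) (dg ?t ^ (m - j) * M.e j))"
  proof (rule M.product_formula[OF \<delta>])
    show "dg ?t \<in> A_upto 0" by (simp add: A_upto_def indep_dg)
    show "dg ?t * x = x * dg ?t" for x :: "('n, ('n, 'k) entry_algebra cpoly) oper"
      by (rule rfm_eqI) (simp add: t_central)
  qed
  also have "\<dots> = dg (mre_char_poly q R \<Psi> m)"
    unfolding mre_char_poly_def char_poly_at_def dg_sum
  proof (rule sum.cong[OF refl])
    fix j
    have "dg ((cvar - const (scal ?h)) ^ (m - j) * const (scal ((- q) ^ j) * elem_symm scal q R \<Psi> (re_matrix q) j))
        = dg ?t ^ (m - j) * (dg (cscal ((- q) ^ j)) * M.e j)"
      by (simp add: cscal_def[symmetric] const_mult const_elem_symm dg_mult dg_power M.dg_elem_symm)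
    then show "M.scl ((- q) ^ j) (dg ?t ^ (m - j) * M.e j)
        = dg ((cvar - const (scal ?h)) ^ (m - j) * const (scal ((- q) ^ j) * elem_symm scal q R \<Psi> (re_matrix q) j))"
      using M.scl_right[of "dg ?t ^ (m - j)" "(- q) ^ j" "M.e j"] by (simp add: M.scl_def)
  qed
  finally show ?thesis by (rule dg_inject[OF sym])
qed

section \<open>The Cayley-Hamilton identity in the modified algebra\<close>

text \<open>
  The shift \<open>L = L\<^sup>~ - h\<close> turns the relations of the modified algebra into the reflection equation: the
  difference of the two is \<open>h (R\<^sup>2 L\<^sub>1 - L\<^sub>1 R\<^sup>2) = R L\<^sub>1 - L\<^sub>1 R\<close>, by the Hecke relation and
  \<open>h (q - q\<^sup>-\<^sup>1) = 1\<close>. The identity is read off from the entries in the first position.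
\<close>

lemma mre_cayley_hamilton:
  assumes \<delta>: "q ^ m * \<delta> = qnum q m" and zero: "\<And>I J. length I = Suc m \<Longrightarrow> length J = Suc m \<Longrightarrow> skew_symm q R (Suc m) (Suc m) I J = 0"
  shows "(\<Sum>j\<le>m. mpow (re_matrix q) (m - j) $ a $ b * (scal ((- q) ^ j) * elem_symm scal q R \<Psi> (re_matrix q) j)) \<in> mre_ideal R"
proof -
  let ?h = "inverse (q - inverse q)" and ?l = "q - inverse q"
  interpret M: hecke_model_matrix q R \<Psi> "scal :: 'k \<Rightarrow> ('n, 'k) entry_algebra" "re_matrix q"
    by (intro hecke_model_matrix.intro hecke_model.intro skew_invertible_hecke_axioms scal_coefficients)
  define J where "J = {X :: ('n, ('n, 'k) entry_algebra) oper. \<forall>I J. ent X I J \<in> mre_ideal R}"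
  have reflection: "M.r 1 * op1 1 (re_matrix q) * M.r 1 * op1 1 (re_matrix q)
      - op1 1 (re_matrix q) * M.r 1 * op1 1 (re_matrix q) * M.r 1 = op2 1 (mre_relations R)"
  proof -
    let ?r = "M.r 1" and ?g = "op1 1 gen_matrix :: ('n, ('n, 'k) entry_algebra) oper"
    have l: "op1 1 (re_matrix q) = ?g - M.scl ?h 1"
      by (simp add: re_matrix_def op1_diff op1_mat M.scl_dg)
    have rr: "?r * ?r = 1 + M.scl ?l ?r" by (rule M.quadratic) simp
    have "(?r * (?g - M.scl ?h 1) * ?r * (?g - M.scl ?h 1) - (?g - M.scl ?h 1) * ?r * (?g - M.scl ?h 1) * ?r)
        = (?r * ?g * ?r * ?g - ?g * ?r * ?g * ?r) - M.scl ?h ((?r * ?r) * ?g - ?g * (?r * ?r))"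
      by (simp add: left_diff_distrib right_diff_distrib M.scl_left M.scl_right mult.assoc M.scale_right_diff_distrib)
    also have "(?r * ?r) * ?g - ?g * (?r * ?r) = M.scl ?l (?r * ?g - ?g * ?r)"
      unfolding rr by (simp add: distrib_left distrib_right M.scl_left M.scl_right M.scale_right_diff_distrib)
    also have "M.scl ?h (M.scl ?l (?r * ?g - ?g * ?r)) = ?r * ?g - ?g * ?r"
      using generic_diff[OF generic_q] by simp
    also have "(?r * ?g * ?r * ?g - ?g * ?r * ?g * ?r) - (?r * ?g - ?g * ?r) = op2 1 (mre_relations R)"
      by (simp add: mre_relations_def Let_def op2_diff op2_mult M.r_def flip: op2_first_copy)
    finally show ?thesis unfolding l .
  qed
  interpret reflection_ideal M.scl q \<delta> M.r M.E A_upto "op1 (Suc 0) (re_matrix q)" J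
  proof unfold_locales
    show "0 \<in> J" by (simp add: J_def mre_ideal_def two_sided_ideal.zero)
    show "x - y \<in> J" if "x \<in> J" "y \<in> J" for x y
      using that by (simp add: J_def mre_ideal_def ideal_diff)
    show "y * x \<in> J" if "x \<in> J" for x y
      using that by (simp add: J_def mre_ideal_def times_rfm.rep_eq ideal_sum ideal_left)
    show "x * y \<in> J" if "x \<in> J" for x y
      using that by (simp add: J_def mre_ideal_def times_rfm.rep_eq ideal_sum ideal_right)
    show "M.E i x \<in> J" if "x \<in> J" for i x
      using that by (simp add: J_def mre_ideal_def M.E_def ptr.rep_eq two_sided_ideal.zero ideal_sum ideal_left)
    have "mre_relations R $ u $ v \<in> mre_ideal R" for u v
      unfolding mre_ideal_def by (rule ideal_gen) auto
    then have "op2 1 (mre_relations R) \<in> J"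
      by (auto simp: J_def op2.rep_eq mre_ideal_def two_sided_ideal.zero)
    then show "M.r 1 * op1 (Suc 0) (re_matrix q) * M.r 1 * op1 (Suc 0) (re_matrix q)
      - op1 (Suc 0) (re_matrix q) * M.r 1 * op1 (Suc 0) (re_matrix q) * M.r 1 \<in> J"
      using reflection by simp
  qed
  have "emb 0 (Suc m) (tlift scal (skew_symm q R (Suc m) (Suc m))) = emb 0 (Suc m) (\<lambda>_ _. 0 :: ('n, 'k) entry_algebra)"
    by (rule emb_cong) (simp add: tlift_def zero M.\<iota>_zero del: skew_symm.simps)
  also have "\<dots> = 0" by (rule rfm_eqI) (simp add: emb.rep_eq)
  finally have P0: "M.P 0 (Suc m) = 0" by (simp add: M.emb_skew_symm del: skew_symm.simps)
  have S: "(\<Sum>j\<le>m. M.scl ((- q) ^ j) (op1 (Suc 0) (re_matrix q) ^ (m - j) * M.e j)) \<in> J"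
    by (rule cayley_hamilton[OF \<delta> P0])
  let ?I = "(\<lambda>_. undefined)(Suc 0 := a)" and ?J = "(\<lambda>_. undefined)(Suc 0 := b)"
  have "ent (M.scl ((- q) ^ j) (op1 (Suc 0) (re_matrix q) ^ (m - j) * M.e j)) ?I ?J
      = mpow (re_matrix q) (m - j) $ a $ b * (scal ((- q) ^ j) * elem_symm scal q R \<Psi> (re_matrix q) j)" for j
    by (simp add: op1_power op1.rep_eq M.\<iota>_left flip: M.dg_elem_symm)
  then have "(\<Sum>j\<le>m. mpow (re_matrix q) (m - j) $ a $ b * (scal ((- q) ^ j) * elem_symm scal q R \<Psi> (re_matrix q) j))
      = ent (\<Sum>j\<le>m. M.scl ((- q) ^ j) (op1 (Suc 0) (re_matrix q) ^ (m - j) * M.e j)) ?I ?J"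
    by (simp add: ent_sum)
  then show ?thesis using S by (simp add: J_def)
qed

end

lemma eval_at_matrix_superset:
  assumes "finite S" "Poly_Mapping.keys Q \<subseteq> S"
  shows "eval_at_matrix Q L $ i $ j = (\<Sum>r\<in>S. mpow L r $ i $ j * Poly_Mapping.lookup Q r)"
  unfolding eval_at_matrix_def using assms by (auto simp: in_keys_iff intro!: sum.mono_neutral_left)

lemma eval_at_matrix_add: "eval_at_matrix (P + Q) L = eval_at_matrix P L + eval_at_matrix Q L"
proof -
  have "eval_at_matrix (P + Q) L $ i $ j = eval_at_matrix P L $ i $ j + eval_at_matrix Q L $ i $ j" for i j
    using eval_at_matrix_superset[of "Poly_Mapping.keys P \<union> Poly_Mapping.keys Q" _ L i j]
    by (simp add: keys_add lookup_add distrib_left sum.distrib)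
  then show ?thesis by (simp add: vec_eq_iff)
qed

lemma eval_at_matrix_zero: "eval_at_matrix 0 L = 0"
  by (simp add: eval_at_matrix_def vec_eq_iff)

lemma eval_at_matrix_sum: "eval_at_matrix (sum f S) L = (\<Sum>x\<in>S. eval_at_matrix (f x) L)"
  by (induction S rule: infinite_finite_induct) (simp_all add: eval_at_matrix_add eval_at_matrix_zero)

lemma eval_at_matrix_single: "eval_at_matrix (Poly_Mapping.single r x) L $ i $ j = mpow L r $ i $ j * x"
  by (subst eval_at_matrix_superset[of "{r}"]) auto

lemma eval_at_matrix_linear_factor:
  fixes G :: "('n::finite, 'a::ring_1) matrix1"
  assumes "\<And>x. d * x = x * d"
  shows "eval_at_matrix ((cvar - const d) * Q) G = (G - mat d) ** eval_at_matrix Q G"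
proof (induction Q rule: additive_induct)
  case (1 r x)
  have "(cvar - const d) * Poly_Mapping.single r x = Poly_Mapping.single (Suc r) x + Poly_Mapping.single r (- (d * x))"
    by (simp add: left_diff_distrib cvar_def const_def mult_single single_uminus)
  moreover have "(\<Sum>k\<in>UNIV. (mat d :: ('n, 'a) matrix1) $ i $ k * (mpow G r $ k $ j * x)) = d * (mpow G r $ i $ j * x)" for i j
    by (simp add: mat_def if_distrib[of "\<lambda>y. y * _"] cong: if_cong)
  ultimately show ?case
    by (simp add: vec_eq_iff eval_at_matrix_add eval_at_matrix_single matrix_matrix_mult_def left_diff_distrib
        sum_subtractf sum_distrib_right mult.assoc)
       (metis assms mult.assoc)
next
  case (2 P Q)
  then show ?case by (simp add: distrib_left eval_at_matrix_add matrix_add_ldistrib)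
qed

lemma eval_at_matrix_linear_power:
  fixes G :: "('n::finite, 'a::ring_1) matrix1"
  assumes "\<And>x. d * x = x * d"
  shows "eval_at_matrix ((cvar - const d) ^ k * const x) G $ i $ j = mpow (G - mat d) k $ i $ j * x"
proof (induction k arbitrary: i j)
  case 0
  show ?case by (simp add: const_def eval_at_matrix_single)
next
  case (Suc k)
  have "eval_at_matrix ((cvar - const d) ^ Suc k * const x) G = (G - mat d) ** eval_at_matrix ((cvar - const d) ^ k * const x) G"
    using eval_at_matrix_linear_factor[OF assms, of "(cvar - const d) ^ k * const x" G] by (simp add: mult.assoc)
  then show ?case by (simp add: matrix_matrix_mult_def Suc sum_distrib_right mult.assoc)
qed

theorem corollary7:
  fixes q :: "'k::real_normed_field"
    and R \<Psi> :: "('n::finite, 'k) matrix2"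
    and m :: nat
  assumes "hecke_symmetry q R"
    and "generic q"
    and "skew_inverse R \<Psi>"
    and "bi_rank q R m 0"
    and "m \<ge> 2"
  shows "mre_matrix_eq R (eval_at_matrix (mre_char_poly q R \<Psi> m) gen_matrix) 0 \<and>
    mre_poly_eq R (mre_char_poly q R \<Psi> m)
      (cscal (q ^ m) * R_trace cscal \<Psi> m
        (tmul m (tlift cscal (skew_symm q R m m))
                (tprod m (map (mre_factor q R m) [1..<Suc m]))))"
proof
  interpret skew_invertible_hecke q R \<Psi> by standard (fact assms)+
  interpret c: coefficients "scal :: 'k \<Rightarrow> ('n, 'k) entry_algebra" by (rule scal_coefficients)
  have m: "m > 0" using assms(5) by simp
  note \<delta> = trace_identity[OF assms(4) m]
  have zero: "skew_symm q R (Suc m) (Suc m) I J = 0" if "length I = Suc m" "length J = Suc m" for I J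
    by (rule skew_symm_zero[OF bi_rank_wedge_dim(2)[OF assms(4) m] that])
  show "mre_matrix_eq R (eval_at_matrix (mre_char_poly q R \<Psi> m) gen_matrix) 0"
    unfolding mre_matrix_eq_def mre_eq_def
  proof (intro allI)
    fix a b
    have "eval_at_matrix (mre_char_poly q R \<Psi> m) gen_matrix $ a $ b
        = (\<Sum>j\<le>m. mpow (re_matrix q) (m - j) $ a $ b * (scal ((- q) ^ j) * elem_symm scal q R \<Psi> (re_matrix q) j))"
      by (simp add: mre_char_poly_def char_poly_at_def eval_at_matrix_sum
          eval_at_matrix_linear_power[OF c.\<iota>_central] flip: re_matrix_def)
    also have "\<dots> \<in> mre_ideal R" by (rule mre_cayley_hamilton[OF \<delta> zero])
    finally show "eval_at_matrix (mre_char_poly q R \<Psi> m) gen_matrix $ a $ b - (0 :: ('n, ('n, 'k) entry_algebra) matrix1) $ a $ b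
        \<in> mre_ideal R"
      by (simp only: zero_index diff_0_right)
  qed
  show "mre_poly_eq R (mre_char_poly q R \<Psi> m)
      (cscal (q ^ m) * R_trace cscal \<Psi> m
        (tmul m (tlift cscal (skew_symm q R m m))
                (tprod m (map (mre_factor q R m) [1..<Suc m]))))"
    unfolding mre_product_formula[OF \<delta>, symmetric]
    by (simp add: mre_poly_eq_def mre_eq_def mre_ideal_def two_sided_ideal.zero)
qed

end
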